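(* For any $\phi\in H^{1/2}(\mathbb{R})$ one has $$(\phi,T\phi)+\tfrac{2}{\pi}\|\phi\|_2^2\ \ge\ \left(\tfrac{\pi}{2}\right)^{1/3}\|\phi\|_3^2,$$ with equality if and only if there are $\alpha\in\mathbb{R}$ and $\beta\in\mathbb{C}$ such that $\phi(t)=\beta\,h(t-\alpha)$, where $h(t)=\dfrac{1}{\cosh t}$.
   Context: Functions are complex-valued and $\|\cdot\|_p$ denotes the norm of $L^p(\mathbb{R})$. The Fourier transform on $\mathbb{R}$ is $\widehat\phi(\tau)=(2\pi)^{-1/2}\int_{\mathbb{R}} e^{-i\tau t}\phi(t)\,dt$. $T$ is the non-local pseudo-differential operator given by $$\widehat{T\phi}(\tau)=\left(\tau\coth(\pi\tau/2)-2/\pi\right)\widehat\phi(\tau),$$ (the function $\tau\coth(\pi\tau/2)$ is extended by its limit $2/\pi$ at $\tau=0$), and $(\phi,T\phi)$ is understood as the quadratic form $\int_{\mathbb{R}}\left(\tau\coth(\pi\tau/2)-2/\pi\right)|\widehat\phi(\tau)|^2\,d\tau$, which is finite for $\phi\in H^{1/2}(\mathbb{R})$. *)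

theory Defs
  imports "HOL-Analysis.Analysis"
begin

text \<open>
  Elements of \<open>L\<^sup>p(\<real>)\<close> are represented by Lebesgue measurable functions; identities between
  such elements are to be read almost everywhere.
\<close>

definition Lp_space :: "real \<Rightarrow> (real \<Rightarrow> complex) set" where
  "Lp_space p = {f \<in> borel_measurable lebesgue. integrable lebesgue (\<lambda>t. norm (f t) powr p)}"

text \<open>
  The Bochner integral is \<open>0\<close> for non-integrable functions, so this is the usual norm only on
  \<^const>\<open>Lp_space\<close>; membership has to be stated separately.
\<close>

definition Lp_norm :: "real \<Rightarrow> (real \<Rightarrow> complex) \<Rightarrow> real" where
  "Lp_norm p f = (\<integral>t. norm (f t) powr p \<partial>lebesgue) powr (1 / p)"

definition truncated_fourier :: "real \<Rightarrow> (real \<Rightarrow> complex) \<Rightarrow> real \<Rightarrow> complex" where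
  "truncated_fourier R f \<tau> =
     complex_of_real ((2 * pi) powr (- 1 / 2)) *
     (LINT t:{-R..R}|lebesgue. exp (- (\<i> * of_real \<tau> * of_real t)) * f t)"

text \<open>
  The Fourier integral need not converge for \<open>f\<close> in \<open>L\<^sup>2\<close>. Following Plancherel, the transform
  is the \<open>L\<^sup>2\<close>-limit of the transforms of the truncations of \<open>f\<close> to \<open>[-R, R]\<close>; the limit is
  determined up to a null set, and one representative is chosen.
\<close>

definition is_fourier_L2 :: "(real \<Rightarrow> complex) \<Rightarrow> (real \<Rightarrow> complex) \<Rightarrow> bool" where
  "is_fourier_L2 f g \<longleftrightarrow> g \<in> Lp_space 2 \<and>
     ((\<lambda>R. \<integral>\<^sup>+\<tau>. ennreal ((norm (truncated_fourier R f \<tau> - g \<tau>))\<^sup>2) \<partial>lebesgue) \<longlongrightarrow> 0) at_top"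

definition fourier_L2 :: "(real \<Rightarrow> complex) \<Rightarrow> real \<Rightarrow> complex" where
  "fourier_L2 f = (SOME g. is_fourier_L2 f g)"

text \<open>The Sobolev space \<open>H\<^sup>s(\<real>)\<close>, for \<open>s \<ge> 0\<close>.\<close>

definition Sobolev_space :: "real \<Rightarrow> (real \<Rightarrow> complex) set" where
  "Sobolev_space s = {f \<in> Lp_space 2.
     integrable lebesgue (\<lambda>\<tau>. (1 + \<tau>\<^sup>2) powr s * (norm (fourier_L2 f \<tau>))\<^sup>2)}"

definition coth :: "real \<Rightarrow> real" where
  "coth x = cosh x / sinh x"

definition T_symbol :: "real \<Rightarrow> real" where
  "T_symbol \<tau> = (if \<tau> = 0 then 2 / pi else \<tau> * coth (pi * \<tau> / 2)) - 2 / pi"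

definition T_form :: "(real \<Rightarrow> complex) \<Rightarrow> real" where
  "T_form f = (\<integral>\<tau>. T_symbol \<tau> * (norm (fourier_L2 f \<tau>))\<^sup>2 \<partial>lebesgue)"

end

theory Submission
  imports Defs "HOL-Probability.Probability" "HOL-Real_Asymp.Real_Asymp"
begin

text \<open>
  The symbol of \<open>T\<close> equals \<open>(2\<pi>)\<inverse> \<integral> \<bar>exp (\<i>\<tau>s) - 1\<bar>\<^sup>2 / sinh\<^sup>2 s ds\<close>, so that replacing \<open>\<phi>\<close> by \<open>\<bar>\<phi>\<bar>\<close> does
  not increase the left-hand side \<open>Q\<close>, and strictly decreases it unless \<open>\<phi>\<close> has constant phase.

  Let \<open>\<phi> \<ge> 0\<close>. In the variable \<open>\<theta> \<in> (0, \<pi>)\<close> with \<open>t = ln tan (\<theta>/2)\<close>, in which \<open>1 / cosh t = sin \<theta>\<close>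
  and \<open>dt = d\<theta> / sin \<theta>\<close>, write \<open>\<phi> = \<Sum> \<beta>\<^sub>m sin ((m + 1) \<theta>)\<close>. Then \<open>Q = (\<pi>/2) \<Sum> (m + 1) \<beta>\<^sub>m\<^sup>2\<close>, which is
  \<open>(\<pi>/2) tr H\<^sup>2\<close> for the Hankel matrix \<open>H = (\<beta>\<^bsub>x+y\<^esub>)\<close>, and the Clebsch-Gordan rule for \<open>SU(2)\<close> gives
  \<open>\<integral> \<phi>\<^sup>3 dt = (\<pi>/2) tr H\<^sup>3\<close>. The inequality is therefore \<open>tr H\<^sup>3 \<le> (tr H\<^sup>2)\<^bsup>3/2\<^esup>\<close>. Equality forces \<open>H\<close> to
  have rank one, that is \<open>\<beta>\<^sub>m = c q\<^sup>m\<close>, and then \<open>\<phi> = c sin \<theta> / (1 - 2 q cos \<theta> + q\<^sup>2)\<close> is a multiple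
  of a translate of \<open>1 / cosh\<close>.

  Only \<open>Q \<ge> (\<pi>/2) tr H\<^sup>2\<close> and \<open>\<integral> \<phi>\<^sup>3 \<le> (\<pi>/2) tr H\<^sup>3\<close> are needed. The first follows by comparing the
  energy with Poisson kernels, the second by Fatou's lemma, since the Abel means of the sine series
  are nonnegative.
\<close>

section \<open>Hankel matrices\<close>

text \<open>An equality case does not pass through limits by itself, and the trace identity is
  available for finite sine polynomials only. The defect is therefore carried quantitatively: each
  cubic bound contains the square of the minor \<open>c 0 * c (z + k) - c k * c z\<close> of
  \<open>H\<close>, which survives truncation, the Abel limit and Fatou's lemma. If equality holds
  in the end, all these minors of the limiting coefficients vanish, and they already force a
  geometric sequence.

  The energy and the coefficients are compared through
  \<open>\<integral> f\<^sup>2 - \<integral> f (A f)\<close>, where \<open>A f\<close> is the Abel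
  mean with parameter \<open>\<rho>\<close>. Bessel's inequality bounds it from below, the double
  integral from above, and the common factor \<open>1 - \<rho>\<close> is cancelled before
  \<open>\<rho>\<close> tends to one.

  The constants fit because \<open>2\<pi> Q\<close> is the \<open>sinh\<close> energy plus four
  times the squared norm, which is exactly the angular energy for real functions.

  The transform in \<open>T_form\<close> is a chosen limit of truncated transforms. It enters only
  through Plancherel's identity for the differences \<open>f (t + s) - f t\<close>, integrated
  against \<open>1 / sinh\<^sup>2 s\<close>. Cubic integrability is a by-product of the
  estimate.\<close>

lemma lagrange_two_term:
  fixes a b :: "nat \<Rightarrow> real"
  assumes "j < N" "k < N"
  shows "(\<Sum>y<N. a y * b y)\<^sup>2 \<le> (\<Sum>y<N. (a y)\<^sup>2) * (\<Sum>y<N. (b y)\<^sup>2) - (a j * b k - a k * b j)\<^sup>2"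
proof (cases "j = k")
  case True
  then show ?thesis using Cauchy_Schwarz_ineq_sum[of a b "{..<N}"] by simp
next
  case False
  let ?g = "\<lambda>p. (a (fst p) * b (snd p) - a (snd p) * b (fst p))\<^sup>2"
  \<comment> \<open>Lagrange's identity: the defect in Cauchy-Schwarz is half the sum of all squared
    minors. Only the pairs \<open>(j, k)\<close> and \<open>(k, j)\<close> are kept below.\<close>
  have eq: "(\<Sum>p\<in>{..<N}\<times>{..<N}. ?g p)
      = 2 * ((\<Sum>y<N. (a y)\<^sup>2) * (\<Sum>y<N. (b y)\<^sup>2) - (\<Sum>y<N. a y * b y)\<^sup>2)"
  proof -
    have "(\<Sum>p\<in>{..<N}\<times>{..<N}. ?g p) = (\<Sum>x<N. \<Sum>y<N. (a x)\<^sup>2 * (b y)\<^sup>2 + (b x)\<^sup>2 * (a y)\<^sup>2 - 2 * ((a x * b x) * (a y * b y)))"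
      by (simp add: sum.cartesian_product power2_eq_square algebra_simps case_prod_beta)
    also have "\<dots> = 2 * ((\<Sum>y<N. (a y)\<^sup>2) * (\<Sum>y<N. (b y)\<^sup>2) - (\<Sum>y<N. a y * b y)\<^sup>2)"
      by (simp add: sum.distrib sum_subtractf flip: sum_distrib_left sum_distrib_right)
         (simp add: algebra_simps power2_eq_square)
    finally show ?thesis .
  qed
  have "(\<Sum>p\<in>{(j,k),(k,j)}. ?g p) \<le> (\<Sum>p\<in>{..<N}\<times>{..<N}. ?g p)"
    by (rule sum_mono2) (use assms in auto)
  moreover have "(\<Sum>p\<in>{(j,k),(k,j)}. ?g p) = 2 * (a j * b k - a k * b j)\<^sup>2"
    using False by (simp add: power2_commute)
  ultimately show ?thesis unfolding eq by simp
qed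

text \<open>The antidiagonal \<open>x + z = m\<close> has \<open>m + 1\<close> entries. Since
  \<open>c\<close> vanishes from \<open>N\<close> on, the square may be cut down to the triangle
  \<open>x + z < N\<close>.\<close>

lemma hankel_norm:
  fixes c :: "nat \<Rightarrow> real"
  assumes c: "\<And>m. N \<le> m \<Longrightarrow> c m = 0"
  shows "(\<Sum>x<N. \<Sum>z<N. (c (x + z))\<^sup>2) = (\<Sum>m<N. real (m + 1) * (c m)\<^sup>2)"
proof -
  have "(\<Sum>x<N. \<Sum>z<N. (c (x + z))\<^sup>2) = (\<Sum>(x, z)\<in>{..<N} \<times> {..<N}. (c (x + z))\<^sup>2)"
    by (simp add: sum.cartesian_product)
  also have "\<dots> = (\<Sum>(x, z)\<in>{(x, z). x + z < N}. (c (x + z))\<^sup>2)"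
    by (rule sum.mono_neutral_right) (auto, use c leI in blast)
  also have "\<dots> = (\<Sum>m<N. \<Sum>i\<le>m. (c (i + (m - i)))\<^sup>2)"
    by (rule sum.triangle_reindex)
  also have "\<dots> = (\<Sum>m<N. real (m + 1) * (c m)\<^sup>2)"
    by (intro sum.cong refl) simp
  finally show ?thesis .
qed

text \<open>
  For the Hankel matrix \<open>H = (c (x + z))\<close> this is \<open>(tr H\<^sup>3)\<^sup>2 \<le> (tr H\<^sup>2)\<^sup>3\<close>, i.e. Cauchy-Schwarz
  followed by the submultiplicativity of the Hilbert-Schmidt norm. The subtracted term is what
  the latter loses on the rows \<open>0\<close> and \<open>z\<close>; it vanishes for all \<open>z\<close>, \<open>k\<close> only in rank one.
\<close>

lemma hankel_trace_cube:
  fixes c :: "nat \<Rightarrow> real"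
  assumes c: "\<And>m. N \<le> m \<Longrightarrow> c m = 0"
  defines "A \<equiv> \<Sum>m<N. real (m + 1) * (c m)\<^sup>2"
  shows "(\<Sum>x<N. \<Sum>y<N. \<Sum>z<N. c (x + y) * c (y + z) * c (z + x))\<^sup>2
    \<le> A * (A\<^sup>2 - (c 0 * c (z + k) - c k * c z)\<^sup>2)"
proof -
  define S where "S = (\<Sum>x<N. \<Sum>y<N. \<Sum>z<N. c (x + y) * c (y + z) * c (z + x))"
  \<comment> \<open>\<open>r x z\<close> is an entry of \<open>H\<^sup>2\<close>, \<open>n x\<close>
    is the squared norm of row \<open>x\<close>, and \<open>A\<close> and \<open>S\<close> are the
    traces of \<open>H\<^sup>2\<close> and \<open>H\<^sup>3\<close>.\<close>
  define r where "r = (\<lambda>x z. \<Sum>y<N. c (x + y) * c (z + y))"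
  define n where "n = (\<lambda>x. \<Sum>y<N. (c (x + y))\<^sup>2)"
  have A1: "A = (\<Sum>x<N. n x)"
    unfolding n_def A_def by (rule hankel_norm[OF c, symmetric])
  then have A: "A = (\<Sum>x<N. n x)" "A = (\<Sum>p\<in>{..<N}\<times>{..<N}. (c (fst p + snd p))\<^sup>2)"
    by (auto simp: n_def sum.cartesian_product case_prod_beta)
  have A0: "0 \<le> A" unfolding A_def by (intro sum_nonneg) auto
  have "S = (\<Sum>x<N. \<Sum>z<N. \<Sum>y<N. c (x + y) * c (y + z) * c (z + x))"
    unfolding S_def by (intro sum.cong refl sum.swap)
  also have "\<dots> = (\<Sum>x<N. \<Sum>z<N. r x z * c (x + z))"
    unfolding r_def sum_distrib_right
    by (intro sum.cong refl) (simp add: add.commute[of _ "_::nat"])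
  also have "\<dots> = (\<Sum>p\<in>{..<N}\<times>{..<N}. r (fst p) (snd p) * c (fst p + snd p))"
    by (simp add: sum.cartesian_product case_prod_beta)
  finally have S: "S = \<dots>" .
  have nn: "n x \<ge> 0" for x unfolding n_def by (intro sum_nonneg) auto
  have A2: "(\<Sum>p\<in>{..<N}\<times>{..<N}. n (fst p) * n (snd p)) = A\<^sup>2"
    by (simp add: A(1) power2_eq_square sum_product sum.cartesian_product case_prod_beta)
  define d where "d = (c 0 * c (z + k) - c k * c z)\<^sup>2"
  have "(\<Sum>p\<in>{..<N}\<times>{..<N}. (r (fst p) (snd p))\<^sup>2) \<le> A\<^sup>2 - d"
  proof (cases "z < N \<and> k < N")
    case True
    have rn: "(r x z)\<^sup>2 \<le> n x * n z" for x z
      unfolding r_def n_def using Cauchy_Schwarz_ineq_sum[of "\<lambda>y. c (x + y)" "\<lambda>y. c (z + y)" "{..<N}"] by simp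
    have r0: "(r 0 z)\<^sup>2 \<le> n 0 * n z - d"
      unfolding r_def n_def d_def using lagrange_two_term[of 0 N k "\<lambda>y. c (0 + y)" "\<lambda>y. c (z + y)"] True by simp
    have "(0, z) \<in> {..<N} \<times> {..<N}" using True by auto
    then have "(\<Sum>p\<in>{..<N}\<times>{..<N}. (r (fst p) (snd p))\<^sup>2)
      = (r 0 z)\<^sup>2 + (\<Sum>p\<in>{..<N}\<times>{..<N}-{(0,z)}. (r (fst p) (snd p))\<^sup>2)"
      by (subst sum.remove[of _ "(0,z)"]) auto
    also have "\<dots> \<le> n 0 * n z - d + (\<Sum>p\<in>{..<N}\<times>{..<N}-{(0,z)}. n (fst p) * n (snd p))"
      by (intro add_mono r0 sum_mono rn)
    also have "\<dots> = (\<Sum>p\<in>{..<N}\<times>{..<N}. n (fst p) * n (snd p)) - d"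
      using \<open>(0, z) \<in> _\<close> by (subst (2) sum.remove[of _ "(0,z)"]) auto
    finally show ?thesis using A2 by simp
  next
    case False
    \<comment> \<open>Outside the range one of \<open>c z\<close>, \<open>c k\<close> vanishes
      together with \<open>c (z + k)\<close>, so the minor is zero and plain Cauchy-Schwarz
      suffices. This includes \<open>N = 0\<close>.\<close>
    then have "d = 0" using c[of z] c[of k] c[of "z + k"] by (auto simp: d_def not_less)
    moreover have "(\<Sum>p\<in>{..<N}\<times>{..<N}. (r (fst p) (snd p))\<^sup>2) \<le> (\<Sum>p\<in>{..<N}\<times>{..<N}. n (fst p) * n (snd p))"
      unfolding r_def n_def by (intro sum_mono Cauchy_Schwarz_ineq_sum)
    ultimately show ?thesis using A2 by simp
  qed
  moreover have "S\<^sup>2 \<le> (\<Sum>p\<in>{..<N}\<times>{..<N}. (r (fst p) (snd p))\<^sup>2) * A"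
    unfolding S A(2) by (rule Cauchy_Schwarz_ineq_sum)
  ultimately have "S\<^sup>2 \<le> (A\<^sup>2 - d) * A" using A0 by (meson mult_right_mono order_trans)
  then show ?thesis by (simp add: S_def d_def mult.commute)
qed

section \<open>Integrals of sine polynomials\<close>

text \<open>A density instead of a restricted space: the underlying space stays the whole line, so
  functions need to be measurable on \<open>borel\<close> only, and the range
  \<open>0 < x < pi\<close> is recovered almost everywhere by \<open>AE_angle\<close>.\<close>

definition angle :: "real measure" where
  "angle = density lborel (indicator {0<..<pi})"

lemma sets_angle [measurable_cong, simp]: "sets angle = sets borel"
  by (simp add: angle_def)

lemma space_angle [simp]: "space angle = UNIV"
  by (simp add: angle_def)

lemma AE_angle: "AE x in angle. 0 < x \<and> x < pi"
  unfolding angle_def by (subst AE_density) (auto simp: indicator_def)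

lemma nn_integral_angle:
  "f \<in> borel_measurable borel \<Longrightarrow>
     (\<integral>\<^sup>+x. f x \<partial>angle) = (\<integral>\<^sup>+x. indicator {0<..<pi} x * f x \<partial>lborel)"
  unfolding angle_def by (subst nn_integral_density) auto

lemma has_bochner_integral_angle:
  fixes f :: "real \<Rightarrow> real"
  assumes "f \<in> borel_measurable borel" "has_bochner_integral lborel (\<lambda>x. indicator {0<..<pi} x *\<^sub>R f x) I"
  shows "has_bochner_integral angle f I"
  using has_bochner_integral_density[of f lborel "indicator {0<..<pi}" I] assms
  by (simp add: angle_def ennreal_indicator[abs_def])

interpretation angle: finite_measure angle
proof
  have "emeasure angle UNIV = emeasure lborel {0<..<pi}"
    unfolding angle_def by (subst emeasure_density) auto
  then show "emeasure angle (space angle) \<noteq> \<infinity>" by simp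
qed

interpretation angle2: pair_sigma_finite angle angle ..

lemma angle_FTC:
  fixes F f :: "real \<Rightarrow> real"
  assumes "\<And>x. (F has_real_derivative f x) (at x)" "\<And>x. isCont f x"
  shows "has_bochner_integral angle f (F pi - F 0)"
proof -
  have "has_bochner_integral lborel (\<lambda>x. indicator {0..pi} x *\<^sub>R f x) (F pi - F 0)"
    by (rule has_bochner_integral_FTC_Icc)
       (use assms in \<open>auto simp: has_real_derivative_iff_has_vector_derivative[symmetric] 
          intro: has_field_derivative_at_within continuous_at_imp_continuous_on\<close>)
  moreover have "AE x in lborel. (x::real) \<noteq> 0 \<and> x \<noteq> pi"
    using AE_lborel_singleton[of "0::real"] AE_lborel_singleton[of pi] by eventually_elim auto
  then have "AE x in lborel. indicator {0..pi} x *\<^sub>R f x = indicator {0<..<pi} x *\<^sub>R f x"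
    by eventually_elim (auto simp: indicator_def)
  moreover have [measurable]: "f \<in> borel_measurable borel"
    using assms(2) by (intro borel_measurable_continuous_onI) (simp add: continuous_at_imp_continuous_on)
  ultimately have "has_bochner_integral lborel (\<lambda>x. indicator {0<..<pi} x *\<^sub>R f x) (F pi - F 0)"
    by (subst has_bochner_integral_cong_AE[symmetric]) auto
  then show ?thesis by (intro has_bochner_integral_angle) auto
qed

lemma cos_int_pi: "cos (real_of_int p * pi) \<noteq> 0" "sin (real_of_int p * pi) = 0"
  using sin_zero_iff_int2[of "real_of_int p * pi"] sin_cos_squared_add[of "real_of_int p * pi"] by auto

lemma integral_angle_cos:
  "has_bochner_integral angle (\<lambda>x. cos (real_of_int p * x)) (if p = 0 then pi else 0)"
proof (cases "p = 0")
  case True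
  then show ?thesis using angle_FTC[of "\<lambda>x. x" "\<lambda>x. 1"] by simp
next
  case False
  have "has_bochner_integral angle (\<lambda>x. cos (real_of_int p * x)) 
     (sin (real_of_int p * pi) / real_of_int p - sin (real_of_int p * 0) / real_of_int p)"
    by (rule angle_FTC) (use False in \<open>auto intro!: derivative_eq_intros\<close>)
  then show ?thesis using False by (simp add: cos_int_pi)
qed

lemma integral_angle_cos_cos:
  "has_bochner_integral angle (\<lambda>x. cos (real_of_int p * x) * cos (real_of_int q * x))
     (pi / 2 * (of_bool (p = q) + of_bool (p = - q)))"
proof -
  have eq: "cos (real_of_int p * x) * cos (real_of_int q * x) =
      1 / 2 * (cos (real_of_int (p - q) * x) + cos (real_of_int (p + q) * x))" for x
    using cos_times_cos[of "real_of_int p * x" "real_of_int q * x"]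
    by (simp add: left_diff_distrib distrib_right)
  have "has_bochner_integral angle (\<lambda>x. 1 / 2 * (cos (real_of_int (p - q) * x) + cos (real_of_int (p + q) * x)))
     (1 / 2 * ((if p - q = 0 then pi else 0) + (if p + q = 0 then pi else 0)))"
    by (intro has_bochner_integral_mult_right has_bochner_integral_add integral_angle_cos)
  also have "1 / 2 * ((if p - q = 0 then pi else 0) + (if p + q = 0 then pi else 0))
     = pi / 2 * (of_bool (p = q) + of_bool (p = - q))"
    by (auto simp: add_eq_0_iff)
  finally show ?thesis unfolding eq .
qed

lemma sin_times_sin_Suc:
  "sin (real (Suc m) * x) * sin (real (Suc n) * x) =
     (cos (real_of_int (int m - int n) * x) - cos (real_of_int (int m + int n + 2) * x)) / 2"
proof -
  have "real_of_int (int m - int n) * x = real (Suc m) * x - real (Suc n) * x"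
    "real_of_int (int m + int n + 2) * x = real (Suc m) * x + real (Suc n) * x"
    by (auto simp: algebra_simps)
  then show ?thesis by (simp only: sin_times_sin)
qed

lemma integral_angle_sin_sin:
  "has_bochner_integral angle (\<lambda>x. sin (real (Suc m) * x) * sin (real (Suc n) * x)) (pi / 2 * of_bool (m = n))"
proof -
  have eq: "sin (real (Suc m) * x) * sin (real (Suc n) * x) =
      1 / 2 * (cos (real_of_int (int m - int n) * x) - cos (real_of_int (int m + int n + 2) * x))" for x
    using sin_times_sin_Suc[of m x n] by simp
  have "has_bochner_integral angle (\<lambda>x. 1 / 2 * (cos (real_of_int (int m - int n) * x) - cos (real_of_int (int m + int n + 2) * x)))
     (1 / 2 * ((if int m - int n = 0 then pi else 0) - (if int m + int n + 2 = 0 then pi else 0)))"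
    by (intro has_bochner_integral_mult_right has_bochner_integral_diff integral_angle_cos)
  then show ?thesis unfolding eq by (auto split: if_splits)
qed

text \<open>The cosines run over the weights \<open>m, m - 2, ..., -m\<close>. The induction goes in
  steps of two, because passing from \<open>m - 2\<close> to \<open>m\<close> adds just the two
  extreme weights \<open>m\<close> and \<open>-m\<close>, and
  \<open>sin ((m + 1) x) - sin ((m - 1) x) = 2 cos (m x) sin x\<close>.\<close>

lemma sin_Suc_times_eq_sum:
  "sin (real (Suc m) * x) = sin x * (\<Sum>j\<le>m. cos ((real m - 2 * real j) * x))"
proof (induction m rule: nat_less_induct)
  case (1 m)
  consider "m = 0" | "m = 1" | k where "m = Suc (Suc k)"
    by (metis One_nat_def not0_implies_Suc)
  then show ?case
  proof cases
    case 1 then show ?thesis by simp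
  next
    case 2 then show ?thesis by (simp add: sin_double)
  next
    case 3
    have "(\<Sum>j\<le>m. cos ((real m - 2 * real j) * x)) =
       cos (real m * x) + (\<Sum>j\<le>Suc k. cos ((real m - 2 * real (Suc j)) * x))"
      by (simp only: 3 sum.atMost_Suc_shift) (simp add: algebra_simps)
    also have "\<dots> = 2 * cos (real m * x) + (\<Sum>j\<le>k. cos ((real k - 2 * real j) * x))"
    proof -
      have "cos ((real m - 2 * real (Suc (Suc k))) * x) = cos (real m * x)"
        by (subst cos_minus[symmetric]) (simp add: 3 algebra_simps)
      then show ?thesis by (simp add: 3 algebra_simps)
    qed
    finally have "sin x * (\<Sum>j\<le>m. cos ((real m - 2 * real j) * x))
       = 2 * cos (real m * x) * sin x + sin (real (Suc k) * x)"
      using 1 3 by (simp add: algebra_simps)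
    also have "\<dots> = sin (real (Suc m) * x)"
    proof -
      have "sin (real (Suc m) * x) = sin (real m * x + x)" "sin (real (Suc k) * x) = sin (real m * x - x)"
        by (auto simp: 3 algebra_simps)
      then show ?thesis by (simp only: sin_add sin_diff)
    qed
    finally show ?thesis by simp
  qed
qed

lemma sum_of_bool_progression:
  fixes d :: int
  shows "(\<Sum>j\<le>m. of_bool (int m - 2 * int j = d)) = (of_bool (even (int m - d) \<and> \<bar>d\<bar> \<le> int m) :: real)"
proof -
  have "(\<Sum>j\<le>m. of_bool (int m - 2 * int j = d)) = (real (card {j. j \<le> m \<and> int m - 2 * int j = d}))"
    by (simp add: sum_of_bool_eq Int_def)
  also have "{j. j \<le> m \<and> int m - 2 * int j = d} =
     (if even (int m - d) \<and> \<bar>d\<bar> \<le> int m then {nat ((int m - d) div 2)} else {})"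
    by auto
  finally show ?thesis by simp
qed

text \<open>The factor with index \<open>m\<close>, divided by \<open>sin x\<close>, is a sum of
  cosines over its weights; the product of the other two is half the difference of the cosines with
  frequencies \<open>n - k\<close> and \<open>n + k + 2\<close>. Orthogonality leaves the question
  which of these two frequencies is a weight, and the difference of the answers is the triangle
  condition.\<close>

lemma integral_angle_sin_sin_sin:
  "has_bochner_integral angle
     (\<lambda>x. sin (real (Suc m) * x) * sin (real (Suc n) * x) * sin (real (Suc k) * x) / sin x)
     (pi / 2 * of_bool (even (m + n + k) \<and> m \<le> n + k \<and> n \<le> k + m \<and> k \<le> m + n))"
proof -
  let ?c = "\<lambda>p x. cos (real_of_int p * x)"
  let ?f = "\<lambda>x. \<Sum>j\<le>m. 1 / 2 * (?c (int m - 2 * int j) x * ?c (int n - int k) x -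
     ?c (int m - 2 * int j) x * ?c (int n + int k + 2) x)"
  let ?I = "\<lambda>d. of_bool (even (int m - d) \<and> \<bar>d\<bar> \<le> int m) :: real"
  have lin: "(\<Sum>j\<le>m. 1 / 2 * (pi / 2 * (a j + b j) - pi / 2 * (c j + d j)))
     = pi / 4 * ((\<Sum>j\<le>m. a j) + (\<Sum>j\<le>m. b j) - (\<Sum>j\<le>m. c j) - (\<Sum>j\<le>m. d j))" for a b c d :: "nat \<Rightarrow> real"
    by (induction m) (simp_all add: field_simps)
  have "has_bochner_integral angle ?f (\<Sum>j\<le>m. 1 / 2 *
     (pi / 2 * (of_bool (int m - 2 * int j = int n - int k) + of_bool (int m - 2 * int j = - (int n - int k))) -
      pi / 2 * (of_bool (int m - 2 * int j = int n + int k + 2) + of_bool (int m - 2 * int j = - (int n + int k + 2)))))"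
    by (intro has_bochner_integral_sum has_bochner_integral_mult_right has_bochner_integral_diff integral_angle_cos_cos)
  also have "(\<Sum>j\<le>m. 1 / 2 *
     (pi / 2 * (of_bool (int m - 2 * int j = int n - int k) + of_bool (int m - 2 * int j = - (int n - int k))) -
      pi / 2 * (of_bool (int m - 2 * int j = int n + int k + 2) + of_bool (int m - 2 * int j = - (int n + int k + 2)))))
     = pi / 4 * (?I (int n - int k) + ?I (- (int n - int k)) - ?I (int n + int k + 2) - ?I (- (int n + int k + 2)))"
    unfolding sum_of_bool_progression[symmetric] by (rule lin)
  also have "\<dots> = pi / 2 * of_bool (even (m + n + k) \<and> m \<le> n + k \<and> n \<le> k + m \<and> k \<le> m + n)"
  proof -
    have "?I (int n - int k) - ?I (int n + int k + 2)
       = of_bool (even (m + n + k) \<and> m \<le> n + k \<and> n \<le> k + m \<and> k \<le> m + n)"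
    proof -
      have "even (int m - (int n - int k)) \<longleftrightarrow> even (m + n + k)"
        "even (int m - (int n + int k + 2)) \<longleftrightarrow> even (m + n + k)" by auto
      moreover have "\<bar>int n - int k\<bar> \<le> int m \<longleftrightarrow> n \<le> k + m \<and> k \<le> m + n"
        "\<bar>int n + int k + 2\<bar> \<le> int m \<longleftrightarrow> n + k + 2 \<le> m" by linarith+
      \<comment> \<open>By parity \<open>m = n + k + 1\<close> cannot occur, so failing
        \<open>m \<le> n + k\<close> already means \<open>n + k + 2 \<le> m\<close>.\<close>
      moreover have "m \<le> n + k \<longleftrightarrow> \<not> n + k + 2 \<le> m" if "even (m + n + k)"
      proof -
        obtain w where "m + n + k = 2 * w" using \<open>even (m + n + k)\<close> by blast
        then show ?thesis by presburger
      qed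
      moreover have "n + k + 2 \<le> m \<Longrightarrow> n \<le> k + m" "n + k + 2 \<le> m \<Longrightarrow> k \<le> m + n" by linarith+
      ultimately show ?thesis unfolding of_bool_def by argo
    qed
    moreover have "?I (- d) = ?I d" for d by (simp add: abs_minus)
    moreover have "pi / 4 * (a + a - b - b) = pi / 2 * z" if "a - b = z" for a b z :: real
      using that by (auto simp: field_simps)
    ultimately show ?thesis by (simp only:)
  qed
  finally have "has_bochner_integral angle ?f \<dots>" .
  moreover have "AE x in angle. ?f x = sin (real (Suc m) * x) * sin (real (Suc n) * x) * sin (real (Suc k) * x) / sin x"
    using AE_angle
  proof eventually_elim
    case (elim x)
    then have "sin x > 0" by (auto simp: sin_gt_zero)
    moreover have "sin (real (Suc n) * x) * sin (real (Suc k) * x) =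
       1 / 2 * (?c (int n - int k) x - ?c (int n + int k + 2) x)"
      using sin_times_sin_Suc[of n x k] by simp
    ultimately show ?case
      unfolding sin_Suc_times_eq_sum[of m]
by (simp only: sum_distrib_right[symmetric] sum_distrib_left[symmetric] flip: right_diff_distrib) simp
  qed
  ultimately show ?thesis
    by (subst (asm) has_bochner_integral_cong_AE) auto
qed

text \<open>Parity and the triangle inequalities are exactly the solvability conditions of
  \<open>m = x + y\<close>, \<open>n = y + z\<close>, \<open>k = z + x\<close> in natural numbers:
  with the half perimeter \<open>w = x + y + z\<close> one has \<open>x = w - n\<close>,
  \<open>y = w - k\<close>, \<open>z = w - m\<close>. This turns the selection rule of the cubic
  integral into a trace.\<close>

lemma hankel_index_bij:
  "bij_betw (\<lambda>(x, y, z). (x + y, y + z, z + x)) UNIV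
     {(m, n, k). even (m + n + k) \<and> m \<le> n + k \<and> n \<le> k + m \<and> k \<le> m + (n::nat)}"
proof (rule bij_betwI[where g = "\<lambda>(m, n, k). let w = (m + n + k) div 2 in (w - n, w - k, w - m)"])
  fix p assume pT: "p \<in> {(m, n, k). even (m + n + k) \<and> m \<le> n + k \<and> n \<le> k + m \<and> k \<le> m + (n::nat)}"
  obtain m n k where p: "p = (m, n, k)" by (rule prod_cases3)
  have e: "even (m + n + k)" "m \<le> n + k" "n \<le> k + m" "k \<le> m + n"
    using pT by (simp_all only: p mem_Collect_eq prod.case)
  define w where "w = (m + n + k) div 2"
  have w: "m + n + k = 2 * w" using e(1) unfolding w_def by simp
  have "w - n + (w - k) = m" "w - k + (w - m) = n" "w - m + (w - n) = k"
    using e(2-) w by linarith+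
  then show "(case case p of (m, n, k) \<Rightarrow> let w = (m + n + k) div 2 in (w - n, w - k, w - m) of
     (x, y, z) \<Rightarrow> (x + y, y + z, z + x)) = p"
    by (simp only: p prod.case Let_def flip: w_def)
next
  fix p :: "nat \<times> nat \<times> nat"
  obtain x y z where p: "p = (x, y, z)" by (rule prod_cases3)
  have "(x + y + (y + z) + (z + x)) div 2 = x + y + z" by simp
  then show "(case case p of (x, y, z) \<Rightarrow> (x + y, y + z, z + x) of
     (m, n, k) \<Rightarrow> let w = (m + n + k) div 2 in (w - n, w - k, w - m)) = p"
    by (simp add: p Let_def)
qed auto

text \<open>
  The functions \<open>sin ((m + 1) x) / sin x\<close> are the characters of \<open>SU(2)\<close>; by the Clebsch-Gordan
  rule the cubic integral is \<open>\<pi>/2\<close> times the trace of the cube of the Hankel matrix.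
\<close>

lemma integral_sine_polynomial_cube:
  fixes c :: "nat \<Rightarrow> real"
  assumes c: "\<And>m. N \<le> m \<Longrightarrow> c m = 0"
  shows "has_bochner_integral angle (\<lambda>x. (\<Sum>m<N. c m * sin (real (Suc m) * x)) ^ 3 / sin x)
    (pi / 2 * (\<Sum>x<N. \<Sum>y<N. \<Sum>z<N. c (x + y) * c (y + z) * c (z + x)))"
proof -
  let ?T = "{(m, n, k). even (m + n + k) \<and> m \<le> n + k \<and> n \<le> k + m \<and> k \<le> m + (n::nat)}"
  let ?C = "\<lambda>(m, n, k). c m * c n * c k"
  define f where "f = (\<lambda>(x, y, z). (x + y, y + z, z + (x::nat)))"
  have "has_bochner_integral angle (\<lambda>x. \<Sum>m<N. \<Sum>n<N. \<Sum>k<N. c m * c n * c k *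
     (sin (real (Suc m) * x) * sin (real (Suc n) * x) * sin (real (Suc k) * x) / sin x))
     (\<Sum>m<N. \<Sum>n<N. \<Sum>k<N. c m * c n * c k *
      (pi / 2 * of_bool (even (m + n + k) \<and> m \<le> n + k \<and> n \<le> k + m \<and> k \<le> m + n)))"
    by (intro has_bochner_integral_sum has_bochner_integral_mult_right integral_angle_sin_sin_sin)
  also have "(\<lambda>x. \<Sum>m<N. \<Sum>n<N. \<Sum>k<N. c m * c n * c k *
     (sin (real (Suc m) * x) * sin (real (Suc n) * x) * sin (real (Suc k) * x) / sin x))
     = (\<lambda>x. (\<Sum>m<N. c m * sin (real (Suc m) * x)) ^ 3 / sin x)"
    by (rule ext, simp only: power3_eq_cube sum_product sum_distrib_left sum_distrib_right sum_divide_distrib)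
       (intro sum.cong refl, simp)
  also have "(\<Sum>m<N. \<Sum>n<N. \<Sum>k<N. c m * c n * c k *
      (pi / 2 * of_bool (even (m + n + k) \<and> m \<le> n + k \<and> n \<le> k + m \<and> k \<le> m + n)))
      = (\<Sum>p\<in>{..<N}\<times>{..<N}\<times>{..<N}. pi / 2 * (if p \<in> ?T then ?C p else 0))"
    by (simp add: sum.cartesian_product case_prod_beta of_bool_def if_distrib mult_ac cong: if_cong)
  also have "\<dots> = pi / 2 * (\<Sum>p\<in>({..<N}\<times>{..<N}\<times>{..<N}) \<inter> ?T. ?C p)"
    by (simp only: sum_distrib_left[symmetric] sum.inter_restrict finite_SigmaI finite_lessThan)
  also have "(\<Sum>p\<in>({..<N}\<times>{..<N}\<times>{..<N}) \<inter> ?T. ?C p) =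
     (\<Sum>p\<in>{p. f p \<in> {..<N}\<times>{..<N}\<times>{..<N}}. ?C (f p))"
  proof (rule sum.reindex_bij_betw[symmetric])
    let ?B = "{..<N}\<times>{..<N}\<times>{..<N}"
    have f: "bij_betw f UNIV ?T" using hankel_index_bij unfolding f_def .
    have "f ` {p. f p \<in> ?B} = ?B \<inter> range f"
      by (simp only: image_vimage_eq flip: vimage_def)
    then have "f ` {p. f p \<in> ?B} = ?B \<inter> ?T" by (simp only: bij_betw_imp_surj_on[OF f])
    then show "bij_betw f {p. f p \<in> ?B} (?B \<inter> ?T)"
      by (rule bij_betw_subset[OF f subset_UNIV])
  qed
  \<comment> \<open>If all three pairwise sums are below \<open>N\<close>, so are \<open>x\<close>,
    \<open>y\<close>, \<open>z\<close>. The remaining triples of the cube have a pairwise sum of at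
    least \<open>N\<close>, where \<open>c\<close> is zero.\<close>
  also have "\<dots> = (\<Sum>p\<in>{..<N}\<times>{..<N}\<times>{..<N}. ?C (f p))"
  proof (rule sum.mono_neutral_left)
    show "\<forall>p\<in>{..<N}\<times>{..<N}\<times>{..<N} - {p. f p \<in> {..<N}\<times>{..<N}\<times>{..<N}}. ?C (f p) = 0"
    proof
      fix p assume p: "p \<in> {..<N}\<times>{..<N}\<times>{..<N} - {p. f p \<in> {..<N}\<times>{..<N}\<times>{..<N}}"
      obtain x y z where xyz: "p = (x, y, z)" by (rule prod_cases3)
      then have "N \<le> x + y \<or> N \<le> y + z \<or> N \<le> z + x" using p by (simp add: f_def not_less)
      then show "?C (f p) = 0" using c by (auto simp: xyz f_def)
    qed
  qed (auto simp: f_def)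
  also have "\<dots> = (\<Sum>x<N. \<Sum>y<N. \<Sum>z<N. c (x + y) * c (y + z) * c (z + x))"
    by (simp add: sum.cartesian_product case_prod_beta f_def)
  finally show ?thesis .
qed

section \<open>The Poisson kernel and Abel means\<close>

text \<open>The Poisson kernel of the unit disc, normalised to mass one over a full period.\<close>

definition poisson :: "real \<Rightarrow> real \<Rightarrow> real" where
  "poisson \<rho> s = (1 - \<rho>\<^sup>2) / (2 * pi * (1 - 2 * \<rho> * cos s + \<rho>\<^sup>2))"

text \<open>Index \<open>m\<close> belongs to the frequency \<open>m + 1\<close>, which is also the
  length of the antidiagonal \<open>m\<close> of the Hankel matrix.\<close>

definition sine_coeff :: "(real \<Rightarrow> real) \<Rightarrow> nat \<Rightarrow> real" where
  "sine_coeff f m = 2 / pi * (\<integral>x. f x * sin (real (Suc m) * x) \<partial>angle)"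

text \<open>The Poisson integral of the odd extension of \<open>f\<close> to the circle, folded onto
  \<open>(0, pi)\<close>; the kernel at \<open>a + b\<close> belongs to the image point
  \<open>- b\<close>. In this form positivity is visible, which the damped sine series does not
  show.\<close>

definition abel_mean :: "real \<Rightarrow> (real \<Rightarrow> real) \<Rightarrow> real \<Rightarrow> real" where
  "abel_mean \<rho> f a = (\<integral>b. f b * (poisson \<rho> (a - b) - poisson \<rho> (a + b)) \<partial>angle)"

lemma borel_measurable_poisson [measurable]: "poisson \<rho> \<in> borel_measurable borel"
  unfolding poisson_def[abs_def] by measurable

lemma poisson_denom_ge:
  fixes \<rho> :: real
  assumes "0 \<le> \<rho>"
  shows "(1 - \<rho>)\<^sup>2 \<le> 1 - 2 * \<rho> * cos s + \<rho>\<^sup>2"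
proof -
  have "\<rho> * cos s \<le> \<rho> * 1" using assms by (intro mult_left_mono) auto
  then show ?thesis by (simp add: power2_eq_square algebra_simps)
qed

lemma poisson_denom_pos:
  fixes \<rho> :: real
  assumes "0 \<le> \<rho>" "\<rho> < 1"
  shows "0 < 1 - 2 * \<rho> * cos s + \<rho>\<^sup>2"
proof -
  have "0 < (1 - \<rho>)\<^sup>2" using assms by simp
  then show ?thesis using poisson_denom_ge[OF assms(1), of s] by linarith
qed

lemma poisson_nonneg:
  assumes "0 \<le> \<rho>" "\<rho> < 1"
  shows "0 \<le> poisson \<rho> s"
  unfolding poisson_def using poisson_denom_pos[OF assms] assms
  by (intro divide_nonneg_nonneg) (auto simp: power_le_one less_imp_le)

lemma poisson_le:
  assumes "0 \<le> \<rho>" "\<rho> < 1"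
  shows "poisson \<rho> s \<le> (1 - \<rho>\<^sup>2) / (2 * pi * (1 - \<rho>)\<^sup>2)"
  unfolding poisson_def using poisson_denom_ge[of \<rho> s] assms
  by (intro divide_left_mono mult_left_mono) (auto simp: power_le_one poisson_denom_pos)

text \<open>The kernel increases with the cosine of its argument, and
  \<open>cos (a - b) - cos (a + b) = 2 sin a sin b\<close>. Hence Abel means of nonnegative
  functions are nonnegative, as Fatou's lemma for their cubes requires.\<close>

lemma poisson_diff_nonneg:
  assumes "0 \<le> \<rho>" "\<rho> < 1" "0 < a" "a < pi" "0 < b" "b < pi"
  shows "0 \<le> poisson \<rho> (a - b) - poisson \<rho> (a + b)"
proof -
  have "0 \<le> sin a * sin b" using assms by (intro mult_nonneg_nonneg) (auto intro: less_imp_le sin_gt_zero)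
  then have "cos (a + b) \<le> cos (a - b)" by (simp add: cos_add cos_diff)
  then have "\<rho> * cos (a + b) \<le> \<rho> * cos (a - b)" using assms by (intro mult_left_mono) auto
  then have "poisson \<rho> (a + b) \<le> poisson \<rho> (a - b)"
    unfolding poisson_def using assms poisson_denom_pos[OF assms(1,2)]
    by (intro divide_left_mono mult_left_mono) (auto simp: power_le_one)
  then show ?thesis by simp
qed

text \<open>The real part of \<open>z / (1 - z)\<close> at \<open>z = \<rho> exp (\<i> s)\<close>;
  the missing constant mode accounts for \<open>1 / 2\<close>.\<close>

lemma poisson_sums:
  assumes "0 \<le> \<rho>" "\<rho> < 1"
  shows "(\<lambda>n. \<rho> ^ Suc n * cos (real (Suc n) * s)) sums (pi * poisson \<rho> s - 1 / 2)"
proof -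
  define z where "z = complex_of_real \<rho> * cis s"
  define D where "D = 1 - 2 * \<rho> * cos s + \<rho>\<^sup>2"
  have nz: "norm z < 1" using assms by (simp add: z_def norm_mult)
  have D0: "D > 0" unfolding D_def by (rule poisson_denom_pos[OF assms])
  have sc: "(cos s)\<^sup>2 + (sin s)\<^sup>2 = 1" by simp
  have "(\<lambda>n. z * z ^ n) sums (z * (1 / (1 - z)))"
    by (intro sums_mult geometric_sums nz)
  then have "(\<lambda>n. Re (z * z ^ n)) sums Re (z * (1 / (1 - z)))" by (rule sums_Re)
  moreover have "Re (z * z ^ n) = \<rho> ^ Suc n * cos (real (Suc n) * s)" for n
  proof -
    have "z * z ^ n = complex_of_real (\<rho> ^ Suc n) * cis (real (Suc n) * s)"
      by (simp add: z_def power_mult_distrib Complex.DeMoivre cis_mult algebra_simps)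
    then show ?thesis by simp
  qed
  moreover have "Re (z * (1 / (1 - z))) = pi * poisson \<rho> s - 1 / 2"
  proof -
    have "z * (1 / (1 - z)) = z / (1 - z)" by simp
    moreover have re: "Re z = \<rho> * cos s" "Im z = \<rho> * sin s" "Re (1 - z) = 1 - \<rho> * cos s" "Im (1 - z) = - (\<rho> * sin s)"
      by (simp_all add: z_def)
    moreover have "(1 - \<rho> * cos s)\<^sup>2 + (- (\<rho> * sin s))\<^sup>2 = D"
      unfolding D_def using sc by algebra
    ultimately have "Re (z * (1 / (1 - z))) = (Re z * Re (1 - z) + Im z * Im (1 - z)) / D"
      by (simp only: Re_divide)
    also have "Re z * Re (1 - z) + Im z * Im (1 - z) = \<rho> * cos s - \<rho>\<^sup>2"
      unfolding re using sc by algebra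
    also have "(\<rho> * cos s - \<rho>\<^sup>2) / D = pi * poisson \<rho> s - 1 / 2"
      using D0 unfolding poisson_def D_def[symmetric] by (simp add: field_simps) (simp add: D_def algebra_simps)
    finally show ?thesis .
  qed
  ultimately show ?thesis by simp
qed

lemma poisson_diff_sums:
  assumes "0 \<le> \<rho>" "\<rho> < 1"
  shows "(\<lambda>n. \<rho> ^ Suc n * (sin (real (Suc n) * a) * sin (real (Suc n) * b)))
     sums (pi / 2 * (poisson \<rho> (a - b) - poisson \<rho> (a + b)))"
proof -
  have "(\<lambda>n. 1 / 2 * (\<rho> ^ Suc n * cos (real (Suc n) * (a - b)) - \<rho> ^ Suc n * cos (real (Suc n) * (a + b))))
     sums (1 / 2 * ((pi * poisson \<rho> (a - b) - 1 / 2) - (pi * poisson \<rho> (a + b) - 1 / 2)))"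
    by (intro sums_mult sums_diff poisson_sums assms)
  moreover have "1 / 2 * (\<rho> ^ Suc n * cos (real (Suc n) * (a - b)) - \<rho> ^ Suc n * cos (real (Suc n) * (a + b)))
     = \<rho> ^ Suc n * (sin (real (Suc n) * a) * sin (real (Suc n) * b))" for n
    unfolding distrib_left right_diff_distrib cos_add cos_diff by simp
  moreover have "1 / 2 * ((pi * poisson \<rho> (a - b) - 1 / 2) - (pi * poisson \<rho> (a + b) - 1 / 2))
     = pi / 2 * (poisson \<rho> (a - b) - poisson \<rho> (a + b))"
    by (simp add: field_simps)
  ultimately show ?thesis by (simp only:)
qed

lemma poisson_add_sums:
  assumes "0 \<le> \<rho>" "\<rho> < 1"
  shows "(\<lambda>n. 2 / pi * (\<rho> ^ Suc n * (cos (real (Suc n) * a) * cos (real (Suc n) * b))))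
     sums (poisson \<rho> (a - b) + poisson \<rho> (a + b) - 1 / pi)"
proof -
  have "(\<lambda>n. 1 / pi * (\<rho> ^ Suc n * cos (real (Suc n) * (a - b)) + \<rho> ^ Suc n * cos (real (Suc n) * (a + b))))
     sums (1 / pi * ((pi * poisson \<rho> (a - b) - 1 / 2) + (pi * poisson \<rho> (a + b) - 1 / 2)))"
    by (intro sums_mult sums_add poisson_sums assms)
  moreover have "1 / pi * (\<rho> ^ Suc n * cos (real (Suc n) * (a - b)) + \<rho> ^ Suc n * cos (real (Suc n) * (a + b)))
     = 2 / pi * (\<rho> ^ Suc n * (cos (real (Suc n) * a) * cos (real (Suc n) * b)))" for n
    unfolding distrib_left right_diff_distrib cos_add cos_diff by simp
  moreover have "1 / pi * ((pi * poisson \<rho> (a - b) - 1 / 2) + (pi * poisson \<rho> (a + b) - 1 / 2))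
     = poisson \<rho> (a - b) + poisson \<rho> (a + b) - 1 / pi"
    by (simp add: field_simps)
  ultimately show ?thesis by (simp only:)
qed

lemma integrable_angle_mult_bounded:
  fixes f g :: "real \<Rightarrow> real"
  assumes f: "integrable angle f" and [measurable]: "g \<in> borel_measurable borel" and "\<And>x. \<bar>g x\<bar> \<le> C"
  shows "integrable angle (\<lambda>x. f x * g x)"
proof (rule Bochner_Integration.integrable_bound)
  show "integrable angle (\<lambda>x. C * f x)" using f by simp
  have "0 \<le> C" using assms(3)[of 0] by linarith
  show "AE x in angle. norm (f x * g x) \<le> norm (C * f x)"
  proof (rule AE_I2)
    fix x
    have "\<bar>f x\<bar> * \<bar>g x\<bar> \<le> \<bar>f x\<bar> * C" by (intro mult_left_mono assms(3)) simp
    then show "norm (f x * g x) \<le> norm (C * f x)" using \<open>0 \<le> C\<close> by (simp add: abs_mult mult.commute)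
  qed
qed (use f in measurable)

lemma two_over_pi_mult_bound:
  fixes x y r :: real
  assumes "\<bar>x\<bar> \<le> 1" "\<bar>y\<bar> \<le> 1" "0 \<le> r"
  shows "\<bar>2 / pi * (r * (x * y))\<bar> \<le> r"
proof -
  have "\<bar>x\<bar> * \<bar>y\<bar> \<le> 1 * 1" using assms by (intro mult_mono) auto
  then have "r * (\<bar>x\<bar> * \<bar>y\<bar>) \<le> r * 1" using assms by (intro mult_left_mono) auto
  moreover have "2 / pi * (r * (\<bar>x\<bar> * \<bar>y\<bar>)) \<le> 1 * (r * (\<bar>x\<bar> * \<bar>y\<bar>))"
    using pi_gt3 assms by (intro mult_right_mono) auto
  moreover have "\<bar>2 / pi * (r * (x * y))\<bar> = 2 / pi * (r * (\<bar>x\<bar> * \<bar>y\<bar>))"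
    using assms by (simp only: abs_mult abs_divide) simp
  ultimately show ?thesis by (simp only: mult_1 mult_1_right)
qed

text \<open>Geometric decay makes the integrals of the absolute values summable, so a Poisson-type
  expansion may be integrated term by term against any integrable function.\<close>

lemma sums_integral_angle_geometric:
  fixes f :: "real \<Rightarrow> real" and h :: "nat \<Rightarrow> real \<Rightarrow> real"
  assumes f: "integrable angle f" and \<rho>: "0 \<le> \<rho>" "\<rho> < 1"
    and [measurable]: "\<And>m. h m \<in> borel_measurable borel"
    and h: "\<And>m x. \<bar>h m x\<bar> \<le> C * \<rho> ^ Suc m"
  shows "(\<lambda>m. \<integral>x. f x * h m x \<partial>angle) sums (\<integral>x. f x * (\<Sum>m. h m x) \<partial>angle)"
proof -
  have summ: "summable (\<lambda>n. C * \<rho> ^ Suc n)"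
    using \<rho> by (intro summable_mult) (simp add: summable_mult summable_geometric)
  have sh: "summable (\<lambda>m. h m x)" for x
    by (rule summable_comparison_test'[OF summ, of 0]) (use h in simp)
  have int: "integrable angle (\<lambda>x. f x * h m x)" for m
    by (rule integrable_angle_mult_bounded[OF f _ h]) measurable
  have bd: "\<bar>f x * h m x\<bar> \<le> \<bar>f x\<bar> * (C * \<rho> ^ Suc m)" for m x
    unfolding abs_mult[of "f x"] by (intro mult_left_mono h) simp
  have "(\<lambda>m. \<integral>x. f x * h m x \<partial>angle) sums (\<integral>x. (\<Sum>m. f x * h m x) \<partial>angle)"
  proof (rule sums_integral[OF int])
    show "AE x in angle. summable (\<lambda>m. norm (f x * h m x))"
      by (intro AE_I2 summable_comparison_test'[OF summable_mult[OF summ], of 0]) (use bd in auto)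
    have "norm (\<integral>x. norm (f x * h m x) \<partial>angle) \<le> (\<integral>x. \<bar>f x\<bar> \<partial>angle) * (C * \<rho> ^ Suc m)" for m
    proof -
      have "(\<integral>x. norm (f x * h m x) \<partial>angle) \<le> (\<integral>x. \<bar>f x\<bar> * (C * \<rho> ^ Suc m) \<partial>angle)"
      proof (rule integral_mono)
        show "integrable angle (\<lambda>x. norm (f x * h m x))" using int by (rule integrable_norm)
        show "integrable angle (\<lambda>x. \<bar>f x\<bar> * (C * \<rho> ^ Suc m))" using f by simp
        show "norm (f x * h m x) \<le> \<bar>f x\<bar> * (C * \<rho> ^ Suc m)" for x using bd by simp
      qed
      also have "\<dots> = (\<integral>x. \<bar>f x\<bar> \<partial>angle) * (C * \<rho> ^ Suc m)" by (rule integral_mult_left_zero)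
      finally show ?thesis by (subst real_norm_def, subst abs_of_nonneg) (auto intro: integral_nonneg_AE)
    qed
    then show "summable (\<lambda>m. \<integral>x. norm (f x * h m x) \<partial>angle)"
      by (intro summable_comparison_test'[OF summable_mult[OF summ], of 0]) auto
  qed
  moreover have "(\<Sum>m. f x * h m x) = f x * (\<Sum>m. h m x)" for x
    by (rule suminf_mult[OF sh])
  ultimately show ?thesis by simp
qed

lemma integrable_poisson_add:
  assumes "0 \<le> \<rho>" "\<rho> < 1"
  shows "integrable angle (\<lambda>b. poisson \<rho> (a - b) + poisson \<rho> (a + b))"
proof -
  define B where "B = (1 - \<rho>\<^sup>2) / (2 * pi * (1 - \<rho>)\<^sup>2)"
  have "poisson \<rho> s \<le> B" "0 \<le> poisson \<rho> s" for s
    unfolding B_def using assms by (auto intro: poisson_le poisson_nonneg)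
  then have "norm (poisson \<rho> (a - b) + poisson \<rho> (a + b)) \<le> B + B" for b
    using add_mono[of "poisson \<rho> (a - b)" B "poisson \<rho> (a + b)" B] by simp
  then show ?thesis by (intro angle.integrable_const_bound[where B = "B + B"]) auto
qed

text \<open>This is the kernel of the even extension. Every cosine of positive frequency integrates
  to zero, so the mass is that of the constant mode \<open>1 / pi\<close>.\<close>

lemma integral_poisson_add:
  assumes "0 \<le> \<rho>" "\<rho> < 1"
  shows "(\<integral>b. poisson \<rho> (a - b) + poisson \<rho> (a + b) \<partial>angle) = 1"
proof -
  let ?g = "\<lambda>n b. 2 / pi * (\<rho> ^ Suc n * (cos (real (Suc n) * a) * cos (real (Suc n) * b)))"
  have "(\<lambda>n. \<integral>b. 1 * ?g n b \<partial>angle) sums (\<integral>b. 1 * (\<Sum>n. ?g n b) \<partial>angle)"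
    by (rule sums_integral_angle_geometric[where C = 1, OF _ assms])
       (simp, measurable, unfold mult_1, rule two_over_pi_mult_bound, use assms in simp_all)
  moreover have "(\<integral>b. 1 * ?g n b \<partial>angle) = 0" for n
    using has_bochner_integral_integral_eq[OF integral_angle_cos[of "int (Suc n)"]] by simp
  ultimately have "(\<lambda>n. 0) sums (\<integral>b. 1 * (\<Sum>n. ?g n b) \<partial>angle)" by (simp only:)
  then have "(\<integral>b. 1 * (\<Sum>n. ?g n b) \<partial>angle) = 0" using sums_unique2 sums_zero by blast
  moreover have "(\<Sum>n. ?g n b) = poisson \<rho> (a - b) + poisson \<rho> (a + b) - 1 / pi" for b
    using poisson_add_sums[OF assms, of a b] by (simp add: sums_iff)
  ultimately have "(\<integral>b. poisson \<rho> (a - b) + poisson \<rho> (a + b) - 1 / pi \<partial>angle) = 0" by simp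
  then show ?thesis
    using has_bochner_integral_integral_eq[OF integral_angle_cos[of 0]] integrable_poisson_add[OF assms, of a] by simp
qed

lemma integrable_angle_of_square:
  fixes f :: "real \<Rightarrow> real"
  assumes [measurable]: "f \<in> borel_measurable borel" and f: "integrable angle (\<lambda>x. (f x)\<^sup>2)"
  shows "integrable angle f"
proof (rule Bochner_Integration.integrable_bound)
  show "integrable angle (\<lambda>x. 1 + (f x)\<^sup>2)" using f by simp
  have "\<bar>y\<bar> \<le> 1 + y\<^sup>2" for y :: real
    using sum_squares_bound[of "\<bar>y\<bar>" 1] abs_ge_zero[of y] by simp
  then show "AE x in angle. norm (f x) \<le> norm (1 + (f x)\<^sup>2)" by simp
qed measurable

context
  fixes f :: "real \<Rightarrow> real"
  assumes f_meas [measurable]: "f \<in> borel_measurable borel"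
    and f_int: "integrable angle f"
begin

lemma integrable_sine_coeff: "integrable angle (\<lambda>x. f x * sin (r * x))"
  by (rule integrable_angle_mult_bounded[OF f_int, where C = 1]) auto

lemma integral_sine_coeff: "(\<integral>x. f x * sin (real (Suc m) * x) \<partial>angle) = pi / 2 * sine_coeff f m"
  by (simp add: sine_coeff_def)

lemma sine_coeff_bound: "\<bar>sine_coeff f m\<bar> \<le> 2 / pi * (\<integral>x. \<bar>f x\<bar> \<partial>angle)"
proof -
  have "\<bar>\<integral>x. f x * sin (real (Suc m) * x) \<partial>angle\<bar> \<le> (\<integral>x. \<bar>f x * sin (real (Suc m) * x)\<bar> \<partial>angle)"
    by (rule integral_abs_bound)
  also have "\<dots> \<le> (\<integral>x. \<bar>f x\<bar> \<partial>angle)"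
  proof (rule integral_mono)
    show "\<bar>f x * sin (real (Suc m) * x)\<bar> \<le> \<bar>f x\<bar>" for x
      unfolding abs_mult by (rule mult_left_le) auto
  qed (use f_int integrable_sine_coeff in auto)
  finally show ?thesis by (simp add: sine_coeff_def abs_mult field_simps)
qed

text \<open>The sine expansion of the kernel difference, integrated term by term. It connects the
  positive kernel with the coefficients that enter the Hankel matrix.\<close>

lemma abel_mean_sums:
  assumes "0 \<le> \<rho>" "\<rho> < 1"
  shows "(\<lambda>m. \<rho> ^ Suc m * sine_coeff f m * sin (real (Suc m) * a)) sums abel_mean \<rho> f a"
proof -
  let ?h = "\<lambda>m b. 2 / pi * (\<rho> ^ Suc m * (sin (real (Suc m) * a) * sin (real (Suc m) * b)))"
  have "(\<lambda>m. \<integral>b. f b * ?h m b \<partial>angle) sums (\<integral>b. f b * (\<Sum>m. ?h m b) \<partial>angle)"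
    by (rule sums_integral_angle_geometric[where C = 1, OF f_int assms])
       (measurable, unfold mult_1, rule two_over_pi_mult_bound, use assms in simp_all)
  moreover have "(\<integral>b. f b * ?h m b \<partial>angle) = \<rho> ^ Suc m * sine_coeff f m * sin (real (Suc m) * a)" for m
  proof -
    have "f b * ?h m b = (2 / pi * (\<rho> ^ Suc m * sin (real (Suc m) * a))) * (f b * sin (real (Suc m) * b))" for b
      by (simp only: mult_ac)
    then show ?thesis by (simp only: integral_mult_right_zero integral_sine_coeff) simp
  qed
  moreover have "(\<Sum>m. ?h m b) = poisson \<rho> (a - b) - poisson \<rho> (a + b)" for b
    by (subst sums_unique[OF sums_mult[OF poisson_diff_sums[OF assms, of a b], of "2 / pi"], symmetric]) simp
  ultimately show ?thesis by (simp add: abel_mean_def)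
qed

text \<open>The coefficients \<open>c\<close> are left free for two uses:
  \<open>c = sine_coeff f\<close> gives Bessel's inequality, the damped coefficients give the
  distance from \<open>f\<close> to its Abel mean.\<close>

lemma integral_square_diff_sine_polynomial:
  assumes f2: "integrable angle (\<lambda>x. (f x)\<^sup>2)"
  shows "has_bochner_integral angle (\<lambda>x. (f x - (\<Sum>m<N. c m * sin (real (Suc m) * x)))\<^sup>2)
    ((\<integral>x. (f x)\<^sup>2 \<partial>angle) - pi * (\<Sum>m<N. c m * sine_coeff f m) + pi / 2 * (\<Sum>m<N. (c m)\<^sup>2))"
proof -
  let ?s = "\<lambda>m x. sin (real (Suc m) * x)"
  have 1: "has_bochner_integral angle (\<lambda>x. (f x)\<^sup>2) (\<integral>x. (f x)\<^sup>2 \<partial>angle)"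
    using f2 by (rule has_bochner_integral_integrable)
  have "has_bochner_integral angle (\<lambda>x. f x * ?s m x) (pi / 2 * sine_coeff f m)" for m
    unfolding integral_sine_coeff[symmetric] by (intro has_bochner_integral_integrable integrable_sine_coeff)
  then have 2: "has_bochner_integral angle (\<lambda>x. \<Sum>m<N. 2 * c m * (f x * ?s m x)) (\<Sum>m<N. 2 * c m * (pi / 2 * sine_coeff f m))"
    by (intro has_bochner_integral_sum has_bochner_integral_mult_right)
  have 3: "has_bochner_integral angle (\<lambda>x. \<Sum>m<N. \<Sum>n<N. c m * c n * (?s m x * ?s n x))
     (\<Sum>m<N. \<Sum>n<N. c m * c n * (pi / 2 * of_bool (m = n)))"
    by (intro has_bochner_integral_sum has_bochner_integral_mult_right integral_angle_sin_sin)
  have "(\<Sum>m<N. \<Sum>n<N. c m * c n * (pi / 2 * of_bool (m = n))) = (\<Sum>m<N. c m * c m * (pi / 2))"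
    by (intro sum.cong refl) (simp add: of_bool_def if_distrib cong: if_cong)
  also have "\<dots> = pi / 2 * (\<Sum>m<N. (c m)\<^sup>2)"
    by (simp add: sum_distrib_left power2_eq_square mult_ac)
  finally have e3: "(\<Sum>m<N. \<Sum>n<N. c m * c n * (pi / 2 * of_bool (m = n))) = pi / 2 * (\<Sum>m<N. (c m)\<^sup>2)" .
  have e2: "(\<Sum>m<N. 2 * c m * (pi / 2 * sine_coeff f m)) = pi * (\<Sum>m<N. c m * sine_coeff f m)"
    by (simp add: sum_distrib_left mult_ac)
  have "(f x - (\<Sum>m<N. c m * ?s m x))\<^sup>2 = (f x)\<^sup>2 - (\<Sum>m<N. 2 * c m * (f x * ?s m x)) + (\<Sum>m<N. \<Sum>n<N. c m * c n * (?s m x * ?s n x))" for x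
  proof -
    have "(\<Sum>m<N. 2 * c m * (f x * ?s m x)) = 2 * f x * (\<Sum>m<N. c m * ?s m x)"
      by (simp add: sum_distrib_left mult_ac)
    moreover have "(\<Sum>m<N. \<Sum>n<N. c m * c n * (?s m x * ?s n x)) = (\<Sum>m<N. c m * ?s m x) * (\<Sum>m<N. c m * ?s m x)"
      unfolding sum_product by (intro sum.cong refl) (simp only: mult_ac)
    ultimately show ?thesis by (simp add: power2_eq_square algebra_simps)
  qed
  then show ?thesis
    using has_bochner_integral_add[OF has_bochner_integral_diff[OF 1 2] 3] unfolding e2 e3 by simp
qed

end

section \<open>Energies of the odd extension\<close>

definition poisson_energy :: "real \<Rightarrow> (real \<Rightarrow> real) \<Rightarrow> ennreal" where
  "poisson_energy \<rho> f = (\<integral>\<^sup>+a. \<integral>\<^sup>+b. ennreal ((f a - f b)\<^sup>2 * poisson \<rho> (a - b)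
     + (f a + f b)\<^sup>2 * poisson \<rho> (a + b)) \<partial>angle \<partial>angle)"

text \<open>In both energies \<open>f a + f b\<close> is the difference of the odd extension between
  \<open>a\<close> and \<open>- b\<close>. The kernel \<open>1 / (4 sin\<^sup>2 (s / 2))\<close> is
  \<open>\<pi>\<close> times the limit of \<open>poisson \<rho> s / (1 - \<rho>)\<close> as
  \<open>\<rho>\<close> tends to one.\<close>

definition angular_energy :: "(real \<Rightarrow> real) \<Rightarrow> ennreal" where
  "angular_energy f = (\<integral>\<^sup>+a. \<integral>\<^sup>+b. ennreal ((f a - f b)\<^sup>2 / (4 * (sin ((a - b) / 2))\<^sup>2)
     + (f a + f b)\<^sup>2 / (4 * (sin ((a + b) / 2))\<^sup>2)) \<partial>angle \<partial>angle)"

text \<open>The denominator is \<open>(1 - \<rho>)\<^sup>2 + 4 \<rho> sin\<^sup>2 (s / 2)\<close>;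
  its first summand is dropped. The constant still contains the factor \<open>1 - \<rho>\<close>,
  and the quotient of the two has the correct limit at \<open>\<rho> = 1\<close>.\<close>

lemma poisson_le_inverse_sin:
  assumes "0 < \<rho>" "\<rho> < 1" "sin (s / 2) \<noteq> 0"
  shows "poisson \<rho> s \<le> (1 - \<rho>\<^sup>2) / (2 * pi * \<rho>) * (1 / (4 * (sin (s / 2))\<^sup>2))"
proof -
  have "cos s = 1 - 2 * (sin (s / 2))\<^sup>2"
    using cos_double_sin[of "s / 2"] by simp
  then have "1 - 2 * \<rho> * cos s + \<rho>\<^sup>2 = (1 - \<rho>)\<^sup>2 + 4 * \<rho> * (sin (s / 2))\<^sup>2"
    by algebra
  then have "4 * \<rho> * (sin (s / 2))\<^sup>2 \<le> 1 - 2 * \<rho> * cos s + \<rho>\<^sup>2" by simp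
  then have "(1 - \<rho>\<^sup>2) / (2 * pi * (1 - 2 * \<rho> * cos s + \<rho>\<^sup>2)) \<le> (1 - \<rho>\<^sup>2) / (2 * pi * (4 * \<rho> * (sin (s / 2))\<^sup>2))"
    using assms by (intro divide_left_mono mult_left_mono) (auto simp: power_le_one poisson_denom_pos)
  then show ?thesis by (simp add: poisson_def mult_ac)
qed

lemma poisson_energy_le_angular_energy:
  fixes f :: "real \<Rightarrow> real"
  assumes [measurable]: "f \<in> borel_measurable borel" and \<rho>: "0 < \<rho>" "\<rho> < 1"
  shows "poisson_energy \<rho> f \<le> ennreal ((1 - \<rho>\<^sup>2) / (2 * pi * \<rho>)) * angular_energy f"
proof -
  define C where "C = (1 - \<rho>\<^sup>2) / (2 * pi * \<rho>)"
  have C: "0 \<le> C" using \<rho> by (simp add: C_def power_le_one)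
  have "poisson_energy \<rho> f \<le> (\<integral>\<^sup>+a. \<integral>\<^sup>+b. ennreal C * ennreal ((f a - f b)\<^sup>2 / (4 * (sin ((a - b) / 2))\<^sup>2)
     + (f a + f b)\<^sup>2 / (4 * (sin ((a + b) / 2))\<^sup>2)) \<partial>angle \<partial>angle)"
    unfolding poisson_energy_def
  proof (rule nn_integral_mono_AE, use AE_angle in eventually_elim, rule nn_integral_mono_AE, use AE_angle in eventually_elim)
    fix a b :: real assume a: "0 < a \<and> a < pi" and b: "0 < b \<and> b < pi"
    have "0 < sin ((a + b) / 2)" using a b by (intro sin_gt_zero) auto
    then have 1: "poisson \<rho> (a + b) \<le> C * (1 / (4 * (sin ((a + b) / 2))\<^sup>2))"
      unfolding C_def using \<rho> by (intro poisson_le_inverse_sin) auto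
    \<comment> \<open>On the diagonal both sides vanish with \<open>f a - f b\<close>, whatever
      value the division by zero has.\<close>
    have 2: "(f a - f b)\<^sup>2 * poisson \<rho> (a - b) \<le> (f a - f b)\<^sup>2 * (C * (1 / (4 * (sin ((a - b) / 2))\<^sup>2)))"
    proof (cases "a = b")
      case False
      then have "sin ((a - b) / 2) \<noteq> 0"
        using a b sin_eq_0_pi[of "(a - b) / 2"] by auto
      then show ?thesis
        unfolding C_def using \<rho> by (intro mult_left_mono poisson_le_inverse_sin) auto
    qed simp
    have "(f a - f b)\<^sup>2 * poisson \<rho> (a - b) + (f a + f b)\<^sup>2 * poisson \<rho> (a + b)
       \<le> (f a - f b)\<^sup>2 * (C * (1 / (4 * (sin ((a - b) / 2))\<^sup>2))) + (f a + f b)\<^sup>2 * (C * (1 / (4 * (sin ((a + b) / 2))\<^sup>2)))"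
      by (intro add_mono 2 mult_left_mono 1) auto
    also have "\<dots> = C * ((f a - f b)\<^sup>2 / (4 * (sin ((a - b) / 2))\<^sup>2) + (f a + f b)\<^sup>2 / (4 * (sin ((a + b) / 2))\<^sup>2))"
      by (simp add: distrib_left mult_ac)
    finally show "ennreal ((f a - f b)\<^sup>2 * poisson \<rho> (a - b) + (f a + f b)\<^sup>2 * poisson \<rho> (a + b))
       \<le> ennreal C * ennreal ((f a - f b)\<^sup>2 / (4 * (sin ((a - b) / 2))\<^sup>2) + (f a + f b)\<^sup>2 / (4 * (sin ((a + b) / 2))\<^sup>2))"
      using C by (subst ennreal_mult'[symmetric]) (auto intro: ennreal_leI)
  qed
  also have "\<dots> = ennreal C * angular_energy f"
    unfolding angular_energy_def by (simp add: nn_integral_cmult)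
  finally show ?thesis unfolding C_def .
qed

context
  fixes f :: "real \<Rightarrow> real"
  assumes f_meas [measurable]: "f \<in> borel_measurable borel"
    and f_sq: "integrable angle (\<lambda>x. (f x)\<^sup>2)"
begin

lemma integrable_of_square: "integrable angle f"
  by (rule integrable_angle_of_square[OF f_meas f_sq])

lemma sine_coeff_bessel: "pi / 2 * (\<Sum>m<N. (sine_coeff f m)\<^sup>2) \<le> (\<integral>x. (f x)\<^sup>2 \<partial>angle)"
proof -
  let ?c = "sine_coeff f"
  have "0 \<le> (\<integral>x. (f x - (\<Sum>m<N. ?c m * sin (real (Suc m) * x)))\<^sup>2 \<partial>angle)" by simp
  also have "\<dots> = (\<integral>x. (f x)\<^sup>2 \<partial>angle) - pi * (\<Sum>m<N. ?c m * ?c m) + pi / 2 * (\<Sum>m<N. (?c m)\<^sup>2)"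
    by (rule has_bochner_integral_integral_eq[OF integral_square_diff_sine_polynomial[OF f_meas integrable_of_square f_sq]])
  finally show ?thesis by (simp add: power2_eq_square)
qed

lemma borel_measurable_abel_mean [measurable]: "abel_mean \<rho> f \<in> borel_measurable borel"
  unfolding abel_mean_def[abs_def] by measurable

lemma integral_mult_abel_mean_sums:
  assumes \<rho>: "0 \<le> \<rho>" "\<rho> < 1"
  shows "(\<lambda>m. pi / 2 * (\<rho> ^ Suc m * (sine_coeff f m)\<^sup>2)) sums (\<integral>x. f x * abel_mean \<rho> f x \<partial>angle)"
proof -
  let ?C = "2 / pi * (\<integral>x. \<bar>f x\<bar> \<partial>angle)"
  let ?h = "\<lambda>m x. \<rho> ^ Suc m * sine_coeff f m * sin (real (Suc m) * x)"
  have "(\<lambda>m. \<integral>x. f x * ?h m x \<partial>angle) sums (\<integral>x. f x * (\<Sum>m. ?h m x) \<partial>angle)"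
  proof (rule sums_integral_angle_geometric[where C = ?C, OF integrable_of_square \<rho>])
    fix m x
    have "\<bar>sine_coeff f m\<bar> * \<rho> ^ Suc m * \<bar>sin (real (Suc m) * x)\<bar> \<le> ?C * \<rho> ^ Suc m * 1"
      using \<rho> by (intro mult_mono sine_coeff_bound integrable_of_square f_meas) auto
    then show "\<bar>?h m x\<bar> \<le> ?C * \<rho> ^ Suc m" using \<rho> by (simp add: abs_mult mult_ac)
  qed measurable
  moreover have "(\<Sum>m. ?h m x) = abel_mean \<rho> f x" for x
    by (rule sums_unique[OF abel_mean_sums[OF f_meas integrable_of_square \<rho>], symmetric])
  moreover have "(\<integral>x. f x * ?h m x \<partial>angle) = pi / 2 * (\<rho> ^ Suc m * (sine_coeff f m)\<^sup>2)" for m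
  proof -
    have "f x * ?h m x = (\<rho> ^ Suc m * sine_coeff f m) * (f x * sin (real (Suc m) * x))" for x
      by (simp only: mult_ac)
    then show ?thesis
      by (simp only: integral_mult_right_zero integral_sine_coeff[OF f_meas integrable_of_square]) (simp add: power2_eq_square)
  qed
  ultimately show ?thesis by (simp only:)
qed

text \<open>On coefficients this is \<open>(1 - r)\<^sup>2 \<le> 1 - r\<close> for
  \<open>r = \<rho> ^ Suc m\<close>, that is \<open>r\<^sup>2 \<le> r\<close>. It is applied to the
  partial sums of the damped series, and Fatou's lemma carries it over to the Abel mean.\<close>

lemma integral_square_diff_abel_mean_le:
  assumes \<rho>: "0 \<le> \<rho>" "\<rho> < 1"
  shows "(\<integral>\<^sup>+x. ennreal ((f x - abel_mean \<rho> f x)\<^sup>2) \<partial>angle)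
    \<le> ennreal ((\<integral>x. (f x)\<^sup>2 \<partial>angle) - (\<integral>x. f x * abel_mean \<rho> f x \<partial>angle))"
proof -
  let ?c = "sine_coeff f"
  let ?p = "\<lambda>N x. \<Sum>m<N. (\<rho> ^ Suc m * ?c m) * sin (real (Suc m) * x)"
  let ?I = "\<integral>x. (f x)\<^sup>2 \<partial>angle"
  define u where "u = (\<lambda>N. ?I - (\<Sum>m<N. pi / 2 * (\<rho> ^ Suc m * (?c m)\<^sup>2)))"
  have u: "u \<longlonglongrightarrow> ?I - (\<integral>x. f x * abel_mean \<rho> f x \<partial>angle)"
    unfolding u_def using integral_mult_abel_mean_sums[OF \<rho>] by (intro tendsto_diff tendsto_const) (simp add: sums_def)
  have p: "(\<lambda>N. ennreal ((f x - ?p N x)\<^sup>2)) \<longlonglongrightarrow> ennreal ((f x - abel_mean \<rho> f x)\<^sup>2)" for x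
    using abel_mean_sums[OF f_meas integrable_of_square \<rho>, of x] unfolding sums_def
    by (intro tendsto_ennrealI tendsto_power tendsto_diff tendsto_const)
  have le: "(\<integral>\<^sup>+x. ennreal ((f x - ?p N x)\<^sup>2) \<partial>angle) \<le> ennreal (u N)" for N
  proof -
    note * = integral_square_diff_sine_polynomial[OF f_meas integrable_of_square f_sq, of "\<lambda>m. \<rho> ^ Suc m * ?c m" N]
    have "(\<Sum>m<N. (\<rho> ^ Suc m * ?c m)\<^sup>2) \<le> (\<Sum>m<N. \<rho> ^ Suc m * (?c m)\<^sup>2)"
    proof (rule sum_mono)
      fix m
      have "\<rho> ^ Suc m * \<rho> ^ Suc m * (?c m)\<^sup>2 \<le> \<rho> ^ Suc m * 1 * (?c m)\<^sup>2"
        using \<rho> by (intro mult_right_mono mult_left_mono) (auto simp: power_le_one mult_le_one)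
      then show "(\<rho> ^ Suc m * ?c m)\<^sup>2 \<le> \<rho> ^ Suc m * (?c m)\<^sup>2" by (simp add: power2_eq_square mult_ac)
    qed
    moreover have "(\<Sum>m<N. \<rho> ^ Suc m * ?c m * ?c m) = (\<Sum>m<N. \<rho> ^ Suc m * (?c m)\<^sup>2)"
      by (simp add: power2_eq_square mult_ac)
    ultimately have "?I - pi * (\<Sum>m<N. \<rho> ^ Suc m * ?c m * ?c m) + pi / 2 * (\<Sum>m<N. (\<rho> ^ Suc m * ?c m)\<^sup>2)
       \<le> ?I - pi * (\<Sum>m<N. \<rho> ^ Suc m * (?c m)\<^sup>2) + pi / 2 * (\<Sum>m<N. \<rho> ^ Suc m * (?c m)\<^sup>2)"
      by (simp only:) (intro add_left_mono mult_left_mono, auto)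
    also have "\<dots> = u N" unfolding u_def sum_distrib_left[symmetric] by simp
    finally show ?thesis
      using * by (subst nn_integral_eq_integral) (auto simp: has_bochner_integral_iff intro: ennreal_leI)
  qed
  have "(\<integral>\<^sup>+x. ennreal ((f x - abel_mean \<rho> f x)\<^sup>2) \<partial>angle) = (\<integral>\<^sup>+x. liminf (\<lambda>N. ennreal ((f x - ?p N x)\<^sup>2)) \<partial>angle)"
    by (intro nn_integral_cong lim_imp_Liminf[symmetric] p) simp
  also have "\<dots> \<le> liminf (\<lambda>N. \<integral>\<^sup>+x. ennreal ((f x - ?p N x)\<^sup>2) \<partial>angle)"
    by (rule nn_integral_liminf) measurable
  also have "\<dots> \<le> liminf (\<lambda>N. ennreal (u N))"
    by (intro Liminf_mono always_eventually allI le)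
  also have "\<dots> = ennreal (?I - (\<integral>x. f x * abel_mean \<rho> f x \<partial>angle))"
    by (intro lim_imp_Liminf tendsto_ennrealI u) simp
  finally show ?thesis .
qed

text \<open>Bessel's inequality up to \<open>M \<ge> N\<close> is combined with the exact series for
  \<open>\<integral> f (abel_mean \<rho> f)\<close> as \<open>M\<close> tends to infinity; the terms
  between \<open>N\<close> and \<open>M\<close> are nonnegative and dropped.\<close>

lemma integral_square_minus_abel_mean_ge:
  assumes \<rho>: "0 \<le> \<rho>" "\<rho> < 1"
  shows "pi / 2 * (\<Sum>m<N. (1 - \<rho> ^ Suc m) * (sine_coeff f m)\<^sup>2)
    \<le> (\<integral>x. (f x)\<^sup>2 \<partial>angle) - (\<integral>x. f x * abel_mean \<rho> f x \<partial>angle)"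
proof (rule LIMSEQ_le_const)
  let ?c = "sine_coeff f"
  let ?I = "\<integral>x. (f x)\<^sup>2 \<partial>angle"
  show "(\<lambda>M. ?I - (\<Sum>m<M. pi / 2 * (\<rho> ^ Suc m * (?c m)\<^sup>2))) \<longlonglongrightarrow> ?I - (\<integral>x. f x * abel_mean \<rho> f x \<partial>angle)"
    using integral_mult_abel_mean_sums[OF \<rho>] by (intro tendsto_diff tendsto_const) (simp add: sums_def)
  have "pi / 2 * (\<Sum>m<N. (1 - \<rho> ^ Suc m) * (?c m)\<^sup>2) \<le> ?I - (\<Sum>m<M. pi / 2 * (\<rho> ^ Suc m * (?c m)\<^sup>2))" if "N \<le> M" for M
  proof -
    have "(\<Sum>m<N. (1 - \<rho> ^ Suc m) * (?c m)\<^sup>2) \<le> (\<Sum>m<M. (1 - \<rho> ^ Suc m) * (?c m)\<^sup>2)"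
      by (rule sum_mono2) (use that \<rho> in \<open>auto intro!: mult_nonneg_nonneg simp: power_le_one mult_le_one\<close>)
    then have "pi / 2 * (\<Sum>m<N. (1 - \<rho> ^ Suc m) * (?c m)\<^sup>2) \<le> pi / 2 * (\<Sum>m<M. (1 - \<rho> ^ Suc m) * (?c m)\<^sup>2)"
      by (rule mult_left_mono) simp
    also have "\<dots> = pi / 2 * (\<Sum>m<M. (?c m)\<^sup>2) - (\<Sum>m<M. pi / 2 * (\<rho> ^ Suc m * (?c m)\<^sup>2))"
      by (simp add: sum_distrib_left left_diff_distrib right_diff_distrib sum_subtractf)
    also have "\<dots> \<le> ?I - (\<Sum>m<M. pi / 2 * (\<rho> ^ Suc m * (?c m)\<^sup>2))"
      using sine_coeff_bessel[of M] by simp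
    finally show ?thesis .
  qed
  then show "\<exists>N'. \<forall>M\<ge>N'. pi / 2 * (\<Sum>m<N. (1 - \<rho> ^ Suc m) * (?c m)\<^sup>2) \<le> ?I - (\<Sum>m<M. pi / 2 * (\<rho> ^ Suc m * (?c m)\<^sup>2))"
    by blast
qed

text \<open>Expanding the squares leaves two kernels: the sum \<open>k\<close>, symmetric and of
  mass one, so that \<open>f a\<close> and \<open>f b\<close> each contribute
  \<open>\<integral> f\<^sup>2\<close>, and the difference \<open>l\<close>, which multiplies the
  mixed term and is the kernel of the Abel mean.\<close>

lemma poisson_energy_eq:
  assumes \<rho>: "0 \<le> \<rho>" "\<rho> < 1"
  shows "poisson_energy \<rho> f = ennreal (2 * ((\<integral>x. (f x)\<^sup>2 \<partial>angle) - (\<integral>x. f x * abel_mean \<rho> f x \<partial>angle)))"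
proof -
  define B where "B = (1 - \<rho>\<^sup>2) / (2 * pi * (1 - \<rho>)\<^sup>2)"
  have P: "poisson \<rho> s \<le> B" "0 \<le> poisson \<rho> s" for s
    unfolding B_def using \<rho> by (auto intro: poisson_le poisson_nonneg)
  define k where "k = (\<lambda>a b. poisson \<rho> (a - b) + poisson \<rho> (a + b))"
  define l where "l = (\<lambda>a b. poisson \<rho> (a - b) - poisson \<rho> (a + b))"
  have [measurable]: "(\<lambda>p. k (fst p) (snd p)) \<in> borel_measurable (borel \<Otimes>\<^sub>M borel)" unfolding k_def by measurable
  have [measurable]: "k a \<in> borel_measurable borel" "l a \<in> borel_measurable borel" for a unfolding k_def l_def by measurable
  have k0: "0 \<le> k a b" for a b unfolding k_def using P by (intro add_nonneg_nonneg)
  have kB: "\<bar>k a b\<bar> \<le> 2 * B" for a b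
    using P(1)[of "a - b"] P(1)[of "a + b"] k0[of a b] unfolding k_def by linarith
  have lB: "\<bar>l a b\<bar> \<le> B" for a b
    using P[of "a - b"] P[of "a + b"] unfolding l_def by linarith
  have k_int: "integrable angle (k a)" for a
    unfolding k_def using \<rho> by (rule integrable_poisson_add)
  have k1: "(\<integral>b. k a b \<partial>angle) = 1" for a
    unfolding k_def using \<rho> by (rule integral_poisson_add)
  have ksym: "k a b = k b a" for a b
    unfolding k_def poisson_def by (simp add: add.commute cos_diff)
  define J where "J = (\<lambda>a. \<integral>b. (f b)\<^sup>2 * k a b \<partial>angle)"
  have J_int: "integrable angle (\<lambda>b. (f b)\<^sup>2 * k a b)" for a
    by (rule integrable_angle_mult_bounded[OF f_sq _ kB]) measurable
  have J0: "0 \<le> J a" for a unfolding J_def by (intro integral_nonneg_AE) (auto intro!: AE_I2 mult_nonneg_nonneg k0)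
  have [measurable]: "J \<in> borel_measurable borel" unfolding J_def[abs_def] by measurable
  let ?I = "\<integral>x. (f x)\<^sup>2 \<partial>angle"
  have "(\<integral>\<^sup>+a. ennreal (J a) \<partial>angle) = (\<integral>\<^sup>+a. \<integral>\<^sup>+b. ennreal ((f b)\<^sup>2 * k a b) \<partial>angle \<partial>angle)"
    unfolding J_def by (intro nn_integral_cong nn_integral_eq_integral[symmetric] J_int) (auto intro!: AE_I2 mult_nonneg_nonneg k0)
  also have "\<dots> = (\<integral>\<^sup>+b. \<integral>\<^sup>+a. ennreal ((f b)\<^sup>2 * k a b) \<partial>angle \<partial>angle)"
    by (rule angle2.Fubini'[symmetric]) measurable
  also have "\<dots> = (\<integral>\<^sup>+b. ennreal ((f b)\<^sup>2) \<partial>angle)"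
  proof (rule nn_integral_cong)
    fix b
    have "(\<integral>\<^sup>+a. ennreal ((f b)\<^sup>2 * k a b) \<partial>angle) = ennreal (\<integral>a. (f b)\<^sup>2 * k b a \<partial>angle)"
      unfolding ksym[of _ b] using k_int by (intro nn_integral_eq_integral) (auto intro!: AE_I2 mult_nonneg_nonneg k0)
    then show "(\<integral>\<^sup>+a. ennreal ((f b)\<^sup>2 * k a b) \<partial>angle) = ennreal ((f b)\<^sup>2)" by (simp add: k1)
  qed
  also have "\<dots> = ennreal ?I" by (rule nn_integral_eq_integral[OF f_sq]) simp
  finally have J: "has_bochner_integral angle J ?I"
    by (intro has_bochner_integral_nn_integral) (auto simp: J0)
  have fa_int: "integrable angle (\<lambda>b. f b * l a b)" for a
    by (rule integrable_angle_mult_bounded[OF integrable_of_square _ lB]) measurable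
  have ab: "abel_mean \<rho> f a = (\<integral>b. f b * l a b \<partial>angle)" for a by (simp add: abel_mean_def l_def)
  have abB: "\<bar>abel_mean \<rho> f a\<bar> \<le> (\<integral>b. \<bar>f b\<bar> \<partial>angle) * B" for a
  proof -
    have "\<bar>abel_mean \<rho> f a\<bar> \<le> (\<integral>b. \<bar>f b * l a b\<bar> \<partial>angle)" unfolding ab by (rule integral_abs_bound)
    also have "\<dots> \<le> (\<integral>b. \<bar>f b\<bar> * B \<partial>angle)"
    proof (rule integral_mono)
      show "\<bar>f b * l a b\<bar> \<le> \<bar>f b\<bar> * B" for b unfolding abs_mult by (intro mult_left_mono lB) simp
    qed (use fa_int integrable_of_square in auto)
    finally show ?thesis by simp
  qed
  have fab_int: "integrable angle (\<lambda>a. f a * abel_mean \<rho> f a)"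
    by (rule integrable_angle_mult_bounded[OF integrable_of_square _ abB]) measurable
  let ?g = "\<lambda>a b. (f a - f b)\<^sup>2 * poisson \<rho> (a - b) + (f a + f b)\<^sup>2 * poisson \<rho> (a + b)"
  have g: "?g a b = (f a)\<^sup>2 * k a b + (f b)\<^sup>2 * k a b - 2 * f a * (f b * l a b)" for a b
    unfolding k_def l_def by (simp add: power2_eq_square algebra_simps)
  have g0: "0 \<le> ?g a b" for a b using P by (intro add_nonneg_nonneg mult_nonneg_nonneg) auto
  have inner: "has_bochner_integral angle (?g a) ((f a)\<^sup>2 + J a - 2 * f a * abel_mean \<rho> f a)" for a
  proof -
    have "has_bochner_integral angle (\<lambda>b. (f a)\<^sup>2 * k a b + (f b)\<^sup>2 * k a b - 2 * f a * (f b * l a b))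
       ((f a)\<^sup>2 * 1 + J a - 2 * f a * abel_mean \<rho> f a)"
      unfolding J_def ab k1[of a, symmetric]
      by (intro has_bochner_integral_diff has_bochner_integral_add has_bochner_integral_mult_right
           has_bochner_integral_integrable k_int J_int fa_int)
    then show ?thesis unfolding g by simp
  qed
  have "poisson_energy \<rho> f = (\<integral>\<^sup>+a. ennreal ((f a)\<^sup>2 + J a - 2 * f a * abel_mean \<rho> f a) \<partial>angle)"
    unfolding poisson_energy_def
  proof (rule nn_integral_cong)
    fix a
    show "(\<integral>\<^sup>+b. ennreal (?g a b) \<partial>angle) = ennreal ((f a)\<^sup>2 + J a - 2 * f a * abel_mean \<rho> f a)"
      using inner[of a] g0 by (subst nn_integral_eq_integral) (auto simp: has_bochner_integral_iff)
  qed
  also have "\<dots> = ennreal (?I + ?I - 2 * (\<integral>x. f x * abel_mean \<rho> f x \<partial>angle))"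
  proof -
    have "has_bochner_integral angle (\<lambda>a. (f a)\<^sup>2 + J a - 2 * (f a * abel_mean \<rho> f a)) (?I + ?I - 2 * (\<integral>x. f x * abel_mean \<rho> f x \<partial>angle))"
      by (intro has_bochner_integral_diff has_bochner_integral_add has_bochner_integral_mult_right J
           has_bochner_integral_integrable f_sq fab_int)
    moreover have "0 \<le> (f a)\<^sup>2 + J a - 2 * f a * abel_mean \<rho> f a" for a
      unfolding has_bochner_integral_integral_eq[OF inner, symmetric] using g0 by simp
    ultimately show ?thesis
      by (subst nn_integral_eq_integral) (auto simp: has_bochner_integral_iff mult.assoc)
  qed
  finally show ?thesis by (simp add: algebra_simps)
qed

end

section \<open>The cubic integral\<close>

text \<open>Division by \<open>sin x\<close> costs only the factor \<open>m + 1\<close>, which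
  remains summable against the damping \<open>\<rho> ^ m\<close>.\<close>

lemma abs_sin_Suc_le: "\<bar>sin (real (Suc m) * x)\<bar> \<le> real (Suc m) * \<bar>sin x\<bar>"
proof -
  have "\<bar>\<Sum>j\<le>m. cos ((real m - 2 * real j) * x)\<bar> \<le> (\<Sum>j\<le>m. \<bar>cos ((real m - 2 * real j) * x)\<bar>)"
    by (rule sum_abs)
  also have "\<dots> \<le> (\<Sum>j\<le>m. 1)" by (intro sum_mono) auto
  finally have "\<bar>\<Sum>j\<le>m. cos ((real m - 2 * real j) * x)\<bar> \<le> real (Suc m)" by simp
  then have "\<bar>sin x\<bar> * \<bar>\<Sum>j\<le>m. cos ((real m - 2 * real j) * x)\<bar> \<le> \<bar>sin x\<bar> * real (Suc m)"
    by (rule mult_left_mono) simp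
  then show ?thesis unfolding sin_Suc_times_eq_sum abs_mult by (simp add: mult.commute)
qed

context
  fixes f :: "real \<Rightarrow> real" and w :: real
  assumes f_meas [measurable]: "f \<in> borel_measurable borel"
    and f_sq: "integrable angle (\<lambda>x. (f x)\<^sup>2)"
    and w: "angular_energy f \<le> ennreal w" "0 \<le> w"
begin

lemma integral_square_minus_abel_mean_le:
  assumes \<rho>: "0 < \<rho>" "\<rho> < 1"
  shows "(\<integral>x. (f x)\<^sup>2 \<partial>angle) - (\<integral>x. f x * abel_mean \<rho> f x \<partial>angle) \<le> (1 - \<rho>\<^sup>2) / (4 * pi * \<rho>) * w"
proof -
  have C: "0 \<le> (1 - \<rho>\<^sup>2) / (2 * pi * \<rho>)" using \<rho> by (simp add: power_le_one)
  let ?d = "(\<integral>x. (f x)\<^sup>2 \<partial>angle) - (\<integral>x. f x * abel_mean \<rho> f x \<partial>angle)"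
  have "ennreal (2 * ?d) = poisson_energy \<rho> f"
    using poisson_energy_eq[OF f_meas f_sq, of \<rho>] \<rho> by simp
  also have "\<dots> \<le> ennreal ((1 - \<rho>\<^sup>2) / (2 * pi * \<rho>)) * ennreal w"
    by (rule order_trans[OF poisson_energy_le_angular_energy[OF f_meas \<rho>] mult_left_mono[OF w(1)]]) simp
  also have "\<dots> = ennreal ((1 - \<rho>\<^sup>2) / (2 * pi * \<rho>) * w)" by (rule ennreal_mult'[OF C, symmetric])
  finally have "2 * ?d \<le> (1 - \<rho>\<^sup>2) / (2 * pi * \<rho>) * w"
    using mult_nonneg_nonneg[OF C w(2)] by (simp only: ennreal_le_iff)
  then show ?thesis by (simp add: field_simps)
qed

text \<open>This is \<open>tr H\<^sup>2 \<le> w / \<pi>\<^sup>2\<close>. Writing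
  \<open>1 - \<rho> ^ Suc m\<close> as \<open>1 - \<rho>\<close> times a geometric sum, the factor
  \<open>1 - \<rho>\<close> cancels against the one in \<open>1 - \<rho>\<^sup>2\<close>; at
  \<open>\<rho> = 1\<close> the geometric sum equals \<open>m + 1\<close>.\<close>

lemma weighted_sine_coeff_bessel:
  "(\<Sum>m<N. real (m + 1) * (sine_coeff f m)\<^sup>2) \<le> w / pi\<^sup>2"
proof (rule tendsto_le)
  let ?c = "sine_coeff f"
  let ?F = "at_left (1::real)"
  show "?F \<noteq> bot" by simp
  show "((\<lambda>\<rho>. \<Sum>m<N. (\<Sum>i\<le>m. \<rho> ^ i) * (?c m)\<^sup>2) \<longlongrightarrow> (\<Sum>m<N. real (m + 1) * (?c m)\<^sup>2)) ?F"
    by (rule tendsto_eq_intros tendsto_ident_at refl | simp)+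
  show "((\<lambda>\<rho>. (1 + \<rho>) / (2 * pi\<^sup>2 * \<rho>) * w) \<longlongrightarrow> w / pi\<^sup>2) ?F"
    by (rule tendsto_eq_intros tendsto_ident_at refl | simp)+
  have "\<forall>\<^sub>F \<rho> in ?F. \<rho> \<in> {0<..<1}" by (rule eventually_at_left_real) simp
  then show "\<forall>\<^sub>F \<rho> in ?F. (\<Sum>m<N. (\<Sum>i\<le>m. \<rho> ^ i) * (?c m)\<^sup>2) \<le> (1 + \<rho>) / (2 * pi\<^sup>2 * \<rho>) * w"
  proof eventually_elim
    case (elim \<rho>)
    then have \<rho>: "0 < \<rho>" "\<rho> < 1" by auto
    have geo: "(1 - \<rho>) * (\<Sum>i\<le>m. \<rho> ^ i) = 1 - \<rho> ^ Suc m" for m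
      using sum_gp_basic[of \<rho> m] by simp
    have "pi / 2 * (\<Sum>m<N. (1 - \<rho> ^ Suc m) * (?c m)\<^sup>2) \<le> (1 - \<rho>\<^sup>2) / (4 * pi * \<rho>) * w"
      by (rule order_trans[OF integral_square_minus_abel_mean_ge[OF f_meas f_sq less_imp_le[OF \<rho>(1)] \<rho>(2)]
          integral_square_minus_abel_mean_le[OF \<rho>]])
    also have "(\<Sum>m<N. (1 - \<rho> ^ Suc m) * (?c m)\<^sup>2) = (1 - \<rho>) * (\<Sum>m<N. (\<Sum>i\<le>m. \<rho> ^ i) * (?c m)\<^sup>2)"
      by (simp only: geo[symmetric] mult.assoc sum_distrib_left[symmetric])
    finally have "(1 - \<rho>) * (pi / 2 * (\<Sum>m<N. (\<Sum>i\<le>m. \<rho> ^ i) * (?c m)\<^sup>2)) \<le> (1 - \<rho>) * ((1 + \<rho>) / (4 * pi * \<rho>) * w)"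
      by (simp add: power2_eq_square algebra_simps)
    then have "pi / 2 * (\<Sum>m<N. (\<Sum>i\<le>m. \<rho> ^ i) * (?c m)\<^sup>2) \<le> (1 + \<rho>) / (4 * pi * \<rho>) * w"
      using \<rho> by (simp only: mult_le_cancel_left_pos diff_gt_0_iff_gt)
    then have "2 / pi * (pi / 2 * (\<Sum>m<N. (\<Sum>i\<le>m. \<rho> ^ i) * (?c m)\<^sup>2)) \<le> 2 / pi * ((1 + \<rho>) / (4 * pi * \<rho>) * w)"
      by (rule mult_left_mono) simp
    moreover have "2 / pi * ((1 + \<rho>) / (4 * pi * \<rho>) * w) = (1 + \<rho>) / (2 * pi\<^sup>2 * \<rho>) * w"
      using \<rho> by (simp add: power2_eq_square field_simps)
    ultimately show ?case by simp
  qed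
qed

text \<open>The finiteness of the energy alone forces the Abel means to converge, at rate \<open>O(1 - \<rho>)\<close>.\<close>

lemma abel_mean_AE_convergent:
  obtains \<rho> where "\<And>n. 0 < \<rho> n" "\<And>n. \<rho> n < (1::real)" "\<rho> \<longlonglongrightarrow> 1"
    "AE x in angle. (\<lambda>n. abel_mean (\<rho> n) f x) \<longlonglongrightarrow> f x"
proof -
  \<comment> \<open>The shift by two keeps \<open>r 0\<close> positive, as division by
    \<open>\<rho>\<close> in the energy bound demands.\<close>
  define r where "r = (\<lambda>n. 1 - 1 / real (n + 2))"
  have r: "0 < r n" "r n < 1" for n by (auto simp: r_def field_simps)
  have r1: "r \<longlonglongrightarrow> 1" unfolding r_def by real_asymp
  let ?d = "\<lambda>n x. (f x - abel_mean (r n) f x)\<^sup>2"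
  have bd: "(\<integral>\<^sup>+x. ennreal (?d n x) \<partial>angle) \<le> ennreal ((1 - (r n)\<^sup>2) / (4 * pi * r n) * w)" for n
    using integral_square_diff_abel_mean_le[OF f_meas f_sq, of "r n"] integral_square_minus_abel_mean_le[of "r n"] r[of n]
    by (meson ennreal_leI less_imp_le order_trans)
  have [measurable]: "abel_mean (r n) f \<in> borel_measurable borel" for n
    by (rule borel_measurable_abel_mean[OF f_meas f_sq])
  have int: "integrable angle (?d n)" for n
    by (rule integrableI_bounded) (use bd[of n] in \<open>auto intro: order.strict_trans1\<close>)
  have "(\<lambda>n. \<integral>x. norm (?d n x) \<partial>angle) \<longlonglongrightarrow> 0"
  proof (rule tendsto_sandwich)
    show "\<forall>\<^sub>F n in sequentially. 0 \<le> (\<integral>x. norm (?d n x) \<partial>angle)" by simp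
    show "\<forall>\<^sub>F n in sequentially. (\<integral>x. norm (?d n x) \<partial>angle) \<le> (1 - (r n)\<^sup>2) / (4 * pi * r n) * w"
    proof (intro always_eventually allI)
      fix n
      have "ennreal (\<integral>x. norm (?d n x) \<partial>angle) \<le> ennreal ((1 - (r n)\<^sup>2) / (4 * pi * r n) * w)"
        using bd[of n] nn_integral_eq_integral[OF int[of n]] by simp
      moreover have "0 \<le> (1 - (r n)\<^sup>2) / (4 * pi * r n) * w"
        using r[of n] w(2) by (intro mult_nonneg_nonneg divide_nonneg_nonneg) (auto simp: power_le_one less_imp_le)
      ultimately show "(\<integral>x. norm (?d n x) \<partial>angle) \<le> (1 - (r n)\<^sup>2) / (4 * pi * r n) * w"
        by (subst (asm) ennreal_le_iff)
    qed
    show "(\<lambda>n. (1 - (r n)\<^sup>2) / (4 * pi * r n) * w) \<longlonglongrightarrow> 0"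
      by (rule tendsto_eq_intros r1 refl | simp)+
  qed simp
  from tendsto_L1_AE_subseq[OF int this] obtain s where s: "strict_mono s"
    "AE x in angle. (\<lambda>n. ?d (s n) x) \<longlonglongrightarrow> 0" by blast
  have "(\<lambda>n. abel_mean (r (s n)) f x) \<longlonglongrightarrow> f x" if "(\<lambda>n. ?d (s n) x) \<longlonglongrightarrow> 0" for x
  proof -
    have "(\<lambda>n. sqrt (?d (s n) x)) \<longlonglongrightarrow> sqrt 0" by (intro tendsto_real_sqrt that)
    then have "(\<lambda>n. f x - abel_mean (r (s n)) f x) \<longlonglongrightarrow> 0" by (simp add: tendsto_rabs_zero_iff)
    from tendsto_diff[OF tendsto_const[of "f x"] this] show ?thesis by simp
  qed
  then have "AE x in angle. (\<lambda>n. abel_mean ((r \<circ> s) n) f x) \<longlonglongrightarrow> f x"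
    using s(2) unfolding comp_def by (auto elim: eventually_mono simp del: tendsto_power_zero)
  moreover have "(r \<circ> s) \<longlonglongrightarrow> 1" using r1 s(1) by (rule LIMSEQ_subseq_LIMSEQ)
  ultimately show thesis using r that[of "r \<circ> s"] by auto
qed

text \<open>For fixed \<open>\<rho>\<close> all partial sums are bounded by a multiple of
  \<open>\<bar>sin x\<bar>\<close>, so their cubes over \<open>sin x\<close> have a common bound and
  the trace estimate passes to the limit. Both products in the minor acquire the same damping,
  \<open>\<rho> ^ (z + k + 2)\<close>, since index \<open>m\<close> carries
  \<open>\<rho> ^ Suc m\<close>.\<close>

lemma abel_mean_cube_le:
  fixes z k :: nat
  assumes \<rho>: "0 < \<rho>" "\<rho> < 1"
  defines "\<delta> \<equiv> \<rho> ^ (z + k + 2) * (sine_coeff f 0 * sine_coeff f (z + k) - sine_coeff f k * sine_coeff f z)"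
  shows "integrable angle (\<lambda>x. abel_mean \<rho> f x ^ 3 / sin x)" (is ?int)
    and "(\<integral>x. abel_mean \<rho> f x ^ 3 / sin x \<partial>angle) \<le> pi / 2 * sqrt (w / pi\<^sup>2 * ((w / pi\<^sup>2)\<^sup>2 - \<delta>\<^sup>2))" (is ?le)
proof -
  define B where "B = w / pi\<^sup>2"
  define \<beta> where "\<beta> = sine_coeff f"
  define D where "D = 2 / pi * (\<integral>x. \<bar>f x\<bar> \<partial>angle)"
  have D: "\<bar>\<beta> m\<bar> \<le> D" for m
    unfolding \<beta>_def D_def by (rule sine_coeff_bound[OF f_meas integrable_of_square[OF f_meas f_sq]])
  then have D0: "0 \<le> D" by (meson abs_ge_zero order_trans)
  let ?s = "\<lambda>m x. \<rho> ^ Suc m * \<beta> m * sin (real (Suc m) * x)"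
  let ?p = "\<lambda>N x. \<Sum>m<N. ?s m x"
  let ?g = "\<lambda>N x. ?p N x ^ 3 / sin x"
  have p: "(\<lambda>N. ?p N x) \<longlonglongrightarrow> abel_mean \<rho> f x" for x
    using abel_mean_sums[OF f_meas integrable_of_square[OF f_meas f_sq], of \<rho> x] \<rho> by (simp add: sums_def \<beta>_def)
  have summ: "summable (\<lambda>m. real (Suc m) * \<rho> ^ m)"
    using sums_summable[OF geometric_deriv_sums[of \<rho>]] \<rho> by simp
  define C where "C = D * (\<Sum>m. real (Suc m) * \<rho> ^ m)"
  have C0: "0 \<le> C" unfolding C_def using D0 \<rho> by (intro mult_nonneg_nonneg suminf_nonneg summ) auto
  have pC: "\<bar>?p N x\<bar> \<le> C * \<bar>sin x\<bar>" for N x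
  proof -
    have "\<bar>?p N x\<bar> \<le> (\<Sum>m<N. \<bar>?s m x\<bar>)" by (rule sum_abs)
    also have "\<dots> \<le> (\<Sum>m<N. D * (real (Suc m) * \<rho> ^ m) * \<bar>sin x\<bar>)"
    proof (rule sum_mono)
      fix m
      have "\<rho> ^ Suc m \<le> \<rho> ^ m" using \<rho> by (simp add: mult_left_le_one_le)
      then have "\<rho> ^ Suc m * \<bar>\<beta> m\<bar> * \<bar>sin (real (Suc m) * x)\<bar> \<le> \<rho> ^ m * D * (real (Suc m) * \<bar>sin x\<bar>)"
        using \<rho> D0 by (intro mult_mono D abs_sin_Suc_le) auto
      then show "\<bar>?s m x\<bar> \<le> D * (real (Suc m) * \<rho> ^ m) * \<bar>sin x\<bar>"
        using \<rho> by (simp add: abs_mult mult_ac)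
    qed
    also have "\<dots> = D * (\<Sum>m<N. real (Suc m) * \<rho> ^ m) * \<bar>sin x\<bar>"
      by (simp add: sum_distrib_left sum_distrib_right)
    also have "\<dots> \<le> C * \<bar>sin x\<bar>"
      unfolding C_def using D0 \<rho> by (intro mult_right_mono mult_left_mono sum_le_suminf summ) auto
    finally show ?thesis .
  qed
  have gC: "AE x in angle. norm (?g N x) \<le> C ^ 3" for N
    using AE_angle
  proof eventually_elim
    case (elim x)
    then have sx: "0 < sin x" by (auto intro: sin_gt_zero)
    have "\<bar>?p N x\<bar> ^ 3 \<le> (C * \<bar>sin x\<bar>) ^ 3" by (intro power_mono pC) simp
    also have "\<dots> \<le> C ^ 3 * sin x"
    proof -
      have "sin x ^ 3 \<le> sin x ^ 1" using sx by (intro power_decreasing) auto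
      then show ?thesis using sx C0 by (simp add: power_mult_distrib mult_left_mono)
    qed
    finally show ?case using sx by (simp add: power_abs abs_mult divide_le_eq flip: power_abs)
  qed
  have lim: "AE x in angle. (\<lambda>N. ?g N x) \<longlonglongrightarrow> abel_mean \<rho> f x ^ 3 / sin x"
    using AE_angle
  proof eventually_elim
    case (elim x)
    then have "0 < sin x" by (auto intro: sin_gt_zero)
    then show ?case by (intro tendsto_divide tendsto_power p tendsto_const) auto
  qed
  have [measurable]: "abel_mean \<rho> f \<in> borel_measurable borel"
    by (rule borel_measurable_abel_mean[OF f_meas f_sq])
  have dom: "integrable angle (\<lambda>x. C ^ 3)" by simp
  show ?int
    by (rule integrable_dominated_convergence[OF _ _ dom lim gC]) measurable
  have conv: "(\<lambda>N. integral\<^sup>L angle (?g N)) \<longlonglongrightarrow> (\<integral>x. abel_mean \<rho> f x ^ 3 / sin x \<partial>angle)"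
    by (rule integral_dominated_convergence[OF _ _ dom lim gC]) measurable
  \<comment> \<open>From \<open>z + k < N\<close> on, the truncation does not touch the four
    coefficients of the minor.\<close>
  have "integral\<^sup>L angle (?g N) \<le> pi / 2 * sqrt (B * (B\<^sup>2 - \<delta>\<^sup>2))" if N: "z + k < N" for N
  proof -
    define c where "c = (\<lambda>m. if m < N then \<rho> ^ Suc m * \<beta> m else 0)"
    define S where "S = (\<Sum>x<N. \<Sum>y<N. \<Sum>z<N. c (x + y) * c (y + z) * c (z + x))"
    define A where "A = (\<Sum>m<N. real (m + 1) * (c m)\<^sup>2)"
    have c0: "c m = 0" if "N \<le> m" for m using that by (simp add: c_def)
    have "(\<lambda>x. (\<Sum>m<N. c m * sin (real (Suc m) * x)) ^ 3 / sin x) = ?g N"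
      by (simp add: c_def)
    then have "has_bochner_integral angle (?g N) (pi / 2 * S)"
      using integral_sine_polynomial_cube[of N c, OF c0] unfolding S_def by simp
    then have S: "integral\<^sup>L angle (?g N) = pi / 2 * S" by (rule has_bochner_integral_integral_eq)
    have "c 0 * c (z + k) - c k * c z = \<delta>"
      unfolding \<delta>_def \<beta>_def[symmetric] using N by (simp add: c_def power_add algebra_simps)
    then have S2: "S\<^sup>2 \<le> A * (A\<^sup>2 - \<delta>\<^sup>2)"
      using hankel_trace_cube[of N c z k, OF c0] unfolding S_def A_def by simp
    have AB: "A \<le> B"
    proof -
      have "A \<le> (\<Sum>m<N. real (m + 1) * (\<beta> m)\<^sup>2)"
        unfolding A_def
      proof (rule sum_mono)
        fix m assume "m \<in> {..<N}"
        have "(\<rho> ^ Suc m)\<^sup>2 * (\<beta> m)\<^sup>2 \<le> 1 * (\<beta> m)\<^sup>2"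
          using \<rho> by (intro mult_right_mono power_le_one) (auto simp: mult_le_one power_le_one)
        then show "real (m + 1) * (c m)\<^sup>2 \<le> real (m + 1) * (\<beta> m)\<^sup>2"
          using \<open>m \<in> {..<N}\<close> by (intro mult_left_mono) (auto simp: c_def power_mult_distrib)
      qed
      also have "\<dots> \<le> B" unfolding B_def \<beta>_def by (rule weighted_sine_coeff_bessel)
      finally show ?thesis .
    qed
    have A0: "0 \<le> A" unfolding A_def by (intro sum_nonneg) auto
    \<comment> \<open>The comparison uses \<open>\<delta>\<^sup>2 \<le> A\<^sup>2\<close>. For
      \<open>A > 0\<close> this follows from \<open>S2\<close>, whose left-hand side is a square;
      for \<open>A = 0\<close> all \<open>c m\<close> vanish and so does
      \<open>\<delta>\<close>.\<close>
    have "A * (A\<^sup>2 - \<delta>\<^sup>2) \<le> B * (B\<^sup>2 - \<delta>\<^sup>2)"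
    proof (cases "A = 0")
      case True
      have "\<delta> = 0"
      proof -
        have "c m = 0" for m
          using True sum_nonneg_eq_0_iff[of "{..<N}" "\<lambda>m. real (m + 1) * (c m)\<^sup>2"] c0[of m]
          unfolding A_def by (cases "m < N") auto
        then show ?thesis using \<open>c 0 * c (z + k) - c k * c z = \<delta>\<close> by simp
      qed
      then show ?thesis using True A0 AB by simp
    next
      case False
      then have "0 \<le> A\<^sup>2 - \<delta>\<^sup>2" using S2 A0 by (smt (verit) zero_le_mult_iff zero_le_power2)
      moreover have "A\<^sup>2 \<le> B\<^sup>2" using AB A0 by (rule power_mono)
      ultimately show ?thesis using AB A0 by (intro mult_mono) auto
    qed
    with S2 have "S\<^sup>2 \<le> B * (B\<^sup>2 - \<delta>\<^sup>2)" by simp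
    then have "S \<le> sqrt (B * (B\<^sup>2 - \<delta>\<^sup>2))" by (rule real_le_rsqrt)
    then show ?thesis unfolding S by simp
  qed
  then have "(\<integral>x. abel_mean \<rho> f x ^ 3 / sin x \<partial>angle) \<le> pi / 2 * sqrt (B * (B\<^sup>2 - \<delta>\<^sup>2))"
    by (intro LIMSEQ_le_const2[OF conv]) (auto intro!: exI[of _ "Suc (z + k)"])
  then show ?le unfolding B_def .
qed

text \<open>Fatou's lemma along parameters for which the Abel means converge almost everywhere. The
  bound is continuous in \<open>\<rho>\<close>, so the defect \<open>\<delta>\<close> of the
  undamped coefficients remains in it.\<close>

lemma cube_integral_le:
  fixes z k :: nat
  assumes f0: "\<And>x. 0 < x \<Longrightarrow> x < pi \<Longrightarrow> 0 \<le> f x"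
  defines "\<delta> \<equiv> sine_coeff f 0 * sine_coeff f (z + k) - sine_coeff f k * sine_coeff f z"
  shows "(\<integral>\<^sup>+x. ennreal (f x ^ 3 / sin x) \<partial>angle) \<le> ennreal (pi / 2 * sqrt (w / pi\<^sup>2 * ((w / pi\<^sup>2)\<^sup>2 - \<delta>\<^sup>2)))"
proof -
  obtain \<rho> where \<rho>: "\<And>n. 0 < \<rho> n" "\<And>n. \<rho> n < (1::real)" "\<rho> \<longlonglongrightarrow> 1"
    and lim: "AE x in angle. (\<lambda>n. abel_mean (\<rho> n) f x) \<longlonglongrightarrow> f x"
    by (rule abel_mean_AE_convergent) (rule that)
  let ?B = "w / pi\<^sup>2"
  have [measurable]: "abel_mean (\<rho> n) f \<in> borel_measurable borel" for n
    by (rule borel_measurable_abel_mean[OF f_meas f_sq])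
  have pos: "AE x in angle. 0 \<le> abel_mean r f x" if "0 < r" "r < 1" for r
    using AE_angle
  proof eventually_elim
    case (elim x)
    have "AE b in angle. 0 \<le> f b * (poisson r (x - b) - poisson r (x + b))"
      using AE_angle by eventually_elim (use elim that in \<open>auto intro!: mult_nonneg_nonneg poisson_diff_nonneg f0\<close>)
    then show ?case unfolding abel_mean_def by (rule integral_nonneg_AE)
  qed
  have bd: "(\<integral>\<^sup>+x. ennreal (abel_mean (\<rho> n) f x ^ 3 / sin x) \<partial>angle)
     \<le> ennreal (pi / 2 * sqrt (?B * (?B\<^sup>2 - (\<rho> n ^ (z + k + 2) * \<delta>)\<^sup>2)))" for n
  proof -
    have "AE x in angle. 0 \<le> abel_mean (\<rho> n) f x ^ 3 / sin x"
      using AE_angle pos[OF \<rho>(1)[of n] \<rho>(2)[of n]]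
      by eventually_elim (intro divide_nonneg_nonneg, auto intro: less_imp_le[OF sin_gt_zero])
    then show ?thesis
      using abel_mean_cube_le[OF \<rho>(1,2)] unfolding \<delta>_def
      by (subst nn_integral_eq_integral) (auto intro: ennreal_leI)
  qed
  have "(\<integral>\<^sup>+x. ennreal (f x ^ 3 / sin x) \<partial>angle) = (\<integral>\<^sup>+x. liminf (\<lambda>n. ennreal (abel_mean (\<rho> n) f x ^ 3 / sin x)) \<partial>angle)"
  proof (rule nn_integral_cong_AE, use lim AE_angle in eventually_elim)
    case (elim x)
    then have "0 < sin x" by (auto intro: sin_gt_zero)
    then show ?case
      by (intro lim_imp_Liminf[symmetric] tendsto_ennrealI tendsto_divide tendsto_power elim(1) tendsto_const) auto
  qed
  also have "\<dots> \<le> liminf (\<lambda>n. \<integral>\<^sup>+x. ennreal (abel_mean (\<rho> n) f x ^ 3 / sin x) \<partial>angle)"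
    by (rule nn_integral_liminf) measurable
  also have "\<dots> \<le> liminf (\<lambda>n. ennreal (pi / 2 * sqrt (?B * (?B\<^sup>2 - (\<rho> n ^ (z + k + 2) * \<delta>)\<^sup>2))))"
    by (intro Liminf_mono always_eventually allI bd)
  also have "\<dots> = ennreal (pi / 2 * sqrt (?B * (?B\<^sup>2 - (1 ^ (z + k + 2) * \<delta>)\<^sup>2)))"
    by (intro lim_imp_Liminf tendsto_ennrealI tendsto_intros \<rho>(3)) simp
  finally show ?thesis by simp
qed

end

section \<open>Continuity of translations\<close>

lemma nn_integral_lborel_translate:
  assumes [measurable]: "f \<in> borel_measurable borel"
  shows "(\<integral>\<^sup>+t. f (t + u) \<partial>lborel) = (\<integral>\<^sup>+t. f t \<partial>(lborel :: real measure))"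
  using nn_integral_real_affine[of f 1 u] assms by (simp add: add.commute)

lemma integral_lborel_translate:
  fixes f :: "real \<Rightarrow> 'b :: {banach, second_countable_topology}"
  shows "(\<integral>t. f (t + u) \<partial>lborel) = (\<integral>t. f t \<partial>lborel)"
  using lborel_integral_real_affine[of 1 f u] by (simp add: add.commute)

lemma integrable_lborel_translate:
  fixes f :: "real \<Rightarrow> 'b :: {banach, second_countable_topology}"
  shows "integrable lborel (\<lambda>t. f (t + u)) \<longleftrightarrow> integrable lborel f"
  using lborel_integrable_real_affine_iff[of 1 f u] by (simp add: add.commute)

definition L1_translation_continuous :: "(real \<Rightarrow> real) \<Rightarrow> bool" where
  "L1_translation_continuous f \<longleftrightarrow>
     (\<forall>u. u \<longlonglongrightarrow> 0 \<longrightarrow> (\<lambda>n. \<integral>t. \<bar>f (t + u n) - f t\<bar> \<partial>lborel) \<longlonglongrightarrow> 0)"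

text \<open>The property is closed under approximation in \<open>L\<^sup>1\<close>, because
  translation invariance makes the error of \<open>g\<close> equally large before and after the
  shift.\<close>

lemma L1_translation_continuous_approx:
  assumes f: "integrable lborel f"
    and "\<And>\<epsilon>. 0 < \<epsilon> \<Longrightarrow> \<exists>g. integrable lborel g \<and> L1_translation_continuous g \<and> (\<integral>t. \<bar>f t - g t\<bar> \<partial>lborel) < \<epsilon>"
  shows "L1_translation_continuous f"
  unfolding L1_translation_continuous_def
proof (intro allI impI LIMSEQ_I)
  fix u :: "nat \<Rightarrow> real" and r :: real
  assume u: "u \<longlonglongrightarrow> 0" and r: "0 < r"
  obtain g where g: "integrable lborel g" "L1_translation_continuous g" and fg: "(\<integral>t. \<bar>f t - g t\<bar> \<partial>lborel) < r / 3"
    using assms(2)[of "r / 3"] r by auto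
  have "(\<lambda>n. \<integral>t. \<bar>g (t + u n) - g t\<bar> \<partial>lborel) \<longlonglongrightarrow> 0"
    using g(2) u unfolding L1_translation_continuous_def by blast
  from LIMSEQ_D[OF this, of "r / 3"] r obtain N where
    N: "\<And>n. N \<le> n \<Longrightarrow> norm (\<integral>t. \<bar>g (t + u n) - g t\<bar> \<partial>lborel) < r / 3" by auto
  have "norm ((\<integral>t. \<bar>f (t + u n) - f t\<bar> \<partial>lborel) - 0) < r" if "N \<le> n" for n
  proof -
    note [simp] = f g(1) integrable_lborel_translate
    have [simp]: "integrable lborel (\<lambda>t. f (t + u n) - g (t + u n))"
      using integrable_lborel_translate[of "\<lambda>t. f t - g t" "u n"] by simp
    have "(\<integral>t. \<bar>f (t + u n) - f t\<bar> \<partial>lborel) \<le>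
       (\<integral>t. \<bar>f (t + u n) - g (t + u n)\<bar> + \<bar>g (t + u n) - g t\<bar> + \<bar>f t - g t\<bar> \<partial>lborel)"
      by (intro integral_mono) auto
    also have "\<dots> = (\<integral>t. \<bar>f (t + u n) - g (t + u n)\<bar> \<partial>lborel) + (\<integral>t. \<bar>g (t + u n) - g t\<bar> \<partial>lborel) + (\<integral>t. \<bar>f t - g t\<bar> \<partial>lborel)"
      by simp
    also have "(\<integral>t. \<bar>f (t + u n) - g (t + u n)\<bar> \<partial>lborel) = (\<integral>t. \<bar>f t - g t\<bar> \<partial>lborel)"
      by (rule integral_lborel_translate[of "\<lambda>t. \<bar>f t - g t\<bar>"])
    finally show ?thesis using fg N[OF that] by simp
  qed
  then show "\<exists>N. \<forall>n\<ge>N. norm ((\<integral>t. \<bar>f (t + u n) - f t\<bar> \<partial>lborel) - 0) < r" by blast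
qed

text \<open>A point of an open set stays in it under small shifts, so the product of the indicator
  with its translate converges pointwise. For indicators
  \<open>\<bar>x - y\<bar> = x + y - 2 x y\<close> reduces the claim to this product.\<close>

lemma L1_translation_continuous_open:
  fixes U :: "real set"
  assumes U: "open U" "emeasure lborel U < \<infinity>"
  shows "L1_translation_continuous (indicator U)"
  unfolding L1_translation_continuous_def
proof (intro allI impI)
  fix u :: "nat \<Rightarrow> real" assume u: "u \<longlonglongrightarrow> 0"
  let ?i = "indicator U :: real \<Rightarrow> real"
  have [measurable]: "U \<in> sets borel" using U by simp
  have i: "integrable lborel ?i" using U by simp
  have it: "integrable lborel (\<lambda>t. ?i (t + u n))" for n
    using i by (subst integrable_lborel_translate)
  have ii: "integrable lborel (\<lambda>t. ?i t * ?i (t + u n))" for n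
    by (rule Bochner_Integration.integrable_bound[OF i]) (auto simp: indicator_def)
  have "(\<lambda>n. \<integral>t. ?i t * ?i (t + u n) \<partial>lborel) \<longlonglongrightarrow> (\<integral>t. ?i t \<partial>lborel)"
  proof (rule integral_dominated_convergence[where w = ?i])
    show "AE t in lborel. (\<lambda>n. ?i t * ?i (t + u n)) \<longlonglongrightarrow> ?i t"
    proof (intro AE_I2)
      fix t
      show "(\<lambda>n. ?i t * ?i (t + u n)) \<longlonglongrightarrow> ?i t"
      proof (cases "t \<in> U")
        case True
        have "(\<lambda>n. t + u n) \<longlonglongrightarrow> t + 0" by (intro tendsto_intros u)
        then have "\<forall>\<^sub>F n in sequentially. t + u n \<in> U" using True U(1) by (intro topological_tendstoD) auto
        then show ?thesis using True by (intro tendsto_eventually) (auto elim: eventually_mono)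
      qed simp
    qed
  qed (use i in \<open>auto simp: indicator_def\<close>)
  then have "(\<lambda>n. 2 * (\<integral>t. ?i t \<partial>lborel) - 2 * (\<integral>t. ?i t * ?i (t + u n) \<partial>lborel)) \<longlonglongrightarrow>
     2 * (\<integral>t. ?i t \<partial>lborel) - 2 * (\<integral>t. ?i t \<partial>lborel)"
    by (intro tendsto_intros)
  moreover have "(\<integral>t. \<bar>?i (t + u n) - ?i t\<bar> \<partial>lborel) = 2 * (\<integral>t. ?i t \<partial>lborel) - 2 * (\<integral>t. ?i t * ?i (t + u n) \<partial>lborel)" for n
  proof -
    have "\<bar>?i (t + u n) - ?i t\<bar> = ?i (t + u n) + ?i t - 2 * (?i t * ?i (t + u n))" for t
      by (auto simp: indicator_def)
    then show ?thesis using i it ii integral_lborel_translate[of ?i "u n"] by simp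
  qed
  ultimately show "(\<lambda>n. \<integral>t. \<bar>?i (t + u n) - ?i t\<bar> \<partial>lborel) \<longlonglongrightarrow> 0" by simp
qed

lemma L1_translation_continuous_scale:
  assumes "L1_translation_continuous f"
  shows "L1_translation_continuous (\<lambda>t. f t * c)"
  unfolding L1_translation_continuous_def
proof (intro allI impI)
  fix u :: "nat \<Rightarrow> real" assume "u \<longlonglongrightarrow> 0"
  with assms have "(\<lambda>n. \<integral>t. \<bar>f (t + u n) - f t\<bar> \<partial>lborel) \<longlonglongrightarrow> 0"
    unfolding L1_translation_continuous_def by blast
  then have "(\<lambda>n. (\<integral>t. \<bar>f (t + u n) - f t\<bar> \<partial>lborel) * \<bar>c\<bar>) \<longlonglongrightarrow> 0" by (rule tendsto_mult_left_zero)
  moreover have "\<bar>f (t + u n) * c - f t * c\<bar> = \<bar>f (t + u n) - f t\<bar> * \<bar>c\<bar>" for t n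
    by (simp add: abs_mult flip: left_diff_distrib)
  ultimately show "(\<lambda>n. \<integral>t. \<bar>f (t + u n) * c - f t * c\<bar> \<partial>lborel) \<longlonglongrightarrow> 0" by simp
qed

lemma integrable_L1_translation_continuous:
  fixes f :: "real \<Rightarrow> real"
  assumes "integrable lborel f"
  shows "L1_translation_continuous f"
  using assms
proof (induction rule: integrable_induct)
  case (base A c)
  then have [measurable]: "A \<in> sets borel" by simp
  have "L1_translation_continuous (indicator A)"
  proof (rule L1_translation_continuous_approx)
    show "integrable lborel (indicat_real A)" using base by simp
    \<comment> \<open>Outer regularity replaces the measurable set by an open one.\<close>
    fix \<epsilon> :: real assume \<epsilon>: "0 < \<epsilon>"
    obtain U where U: "open U" "A \<subseteq> U" "emeasure lborel (U - A) < ennreal \<epsilon>"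
      using outer_regular_lborel[of A \<epsilon>] \<epsilon> by auto
    have [measurable]: "U \<in> sets borel" using U by simp
    have "emeasure lborel U = emeasure lborel (U - A) + emeasure lborel A"
      using U(2) by (subst plus_emeasure) (auto simp: Un_absorb2)
    also have "\<dots> < \<infinity>" using U(3) base(2) by (auto simp: ennreal_add_less_top top.not_eq_extremum intro: order.strict_trans)
    finally have fin: "emeasure lborel U < \<infinity>" .
    have "(\<integral>t. \<bar>indicat_real A t - indicator U t\<bar> \<partial>lborel) = (\<integral>t. indicator (U - A) t \<partial>lborel)"
      using U(2) by (intro Bochner_Integration.integral_cong refl) (auto simp: indicator_def)
    also have "\<dots> = measure lborel (U - A)" by simp
    also have "\<dots> < \<epsilon>"
    proof -
      have "emeasure lborel (U - A) = ennreal (measure lborel (U - A))"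
        using U(3) by (intro emeasure_eq_ennreal_measure) auto
      then show ?thesis using U(3) by (simp add: ennreal_less_iff)
    qed
    finally show "\<exists>g. integrable lborel g \<and> L1_translation_continuous g \<and> (\<integral>t. \<bar>indicat_real A t - g t\<bar> \<partial>lborel) < \<epsilon>"
      using U(1) fin by (intro exI[of _ "indicator U"] conjI L1_translation_continuous_open) auto
  qed
  from L1_translation_continuous_scale[OF this, of c] show ?case by simp
next
  case (add f g)
  show ?case
    unfolding L1_translation_continuous_def
  proof (intro allI impI)
    fix u :: "nat \<Rightarrow> real" assume "u \<longlonglongrightarrow> 0"
    with add have "(\<lambda>n. \<integral>t. \<bar>f (t + u n) - f t\<bar> \<partial>lborel) \<longlonglongrightarrow> 0" "(\<lambda>n. \<integral>t. \<bar>g (t + u n) - g t\<bar> \<partial>lborel) \<longlonglongrightarrow> 0"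
      unfolding L1_translation_continuous_def by blast+
    from tendsto_add[OF this]
    have lim: "(\<lambda>n. (\<integral>t. \<bar>f (t + u n) - f t\<bar> \<partial>lborel) + (\<integral>t. \<bar>g (t + u n) - g t\<bar> \<partial>lborel)) \<longlonglongrightarrow> 0" by simp
    show "(\<lambda>n. \<integral>t. \<bar>f (t + u n) + g (t + u n) - (f t + g t)\<bar> \<partial>lborel) \<longlonglongrightarrow> 0"
    proof (rule tendsto_sandwich[OF _ _ tendsto_const lim])
      note [simp] = add.hyps integrable_lborel_translate
      have "(\<integral>t. \<bar>f (t + u n) + g (t + u n) - (f t + g t)\<bar> \<partial>lborel)
         \<le> (\<integral>t. \<bar>f (t + u n) - f t\<bar> + \<bar>g (t + u n) - g t\<bar> \<partial>lborel)" for n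
        by (rule integral_mono) auto
      then show "\<forall>\<^sub>F n in sequentially. (\<integral>t. \<bar>f (t + u n) + g (t + u n) - (f t + g t)\<bar> \<partial>lborel)
         \<le> (\<integral>t. \<bar>f (t + u n) - f t\<bar> \<partial>lborel) + (\<integral>t. \<bar>g (t + u n) - g t\<bar> \<partial>lborel)" by simp
    qed simp
  qed
next
  case (lim f s)
  show ?case
  proof (rule L1_translation_continuous_approx)
    fix \<epsilon> :: real assume \<epsilon>: "0 < \<epsilon>"
    have "(\<lambda>i. \<integral>t. \<bar>f t - s i t\<bar> \<partial>lborel) \<longlonglongrightarrow> (\<integral>t. 0 \<partial>(lborel :: real measure))"
    \<comment> \<open>The approximating functions of the induction rule are bounded by
      \<open>2 * \<bar>f t\<bar>\<close>, which gives the factor three.\<close>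
    proof (rule integral_dominated_convergence[where w = "\<lambda>t. 3 * \<bar>f t\<bar>"])
      show "AE t in lborel. (\<lambda>i. \<bar>f t - s i t\<bar>) \<longlonglongrightarrow> 0"
      proof (intro AE_I2)
        fix t
        have "(\<lambda>i. \<bar>f t - s i t\<bar>) \<longlonglongrightarrow> \<bar>f t - f t\<bar>" by (intro tendsto_intros lim) simp
        then show "(\<lambda>i. \<bar>f t - s i t\<bar>) \<longlonglongrightarrow> 0" by simp
      qed
      show "AE t in lborel. norm \<bar>f t - s i t\<bar> \<le> 3 * \<bar>f t\<bar>" for i
      proof (intro AE_I2)
        fix t show "norm \<bar>f t - s i t\<bar> \<le> 3 * \<bar>f t\<bar>" using lim.hyps(3)[of t i] by simp
      qed
    qed (use lim in auto)
    then have "(\<lambda>i. \<integral>t. \<bar>f t - s i t\<bar> \<partial>lborel) \<longlonglongrightarrow> 0" by simp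
    from LIMSEQ_D[OF this \<epsilon>] obtain i where "norm ((\<integral>t. \<bar>f t - s i t\<bar> \<partial>lborel) - 0) < \<epsilon>" by blast
    then show "\<exists>g. integrable lborel g \<and> L1_translation_continuous g \<and> (\<integral>t. \<bar>f t - g t\<bar> \<partial>lborel) < \<epsilon>"
      using lim by (intro exI[of _ "s i"]) simp
  qed (rule lim)
qed

text \<open>Reduces continuity of translations in \<open>L\<^sup>2\<close> to that in
  \<open>L\<^sup>1\<close> for squares. The inequality
  \<open>(x - y)\<^sup>2 \<le> \<bar>x\<^sup>2 - y\<^sup>2\<bar>\<close> is available for
  nonnegative numbers, hence the splitting into positive and negative parts.\<close>

lemma square_pos_part_diff_le:
  fixes a b :: real
  shows "(a - b)\<^sup>2 \<le> 2 * \<bar>(max a 0)\<^sup>2 - (max b 0)\<^sup>2\<bar> + 2 * \<bar>(max (- a) 0)\<^sup>2 - (max (- b) 0)\<^sup>2\<bar>"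
proof -
  have *: "(x - y)\<^sup>2 \<le> \<bar>x\<^sup>2 - y\<^sup>2\<bar>" if "0 \<le> x" "0 \<le> y" for x y :: real
  proof -
    have "\<bar>x - y\<bar> * \<bar>x - y\<bar> \<le> \<bar>x - y\<bar> * (x + y)" using that by (intro mult_left_mono) auto
    also have "\<dots> = \<bar>(x - y) * (x + y)\<bar>" using that by (simp add: abs_mult)
    also have "(x - y) * (x + y) = x\<^sup>2 - y\<^sup>2" by (simp add: power2_eq_square algebra_simps)
    finally show ?thesis by (simp add: power2_eq_square)
  qed
  have "(a - b)\<^sup>2 = ((max a 0 - max b 0) - (max (- a) 0 - max (- b) 0))\<^sup>2" by (auto simp: max_def)
  also have "\<dots> \<le> 2 * (max a 0 - max b 0)\<^sup>2 + 2 * (max (- a) 0 - max (- b) 0)\<^sup>2"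
    using sum_squares_bound[of "max a 0 - max b 0" "- (max (- a) 0 - max (- b) 0)"]
    by (simp add: power2_diff power2_eq_square algebra_simps)
  also have "\<dots> \<le> 2 * \<bar>(max a 0)\<^sup>2 - (max b 0)\<^sup>2\<bar> + 2 * \<bar>(max (- a) 0)\<^sup>2 - (max (- b) 0)\<^sup>2\<bar>"
    by (intro add_mono mult_left_mono *) auto
  finally show ?thesis .
qed

lemma L2_translation_continuous_real:
  fixes f :: "real \<Rightarrow> real"
  assumes [measurable]: "f \<in> borel_measurable borel" and f: "integrable lborel (\<lambda>t. (f t)\<^sup>2)"
    and u: "u \<longlonglongrightarrow> 0"
  shows "integrable lborel (\<lambda>t. (f (t + s) - f t)\<^sup>2)"
    and "(\<lambda>n. \<integral>t. (f (t + u n) - f t)\<^sup>2 \<partial>lborel) \<longlonglongrightarrow> 0"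
proof -
  define p where "p = (\<lambda>t. (max (f t) 0)\<^sup>2)"
  define q where "q = (\<lambda>t. (max (- f t) 0)\<^sup>2)"
  have p_int: "integrable lborel p"
    unfolding p_def by (rule Bochner_Integration.integrable_bound[OF f]) (auto simp: max_def)
  have q_int: "integrable lborel q"
    unfolding q_def by (rule Bochner_Integration.integrable_bound[OF f]) (auto simp: max_def)
  have pt_int: "integrable lborel (\<lambda>t. p (t + s))" for s using p_int by (subst integrable_lborel_translate)
  have qt_int: "integrable lborel (\<lambda>t. q (t + s))" for s using q_int by (subst integrable_lborel_translate)
  note ints = p_int q_int pt_int qt_int
  let ?d = "\<lambda>s t. 2 * \<bar>p (t + s) - p t\<bar> + 2 * \<bar>q (t + s) - q t\<bar>"
  have le: "(f (t + s) - f t)\<^sup>2 \<le> ?d s t" for t s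
    unfolding p_def q_def by (rule square_pos_part_diff_le)
  have dint: "integrable lborel (?d s)" for s
    by (intro Bochner_Integration.integrable_add integrable_mult_right integrable_abs Bochner_Integration.integrable_diff ints)
  show int: "integrable lborel (\<lambda>t. (f (t + s) - f t)\<^sup>2)" for s
  proof (rule Bochner_Integration.integrable_bound[OF dint[of s]])
    show "AE t in lborel. norm ((f (t + s) - f t)\<^sup>2) \<le> norm (?d s t)"
    proof (rule AE_I2)
      fix t show "norm ((f (t + s) - f t)\<^sup>2) \<le> norm (?d s t)" using le[of t s] by simp
    qed
  qed measurable
  have pl: "(\<lambda>n. \<integral>t. \<bar>p (t + u n) - p t\<bar> \<partial>lborel) \<longlonglongrightarrow> 0" and ql: "(\<lambda>n. \<integral>t. \<bar>q (t + u n) - q t\<bar> \<partial>lborel) \<longlonglongrightarrow> 0"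
    using integrable_L1_translation_continuous[OF p_int] integrable_L1_translation_continuous[OF q_int] u
    unfolding L1_translation_continuous_def by blast+
  show "(\<lambda>n. \<integral>t. (f (t + u n) - f t)\<^sup>2 \<partial>lborel) \<longlonglongrightarrow> 0"
  proof (rule tendsto_sandwich[OF _ _ tendsto_const])
    show "(\<lambda>n. 2 * (\<integral>t. \<bar>p (t + u n) - p t\<bar> \<partial>lborel) + 2 * (\<integral>t. \<bar>q (t + u n) - q t\<bar> \<partial>lborel)) \<longlonglongrightarrow> 0"
      using tendsto_add[OF tendsto_mult_right_zero[OF pl, of 2] tendsto_mult_right_zero[OF ql, of 2]] by simp
    have "(\<integral>t. (f (t + u n) - f t)\<^sup>2 \<partial>lborel) \<le> (\<integral>t. ?d (u n) t \<partial>lborel)" for n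
      by (rule integral_mono[OF int dint le])
    also have "(\<integral>t. ?d (u n) t \<partial>lborel) =
       2 * (\<integral>t. \<bar>p (t + u n) - p t\<bar> \<partial>lborel) + 2 * (\<integral>t. \<bar>q (t + u n) - q t\<bar> \<partial>lborel)" for n
      using ints by (subst Bochner_Integration.integral_add) auto
    finally show "\<forall>\<^sub>F n in sequentially. (\<integral>t. (f (t + u n) - f t)\<^sup>2 \<partial>lborel)
       \<le> 2 * (\<integral>t. \<bar>p (t + u n) - p t\<bar> \<partial>lborel) + 2 * (\<integral>t. \<bar>q (t + u n) - q t\<bar> \<partial>lborel)" by simp
  qed simp
qed

lemma integrable_Re_Im_square:
  fixes f :: "real \<Rightarrow> complex"
  assumes [measurable]: "f \<in> borel_measurable borel" and f: "integrable lborel (\<lambda>t. (norm (f t))\<^sup>2)"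
  shows "integrable lborel (\<lambda>t. (Re (f t))\<^sup>2)" "integrable lborel (\<lambda>t. (Im (f t))\<^sup>2)"
  by (rule Bochner_Integration.integrable_bound[OF f]; simp add: cmod_power2)+

lemma L2_translation_continuous:
  fixes f :: "real \<Rightarrow> complex"
  assumes [measurable]: "f \<in> borel_measurable borel" and f: "integrable lborel (\<lambda>t. (norm (f t))\<^sup>2)"
    and u: "u \<longlonglongrightarrow> 0"
  shows "(\<lambda>n. \<integral>t. (norm (f (t + u n) - f t))\<^sup>2 \<partial>lborel) \<longlonglongrightarrow> 0"
proof -
  note re = L2_translation_continuous_real[of "\<lambda>t. Re (f t)", OF _ integrable_Re_Im_square(1)[OF assms(1,2)] u]
  note im = L2_translation_continuous_real[of "\<lambda>t. Im (f t)", OF _ integrable_Re_Im_square(2)[OF assms(1,2)] u]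
  have "(\<lambda>n. (\<integral>t. (Re (f (t + u n)) - Re (f t))\<^sup>2 \<partial>lborel) + (\<integral>t. (Im (f (t + u n)) - Im (f t))\<^sup>2 \<partial>lborel)) \<longlonglongrightarrow> 0 + 0"
    by (intro tendsto_add re(2) im(2)) measurable
  moreover have "(\<integral>t. (norm (f (t + s) - f t))\<^sup>2 \<partial>lborel) =
      (\<integral>t. (Re (f (t + s)) - Re (f t))\<^sup>2 \<partial>lborel) + (\<integral>t. (Im (f (t + s)) - Im (f t))\<^sup>2 \<partial>lborel)" for s
    unfolding cmod_power2 minus_complex.sel
    by (intro Bochner_Integration.integral_add re(1) im(1)) measurable
  ultimately show ?thesis by simp
qed

section \<open>Plancherel for integrable functions\<close>

definition fourier_L1 :: "(real \<Rightarrow> complex) \<Rightarrow> real \<Rightarrow> complex" where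
  "fourier_L1 f \<tau> = complex_of_real ((2 * pi) powr (- 1 / 2)) *
     (\<integral>t. exp (- (\<i> * of_real \<tau> * of_real t)) * f t \<partial>lborel)"

lemma borel_measurable_cnj [measurable]: "cnj \<in> borel_measurable borel"
  by (intro borel_measurable_continuous_onI continuous_intros)

text \<open>The characteristic function of the standard normal distribution at
  \<open>x / \<sigma>\<close>, after the substitution \<open>v = \<sigma> \<tau>\<close>.\<close>

lemma integral_gaussian_exp:
  assumes \<sigma>: "0 < \<sigma>"
  shows "(\<integral>\<tau>. complex_of_real (exp (- (\<sigma> * \<tau>)\<^sup>2 / 2)) * exp (\<i> * of_real (\<tau> * x)) \<partial>lborel)
    = complex_of_real (2 * pi * normal_density 0 \<sigma> x)"
proof -
  let ?F = "\<lambda>v. std_normal_density v *\<^sub>R iexp (x / \<sigma> * v)"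
  have "complex_of_real (exp (- ((x / \<sigma>)\<^sup>2) / 2)) = char std_normal_distribution (x / \<sigma>)"
    by (simp add: char_std_normal_distribution)
  also have "\<dots> = (\<integral>v. ?F v \<partial>lborel)"
    unfolding char_def by (subst integral_density) auto
  also have "\<dots> = \<sigma> *\<^sub>R (\<integral>\<tau>. ?F (0 + \<sigma> * \<tau>) \<partial>lborel)"
    using lborel_integral_real_affine[of \<sigma> ?F 0] \<sigma> by simp
  also have "(\<lambda>\<tau>. ?F (0 + \<sigma> * \<tau>)) = (\<lambda>\<tau>. complex_of_real (1 / sqrt (2 * pi)) *
      (complex_of_real (exp (- (\<sigma> * \<tau>)\<^sup>2 / 2)) * exp (\<i> * of_real (\<tau> * x))))"
    using \<sigma> by (auto simp: std_normal_density_def scaleR_conv_of_real mult_ac)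
  finally have "complex_of_real (exp (- ((x / \<sigma>)\<^sup>2) / 2)) = complex_of_real (\<sigma> / sqrt (2 * pi)) *
      (\<integral>\<tau>. complex_of_real (exp (- (\<sigma> * \<tau>)\<^sup>2 / 2)) * exp (\<i> * of_real (\<tau> * x)) \<partial>lborel)"
    by (simp add: scaleR_conv_of_real)
  then have "complex_of_real (sqrt (2 * pi) / \<sigma>) * complex_of_real (exp (- ((x / \<sigma>)\<^sup>2) / 2)) =
      (\<integral>\<tau>. complex_of_real (exp (- (\<sigma> * \<tau>)\<^sup>2 / 2)) * exp (\<i> * of_real (\<tau> * x)) \<partial>lborel)"
    using \<sigma> by simp
  moreover have "sqrt (2 * pi) / \<sigma> * exp (- ((x / \<sigma>)\<^sup>2) / 2) = 2 * pi * normal_density 0 \<sigma> x"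
  proof -
    have "sqrt (2 * pi * \<sigma>\<^sup>2) = sqrt (2 * pi) * \<sigma>" using \<sigma> by (simp add: real_sqrt_mult)
    moreover have "sqrt (2 * pi) * sqrt (2 * pi) = 2 * pi" by simp
    ultimately show ?thesis
      using \<sigma> unfolding normal_density_def by (simp add: power_divide field_simps)
  qed
  ultimately show ?thesis by (metis of_real_mult)
qed

lemma integrable_gaussian:
  fixes \<sigma> :: real
  assumes \<sigma>: "0 < \<sigma>"
  shows "integrable lborel (\<lambda>\<tau>. exp (- (\<sigma> * \<tau>)\<^sup>2 / 2))"
proof -
  have "integrable lborel (\<lambda>v. std_normal_density v)" by simp
  then have "integrable lborel (\<lambda>\<tau>. std_normal_density (0 + \<sigma> * \<tau>))"
    using \<sigma> by (subst lborel_integrable_real_affine_iff) auto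
  then have "integrable lborel (\<lambda>\<tau>. sqrt (2 * pi) * std_normal_density (0 + \<sigma> * \<tau>))" by (rule integrable_mult_right)
  then show ?thesis by (simp add: std_normal_density_def)
qed

context
  fixes f :: "real \<Rightarrow> complex"
  assumes f_meas [measurable]: "f \<in> borel_measurable borel"
    and f_int: "integrable lborel f"
    and f_sq: "integrable lborel (\<lambda>t. (norm (f t))\<^sup>2)"
begin

lemma borel_measurable_fourier_L1 [measurable]: "fourier_L1 f \<in> borel_measurable borel"
  unfolding fourier_L1_def[abs_def] by measurable

lemma norm_fourier_L1_le: "norm (fourier_L1 f \<tau>) \<le> (2 * pi) powr (- 1 / 2) * (\<integral>t. norm (f t) \<partial>lborel)"
proof -
  have "norm (\<integral>t. exp (- (\<i> * of_real \<tau> * of_real t)) * f t \<partial>lborel) \<le> (\<integral>t. norm (exp (- (\<i> * of_real \<tau> * of_real t)) * f t) \<partial>lborel)"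
    by (rule integral_norm_bound)
  also have "\<dots> = (\<integral>t. norm (f t) \<partial>lborel)" by (simp add: norm_mult)
  finally show ?thesis unfolding fourier_L1_def by (simp add: norm_mult mult_left_mono)
qed

text \<open>Fourier inversion with a Gaussian cut-off in frequency: Fubini's theorem moves the
  cut-off onto \<open>s - t\<close>, where it becomes a normal density of standard deviation
  \<open>\<sigma>\<close>.\<close>

lemma integral_gaussian_fourier:
  assumes \<sigma>: "0 < \<sigma>"
  shows "complex_of_real ((2 * pi) powr (- 1 / 2)) *
     (\<integral>\<tau>. complex_of_real (exp (- (\<sigma> * \<tau>)\<^sup>2 / 2)) * (exp (\<i> * of_real (\<tau> * s)) * fourier_L1 f \<tau>) \<partial>lborel)
     = (\<integral>u. normal_density 0 \<sigma> u *\<^sub>R f (s + u) \<partial>lborel)"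
proof -
  let ?c = "complex_of_real ((2 * pi) powr (- 1 / 2))"
  let ?g = "\<lambda>\<tau>. complex_of_real (exp (- (\<sigma> * \<tau>)\<^sup>2 / 2))"
  let ?h = "\<lambda>\<tau> t. ?g \<tau> * exp (\<i> * of_real (\<tau> * (s - t))) * f t"
  have cc: "?c * ?c = complex_of_real (1 / (2 * pi))"
    unfolding of_real_mult[symmetric] powr_add[symmetric] by (simp add: powr_minus_divide)
  have int: "integrable (lborel \<Otimes>\<^sub>M lborel) (\<lambda>(\<tau>, t). ?h \<tau> t)"
  proof (rule lborel_pair.Fubini_integrable)
    have n: "norm (?h \<tau> t) = exp (- (\<sigma> * \<tau>)\<^sup>2 / 2) * norm (f t)" for \<tau> t
      by (simp add: norm_mult)
    show "integrable lborel (\<lambda>\<tau>. \<integral>t. norm (case (\<tau>, t) of (\<tau>, t) \<Rightarrow> ?h \<tau> t) \<partial>lborel)"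
      unfolding prod.case n using integrable_gaussian[OF \<sigma>] by simp
    have "integrable lborel (?h \<tau>)" for \<tau>
      by (rule Bochner_Integration.integrable_bound[OF integrable_mult_right[OF integrable_norm[OF f_int], of "exp (- (\<sigma> * \<tau>)\<^sup>2 / 2)"]])
         (measurable, rule AE_I2, simp only: n, simp)
    then show "AE \<tau> in lborel. integrable lborel (\<lambda>t. case (\<tau>, t) of (\<tau>, t) \<Rightarrow> ?h \<tau> t)" by simp
  qed measurable
  have e: "?c * (?g \<tau> * (exp (\<i> * of_real (\<tau> * s)) * fourier_L1 f \<tau>)) = ?c * ?c * (\<integral>t. ?h \<tau> t \<partial>lborel)" for \<tau>
  proof -
    have "?g \<tau> * exp (\<i> * of_real (\<tau> * s)) * (\<integral>t. exp (- (\<i> * of_real \<tau> * of_real t)) * f t \<partial>lborel)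
       = (\<integral>t. ?g \<tau> * exp (\<i> * of_real (\<tau> * s)) * (exp (- (\<i> * of_real \<tau> * of_real t)) * f t) \<partial>lborel)"
      by (rule integral_mult_right_zero[symmetric])
    also have "\<dots> = (\<integral>t. ?h \<tau> t \<partial>lborel)"
    proof (intro Bochner_Integration.integral_cong refl)
      fix t
      have "exp (\<i> * of_real (\<tau> * (s - t))) = exp (\<i> * of_real (\<tau> * s)) * exp (- (\<i> * of_real \<tau> * complex_of_real t))"
        unfolding exp_add[symmetric] by (simp add: algebra_simps)
      then show "?g \<tau> * exp (\<i> * of_real (\<tau> * s)) * (exp (- (\<i> * of_real \<tau> * of_real t)) * f t) = ?h \<tau> t"
        by (simp add: mult_ac)
    qed
    finally have "?g \<tau> * exp (\<i> * of_real (\<tau> * s)) * (\<integral>t. exp (- (\<i> * of_real \<tau> * of_real t)) * f t \<partial>lborel) = (\<integral>t. ?h \<tau> t \<partial>lborel)" .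
    moreover have "?c * (X * (Y * (?c * Z))) = ?c * ?c * (X * Y * Z)" for X Y Z :: complex
      by (simp only: mult_ac)
    ultimately show ?thesis unfolding fourier_L1_def by (simp only:)
  qed
  have "?c * (\<integral>\<tau>. ?g \<tau> * (exp (\<i> * of_real (\<tau> * s)) * fourier_L1 f \<tau>) \<partial>lborel)
     = (\<integral>\<tau>. ?c * ?c * (\<integral>t. ?h \<tau> t \<partial>lborel) \<partial>lborel)"
    unfolding integral_mult_right_zero[symmetric] e by simp
  also have "\<dots> = ?c * ?c * (\<integral>\<tau>. \<integral>t. ?h \<tau> t \<partial>lborel \<partial>lborel)" by (rule integral_mult_right_zero)
  also have "(\<integral>\<tau>. \<integral>t. ?h \<tau> t \<partial>lborel \<partial>lborel) = (\<integral>t. \<integral>\<tau>. ?h \<tau> t \<partial>lborel \<partial>lborel)"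
    by (rule lborel_pair.Fubini_integral[OF int, symmetric])
  also have "\<dots> = (\<integral>t. complex_of_real (2 * pi * normal_density 0 \<sigma> (s - t)) * f t \<partial>lborel)"
    unfolding integral_mult_left_zero by (simp only: integral_gaussian_exp[OF \<sigma>])
  also have "\<dots> = (\<integral>t. complex_of_real (2 * pi) * (normal_density 0 \<sigma> (t - s) *\<^sub>R f t) \<partial>lborel)"
    by (simp add: normal_density_def power2_commute scaleR_conv_of_real mult_ac)
  also have "\<dots> = complex_of_real (2 * pi) * (\<integral>t. normal_density 0 \<sigma> (t - s) *\<^sub>R f t \<partial>lborel)"
    by (rule integral_mult_right_zero)
  also have "(\<integral>t. normal_density 0 \<sigma> (t - s) *\<^sub>R f t \<partial>lborel) = (\<integral>u. normal_density 0 \<sigma> u *\<^sub>R f (s + u) \<partial>lborel)"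
    using integral_lborel_translate[of "\<lambda>t. normal_density 0 \<sigma> (t - s) *\<^sub>R f t" s] by (simp add: add.commute)
  also have "?c * ?c * (complex_of_real (2 * pi) * x) = x" for x
    unfolding cc by simp
  finally show ?thesis .
qed

text \<open>One of the two factors \<open>fourier_L1 f\<close> is written out as an integral, the
  other is resolved by the inversion formula. The cut-off makes the double integral absolutely
  convergent, the transform itself being only bounded.\<close>

lemma integral_gaussian_fourier_square:
  assumes \<sigma>: "0 < \<sigma>"
  shows "integrable lborel (\<lambda>\<tau>. exp (- (\<sigma> * \<tau>)\<^sup>2 / 2) * (norm (fourier_L1 f \<tau>))\<^sup>2)"
    and "complex_of_real (\<integral>\<tau>. exp (- (\<sigma> * \<tau>)\<^sup>2 / 2) * (norm (fourier_L1 f \<tau>))\<^sup>2 \<partial>lborel)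
     = (\<integral>s. f s * cnj (\<integral>u. normal_density 0 \<sigma> u *\<^sub>R f (s + u) \<partial>lborel) \<partial>lborel)"
proof -
  let ?c = "complex_of_real ((2 * pi) powr (- 1 / 2))"
  let ?F = "fourier_L1 f"
  let ?g = "\<lambda>\<tau>. complex_of_real (exp (- (\<sigma> * \<tau>)\<^sup>2 / 2))"
  define K where "K = (2 * pi) powr (- 1 / 2) * (\<integral>t. norm (f t) \<partial>lborel)"
  have FK: "norm (?F \<tau>) \<le> K" for \<tau> unfolding K_def by (rule norm_fourier_L1_le)
  then have K0: "0 \<le> K" using norm_ge_zero order_trans by blast
  show "integrable lborel (\<lambda>\<tau>. exp (- (\<sigma> * \<tau>)\<^sup>2 / 2) * (norm (?F \<tau>))\<^sup>2)"
    by (rule Bochner_Integration.integrable_bound[OF integrable_mult_left[OF integrable_gaussian[OF \<sigma>], of "K\<^sup>2"]])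
       (auto intro!: AE_I2 mult_left_mono power_mono FK)
  let ?h = "\<lambda>\<tau> s. ?g \<tau> * cnj (?F \<tau>) * (exp (- (\<i> * of_real \<tau> * of_real s)) * f s)"
  have int: "integrable (lborel \<Otimes>\<^sub>M lborel) (\<lambda>(\<tau>, s). ?h \<tau> s)"
  proof (rule lborel_pair.Fubini_integrable)
    have n: "norm (?h \<tau> s) = exp (- (\<sigma> * \<tau>)\<^sup>2 / 2) * norm (?F \<tau>) * norm (f s)" for \<tau> s
      by (simp add: norm_mult)
    have gF: "integrable lborel (\<lambda>\<tau>. exp (- (\<sigma> * \<tau>)\<^sup>2 / 2) * norm (?F \<tau>))"
      by (rule Bochner_Integration.integrable_bound[OF integrable_mult_left[OF integrable_gaussian[OF \<sigma>], of K]])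
         (use K0 in \<open>auto intro!: AE_I2 mult_left_mono FK\<close>)
    show "integrable lborel (\<lambda>\<tau>. \<integral>s. norm (case (\<tau>, s) of (\<tau>, s) \<Rightarrow> ?h \<tau> s) \<partial>lborel)"
      unfolding prod.case n using gF by simp
    have "integrable lborel (?h \<tau>)" for \<tau>
      by (rule Bochner_Integration.integrable_bound[OF integrable_mult_right[OF integrable_norm[OF f_int], of "exp (- (\<sigma> * \<tau>)\<^sup>2 / 2) * norm (?F \<tau>)"]])
         (measurable, rule AE_I2, simp only: n, simp)
    then show "AE \<tau> in lborel. integrable lborel (\<lambda>s. case (\<tau>, s) of (\<tau>, s) \<Rightarrow> ?h \<tau> s)" by simp
  qed measurable
  have "complex_of_real (\<integral>\<tau>. exp (- (\<sigma> * \<tau>)\<^sup>2 / 2) * (norm (?F \<tau>))\<^sup>2 \<partial>lborel)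
     = (\<integral>\<tau>. complex_of_real (exp (- (\<sigma> * \<tau>)\<^sup>2 / 2) * (norm (?F \<tau>))\<^sup>2) \<partial>lborel)"
    by (rule integral_complex_of_real[symmetric])
  also have "\<dots> = (\<integral>\<tau>. ?c * (\<integral>s. ?h \<tau> s \<partial>lborel) \<partial>lborel)"
  proof (intro Bochner_Integration.integral_cong refl)
    fix \<tau>
    have "complex_of_real (exp (- (\<sigma> * \<tau>)\<^sup>2 / 2) * (norm (?F \<tau>))\<^sup>2) = ?g \<tau> * cnj (?F \<tau>) * ?F \<tau>"
      by (simp only: of_real_mult complex_norm_square mult_ac)
    also have "?F \<tau> = ?c * (\<integral>s. exp (- (\<i> * of_real \<tau> * of_real s)) * f s \<partial>lborel)"
      by (rule fourier_L1_def)
    finally show "complex_of_real (exp (- (\<sigma> * \<tau>)\<^sup>2 / 2) * (norm (?F \<tau>))\<^sup>2) = ?c * (\<integral>s. ?h \<tau> s \<partial>lborel)"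
      unfolding integral_mult_right_zero by (simp only: mult_ac fourier_L1_def)
  qed
  also have "\<dots> = ?c * (\<integral>\<tau>. \<integral>s. ?h \<tau> s \<partial>lborel \<partial>lborel)" by (rule integral_mult_right_zero)
  also have "(\<integral>\<tau>. \<integral>s. ?h \<tau> s \<partial>lborel \<partial>lborel) = (\<integral>s. \<integral>\<tau>. ?h \<tau> s \<partial>lborel \<partial>lborel)"
    by (rule lborel_pair.Fubini_integral[OF int, symmetric])
  also have "?c * \<dots> = (\<integral>s. ?c * (\<integral>\<tau>. ?h \<tau> s \<partial>lborel) \<partial>lborel)" by (rule integral_mult_right_zero[symmetric])
  also have "\<dots> = (\<integral>s. f s * cnj (\<integral>u. normal_density 0 \<sigma> u *\<^sub>R f (s + u) \<partial>lborel) \<partial>lborel)"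
  proof (intro Bochner_Integration.integral_cong refl)
    fix s
    have "(\<integral>\<tau>. ?h \<tau> s \<partial>lborel) = (\<integral>\<tau>. f s * cnj (?g \<tau> * (exp (\<i> * of_real (\<tau> * s)) * ?F \<tau>)) \<partial>lborel)"
      by (intro Bochner_Integration.integral_cong refl) (simp add: exp_cnj mult_ac)
    then have "(\<integral>\<tau>. ?h \<tau> s \<partial>lborel) = f s * cnj (\<integral>\<tau>. ?g \<tau> * (exp (\<i> * of_real (\<tau> * s)) * ?F \<tau>) \<partial>lborel)"
      by (simp only: integral_mult_right_zero Bochner_Integration.integral_cnj)
    then show "?c * (\<integral>\<tau>. ?h \<tau> s \<partial>lborel) = f s * cnj (\<integral>u. normal_density 0 \<sigma> u *\<^sub>R f (s + u) \<partial>lborel)"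
      unfolding integral_gaussian_fourier[OF \<sigma>, symmetric]
      by (simp only: complex_cnj_mult complex_cnj_complex_of_real mult_ac)
  qed
  finally show "complex_of_real (\<integral>\<tau>. exp (- (\<sigma> * \<tau>)\<^sup>2 / 2) * (norm (?F \<tau>))\<^sup>2 \<partial>lborel)
     = (\<integral>s. f s * cnj (\<integral>u. normal_density 0 \<sigma> u *\<^sub>R f (s + u) \<partial>lborel) \<partial>lborel)" .
qed

text \<open>Polarisation expresses the correlation by the squared difference of \<open>f\<close> and
  its translate, so that Plancherel's identity becomes a consequence of continuity of
  translations.\<close>

lemma autocorrelation:
  shows "integrable lborel (\<lambda>s. f s * cnj (f (s + u)))"
    and "integrable lborel (\<lambda>s. (norm (f (s + u) - f s))\<^sup>2)"
    and "Re (\<integral>s. f s * cnj (f (s + u)) \<partial>lborel) = (\<integral>s. (norm (f s))\<^sup>2 \<partial>lborel) - (\<integral>s. (norm (f (s + u) - f s))\<^sup>2 \<partial>lborel) / 2"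
    and "(\<integral>s. norm (f s * cnj (f (s + u))) \<partial>lborel) \<le> (\<integral>s. (norm (f s))\<^sup>2 \<partial>lborel)"
proof -
  have ft: "integrable lborel (\<lambda>s. (norm (f (s + u)))\<^sup>2)"
    using f_sq by (rule integrable_lborel_translate[of "\<lambda>s. (norm (f s))\<^sup>2", THEN iffD2])
  have n: "norm (f s * cnj (f (s + u))) \<le> ((norm (f s))\<^sup>2 + (norm (f (s + u)))\<^sup>2) / 2" for s
    using sum_squares_bound[of "norm (f s)" "norm (f (s + u))"] by (simp add: norm_mult)
  show int: "integrable lborel (\<lambda>s. f s * cnj (f (s + u)))"
    by (rule Bochner_Integration.integrable_bound[OF integrable_divide[OF Bochner_Integration.integrable_add[OF f_sq ft], of 2]])
       (measurable, rule AE_I2, rule order_trans[OF n], simp)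
  have Re: "2 * Re (a * cnj b) = (norm a)\<^sup>2 + (norm b)\<^sup>2 - (norm (b - a))\<^sup>2" for a b
    unfolding cmod_power2 by (simp add: power2_eq_square algebra_simps)
  have d: "(norm (f (s + u) - f s))\<^sup>2 = (norm (f s))\<^sup>2 + (norm (f (s + u)))\<^sup>2 - 2 * Re (f s * cnj (f (s + u)))" for s
    using Re[of "f s" "f (s + u)"] by simp
  show dint: "integrable lborel (\<lambda>s. (norm (f (s + u) - f s))\<^sup>2)"
    unfolding d using f_sq ft int by (intro Bochner_Integration.integrable_diff Bochner_Integration.integrable_add integrable_mult_right integrable_Re)
  have "(\<integral>s. (norm (f (s + u) - f s))\<^sup>2 \<partial>lborel) = (\<integral>s. (norm (f s))\<^sup>2 \<partial>lborel) + (\<integral>s. (norm (f (s + u)))\<^sup>2 \<partial>lborel) - 2 * Re (\<integral>s. f s * cnj (f (s + u)) \<partial>lborel)"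
  proof -
    define r where "r = (\<lambda>s. Re (f s * cnj (f (s + u))))"
    have r: "integrable lborel r" "integral\<^sup>L lborel r = Re (\<integral>s. f s * cnj (f (s + u)) \<partial>lborel)"
      unfolding r_def using int by (auto simp only: integrable_Re integral_Re)
    have "(\<integral>s. (norm (f (s + u) - f s))\<^sup>2 \<partial>lborel) = (\<integral>s. (norm (f s))\<^sup>2 + (norm (f (s + u)))\<^sup>2 - 2 * r s \<partial>lborel)"
      unfolding d r_def ..
    also have "\<dots> = (\<integral>s. (norm (f s))\<^sup>2 \<partial>lborel) + (\<integral>s. (norm (f (s + u)))\<^sup>2 \<partial>lborel) - 2 * integral\<^sup>L lborel r"
      using f_sq ft r(1) by simp
    finally show ?thesis unfolding r(2) .
  qed
  moreover have t: "(\<integral>s. (norm (f (s + u)))\<^sup>2 \<partial>lborel) = (\<integral>s. (norm (f s))\<^sup>2 \<partial>lborel)"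
    by (rule integral_lborel_translate[of "\<lambda>s. (norm (f s))\<^sup>2"])
  ultimately show "Re (\<integral>s. f s * cnj (f (s + u)) \<partial>lborel) = (\<integral>s. (norm (f s))\<^sup>2 \<partial>lborel) - (\<integral>s. (norm (f (s + u) - f s))\<^sup>2 \<partial>lborel) / 2"
    by linarith
  have "(\<integral>s. norm (f s * cnj (f (s + u))) \<partial>lborel) \<le> (\<integral>s. ((norm (f s))\<^sup>2 + (norm (f (s + u)))\<^sup>2) / 2 \<partial>lborel)"
    using int f_sq ft n by (intro integral_mono integrable_norm integrable_divide Bochner_Integration.integrable_add)
  also have "\<dots> = (\<integral>s. (norm (f s))\<^sup>2 \<partial>lborel)" using f_sq ft t by simp
  finally show "(\<integral>s. norm (f s * cnj (f (s + u))) \<partial>lborel) \<le> (\<integral>s. (norm (f s))\<^sup>2 \<partial>lborel)" .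
qed

text \<open>Averaging the autocorrelation over \<open>u\<close> with the normal density; only its
  real part matters, since the left-hand side is real.\<close>

lemma integral_gaussian_fourier_square_eq:
  assumes \<sigma>: "0 < \<sigma>"
  shows "(\<integral>\<tau>. exp (- (\<sigma> * \<tau>)\<^sup>2 / 2) * (norm (fourier_L1 f \<tau>))\<^sup>2 \<partial>lborel)
     = (\<integral>s. (norm (f s))\<^sup>2 \<partial>lborel) - (\<integral>u. normal_density 0 \<sigma> u * (\<integral>s. (norm (f (s + u) - f s))\<^sup>2 \<partial>lborel) \<partial>lborel) / 2"
proof -
  let ?N = "\<integral>s. (norm (f s))\<^sup>2 \<partial>lborel"
  let ?A = "\<lambda>u. \<integral>s. f s * cnj (f (s + u)) \<partial>lborel"
  let ?h = "\<lambda>u s. normal_density 0 \<sigma> u *\<^sub>R (f s * cnj (f (s + u)))"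
  have nd: "integrable lborel (normal_density 0 \<sigma>)" "(\<integral>u. normal_density 0 \<sigma> u \<partial>lborel) = 1" using \<sigma> by auto
  have int: "integrable (lborel \<Otimes>\<^sub>M lborel) (\<lambda>(u, s). ?h u s)"
  proof (rule lborel_pair.Fubini_integrable)
    have n: "(\<integral>s. norm (?h u s) \<partial>lborel) = normal_density 0 \<sigma> u * (\<integral>s. norm (f s * cnj (f (s + u))) \<partial>lborel)" for u
      by (simp del: norm_mult)
    show "integrable lborel (\<lambda>u. \<integral>s. norm (case (u, s) of (u, s) \<Rightarrow> ?h u s) \<partial>lborel)"
      unfolding prod.case n
      by (rule Bochner_Integration.integrable_bound[OF integrable_mult_left[OF nd(1), of ?N]])
         (auto intro!: AE_I2 mult_left_mono autocorrelation(4) simp del: norm_mult simp: abs_mult abs_of_nonneg[OF Bochner_Integration.integral_nonneg])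
    show "AE u in lborel. integrable lborel (\<lambda>s. case (u, s) of (u, s) \<Rightarrow> ?h u s)"
      using autocorrelation(1) by simp
  qed measurable
  have "(\<integral>s. f s * cnj (\<integral>u. normal_density 0 \<sigma> u *\<^sub>R f (s + u) \<partial>lborel) \<partial>lborel) = (\<integral>s. \<integral>u. ?h u s \<partial>lborel \<partial>lborel)"
  proof (intro Bochner_Integration.integral_cong refl)
    fix s
    have "f s * cnj (\<integral>u. normal_density 0 \<sigma> u *\<^sub>R f (s + u) \<partial>lborel) = (\<integral>u. f s * cnj (normal_density 0 \<sigma> u *\<^sub>R f (s + u)) \<partial>lborel)"
      by (simp only: Bochner_Integration.integral_cnj integral_mult_right_zero)
    then show "f s * cnj (\<integral>u. normal_density 0 \<sigma> u *\<^sub>R f (s + u) \<partial>lborel) = (\<integral>u. ?h u s \<partial>lborel)"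
      by (simp add: scaleR_conv_of_real mult_ac)
  qed
  also have "\<dots> = (\<integral>u. \<integral>s. ?h u s \<partial>lborel \<partial>lborel)" by (rule lborel_pair.Fubini_integral[OF int])
  also have "\<dots> = (\<integral>u. normal_density 0 \<sigma> u *\<^sub>R ?A u \<partial>lborel)" by simp
  finally have eq: "complex_of_real (\<integral>\<tau>. exp (- (\<sigma> * \<tau>)\<^sup>2 / 2) * (norm (fourier_L1 f \<tau>))\<^sup>2 \<partial>lborel)
     = (\<integral>u. normal_density 0 \<sigma> u *\<^sub>R ?A u \<partial>lborel)"
    using integral_gaussian_fourier_square(2)[OF \<sigma>] by simp
  have Aint: "integrable lborel (\<lambda>u. normal_density 0 \<sigma> u *\<^sub>R ?A u)"
    using lborel_pair.integrable_fst[OF int] by simp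
  have "(\<integral>\<tau>. exp (- (\<sigma> * \<tau>)\<^sup>2 / 2) * (norm (fourier_L1 f \<tau>))\<^sup>2 \<partial>lborel) = Re (\<integral>u. normal_density 0 \<sigma> u *\<^sub>R ?A u \<partial>lborel)"
    unfolding eq[symmetric] by simp
  also have "\<dots> = (\<integral>u. normal_density 0 \<sigma> u * Re (?A u) \<partial>lborel)"
    unfolding integral_Re[OF Aint, symmetric] by simp
  also have "\<dots> = (\<integral>u. normal_density 0 \<sigma> u * ?N - normal_density 0 \<sigma> u * (\<integral>s. (norm (f (s + u) - f s))\<^sup>2 \<partial>lborel) / 2 \<partial>lborel)"
    unfolding autocorrelation(3) by (simp add: right_diff_distrib)
  also have "\<dots> = (\<integral>u. normal_density 0 \<sigma> u * ?N \<partial>lborel) - (\<integral>u. normal_density 0 \<sigma> u * (\<integral>s. (norm (f (s + u) - f s))\<^sup>2 \<partial>lborel) / 2 \<partial>lborel)"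
  proof (rule Bochner_Integration.integral_diff)
    show i1: "integrable lborel (\<lambda>u. normal_density 0 \<sigma> u * ?N)" using nd(1) by (rule integrable_mult_left)
    have "integrable lborel (\<lambda>u. normal_density 0 \<sigma> u * ?N - Re (normal_density 0 \<sigma> u *\<^sub>R ?A u))"
      by (intro Bochner_Integration.integrable_diff i1 integrable_Re Aint)
    then show "integrable lborel (\<lambda>u. normal_density 0 \<sigma> u * (\<integral>s. (norm (f (s + u) - f s))\<^sup>2 \<partial>lborel) / 2)"
      by (simp add: autocorrelation(3) right_diff_distrib)
  qed
  also have "\<dots> = ?N - (\<integral>u. normal_density 0 \<sigma> u * (\<integral>s. (norm (f (s + u) - f s))\<^sup>2 \<partial>lborel) \<partial>lborel) / 2"
    using nd by simp
  finally show ?thesis .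
qed

text \<open>As \<open>\<sigma>\<close> tends to zero, the Gaussian average of
  \<open>\<omega> u\<close>, the squared distance of \<open>f\<close> to its translate, vanishes.
  The cut-off on the frequency side is removed by Fatou's lemma in one direction and by
  \<open>exp (- y) \<le> 1\<close> for \<open>y \<ge> 0\<close> in the other.\<close>

theorem plancherel_L1:
  "(\<integral>\<^sup>+\<tau>. ennreal ((norm (fourier_L1 f \<tau>))\<^sup>2) \<partial>lborel) = (\<integral>\<^sup>+t. ennreal ((norm (f t))\<^sup>2) \<partial>lborel)"
proof -
  let ?N = "\<integral>s. (norm (f s))\<^sup>2 \<partial>lborel"
  define \<omega> where "\<omega> = (\<lambda>u. \<integral>s. (norm (f (s + u) - f s))\<^sup>2 \<partial>lborel)"
  define \<sigma> where "\<sigma> = (\<lambda>n. 1 / real (Suc n))"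
  have \<sigma>: "0 < \<sigma> n" for n by (simp add: \<sigma>_def)
  have \<sigma>0: "\<sigma> \<longlonglongrightarrow> 0" unfolding \<sigma>_def by (rule LIMSEQ_inverse_real_of_nat[unfolded inverse_eq_divide])
  let ?g = "\<lambda>n \<tau>. exp (- (\<sigma> n * \<tau>)\<^sup>2 / 2) * (norm (fourier_L1 f \<tau>))\<^sup>2"
  have [measurable]: "\<omega> \<in> borel_measurable borel" unfolding \<omega>_def by measurable
  have \<omega>: "0 \<le> \<omega> u" "\<omega> u \<le> 4 * ?N" for u
  proof -
    show "0 \<le> \<omega> u" unfolding \<omega>_def by simp
    have "- (\<integral>s. norm (f s * cnj (f (s + u))) \<partial>lborel) \<le> Re (\<integral>s. f s * cnj (f (s + u)) \<partial>lborel)"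
      using abs_Re_le_cmod[of "\<integral>s. f s * cnj (f (s + u)) \<partial>lborel"] integral_norm_bound[of lborel "\<lambda>s. f s * cnj (f (s + u))"]
      by linarith
    then show "\<omega> u \<le> 4 * ?N" using autocorrelation(3,4)[of u] unfolding \<omega>_def by linarith
  qed
  \<comment> \<open>The substitution \<open>u = \<sigma> v\<close> replaces the shrinking density by
    a fixed one, so that dominated convergence applies.\<close>
  have J: "(\<integral>u. normal_density 0 (\<sigma> n) u * \<omega> u \<partial>lborel) = (\<integral>v. std_normal_density v * \<omega> (\<sigma> n * v) \<partial>lborel)" for n
  proof -
    have "normal_density 0 (\<sigma> n) (\<sigma> n * v) = std_normal_density v / \<sigma> n" for v
      using \<sigma>[of n] by (simp add: normal_density_def real_sqrt_mult power_mult_distrib)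
    note nd = this
    have "(\<integral>u. normal_density 0 (\<sigma> n) u * \<omega> u \<partial>lborel) = \<sigma> n * (\<integral>v. normal_density 0 (\<sigma> n) (\<sigma> n * v) * \<omega> (\<sigma> n * v) \<partial>lborel)"
      using lborel_integral_real_affine[of "\<sigma> n" "\<lambda>u. normal_density 0 (\<sigma> n) u * \<omega> u" 0] \<sigma>[of n] by simp
    also have "\<dots> = (\<integral>v. \<sigma> n * (normal_density 0 (\<sigma> n) (\<sigma> n * v) * \<omega> (\<sigma> n * v)) \<partial>lborel)"
      by (rule integral_mult_right_zero[symmetric])
    also have "\<dots> = (\<integral>v. std_normal_density v * \<omega> (\<sigma> n * v) \<partial>lborel)"
      unfolding nd using \<sigma>[of n] by simp
    finally show ?thesis .
  qed
  have "(\<lambda>n. \<integral>v. std_normal_density v * \<omega> (\<sigma> n * v) \<partial>lborel) \<longlonglongrightarrow> (\<integral>v. std_normal_density v * 0 \<partial>lborel)"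
  proof (rule integral_dominated_convergence[where w = "\<lambda>v. std_normal_density v * (4 * ?N)"])
    show "AE v in lborel. (\<lambda>n. std_normal_density v * \<omega> (\<sigma> n * v)) \<longlonglongrightarrow> std_normal_density v * 0"
    proof (rule AE_I2)
      fix v
      have "(\<lambda>n. \<sigma> n * v) \<longlonglongrightarrow> 0" using \<sigma>0 by (rule tendsto_mult_left_zero)
      then show "(\<lambda>n. std_normal_density v * \<omega> (\<sigma> n * v)) \<longlonglongrightarrow> std_normal_density v * 0"
        unfolding \<omega>_def by (intro tendsto_mult tendsto_const L2_translation_continuous f_meas f_sq)
    qed
    show "AE v in lborel. norm (std_normal_density v * \<omega> (\<sigma> n * v)) \<le> std_normal_density v * (4 * ?N)" for n
      using \<omega> by (intro AE_I2) (simp add: abs_mult mult_left_mono)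
  qed (auto intro!: integrable_mult_left)
  then have J0: "(\<lambda>n. \<integral>u. normal_density 0 (\<sigma> n) u * \<omega> u \<partial>lborel) \<longlonglongrightarrow> 0" by (simp add: J)
  have "(\<lambda>n. ?N - (\<integral>u. normal_density 0 (\<sigma> n) u * \<omega> u \<partial>lborel) / 2) \<longlonglongrightarrow> ?N - 0 / 2"
    by (intro tendsto_intros J0) simp
  then have lim: "(\<lambda>n. integral\<^sup>L lborel (?g n)) \<longlonglongrightarrow> ?N"
    unfolding integral_gaussian_fourier_square_eq[OF \<sigma>] \<omega>_def by simp
  have gi: "(\<integral>\<^sup>+\<tau>. ennreal (?g n \<tau>) \<partial>lborel) = ennreal (integral\<^sup>L lborel (?g n))" for n
    by (intro nn_integral_eq_integral integral_gaussian_fourier_square(1) \<sigma>) simp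
  have conv: "(\<lambda>n. ennreal (integral\<^sup>L lborel (?g n))) \<longlonglongrightarrow> ennreal ?N" by (intro tendsto_ennrealI lim)
  have Nn: "(\<integral>\<^sup>+t. ennreal ((norm (f t))\<^sup>2) \<partial>lborel) = ennreal ?N" by (rule nn_integral_eq_integral[OF f_sq]) simp
  show ?thesis unfolding Nn
  proof (rule antisym)
    have g1: "(\<lambda>n. ?g n \<tau>) \<longlonglongrightarrow> (norm (fourier_L1 f \<tau>))\<^sup>2" for \<tau>
    proof -
      have "(\<lambda>n. exp (- (\<sigma> n * \<tau>)\<^sup>2 / 2) * (norm (fourier_L1 f \<tau>))\<^sup>2) \<longlonglongrightarrow> exp (- (0 * \<tau>)\<^sup>2 / 2) * (norm (fourier_L1 f \<tau>))\<^sup>2"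
        by (intro tendsto_intros \<sigma>0) simp
      then show ?thesis by simp
    qed
    have "(\<integral>\<^sup>+\<tau>. ennreal ((norm (fourier_L1 f \<tau>))\<^sup>2) \<partial>lborel) = (\<integral>\<^sup>+\<tau>. liminf (\<lambda>n. ennreal (?g n \<tau>)) \<partial>lborel)"
      by (intro nn_integral_cong lim_imp_Liminf[symmetric] tendsto_ennrealI g1) simp
    also have "\<dots> \<le> liminf (\<lambda>n. \<integral>\<^sup>+\<tau>. ennreal (?g n \<tau>) \<partial>lborel)" by (rule nn_integral_liminf) measurable
    also have "\<dots> = ennreal ?N" unfolding gi by (intro lim_imp_Liminf conv) simp
    finally show "(\<integral>\<^sup>+\<tau>. ennreal ((norm (fourier_L1 f \<tau>))\<^sup>2) \<partial>lborel) \<le> ennreal ?N" .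
    have "ennreal (integral\<^sup>L lborel (?g n)) \<le> (\<integral>\<^sup>+\<tau>. ennreal ((norm (fourier_L1 f \<tau>))\<^sup>2) \<partial>lborel)" for n
      unfolding gi[symmetric] by (intro nn_integral_mono ennreal_leI mult_left_le_one_le) auto
    then show "ennreal ?N \<le> (\<integral>\<^sup>+\<tau>. ennreal ((norm (fourier_L1 f \<tau>))\<^sup>2) \<partial>lborel)"
      by (intro LIMSEQ_le_const2[OF conv]) auto
  qed
qed

end

section \<open>The Fourier transform on the space of square-integrable functions\<close>

lemma norm_diff_square_le:
  fixes a b :: "'a :: real_normed_vector"
  shows "(norm (a - b))\<^sup>2 \<le> 2 * (norm a)\<^sup>2 + 2 * (norm b)\<^sup>2"
proof -
  have "(norm (a - b))\<^sup>2 \<le> (norm a + norm b)\<^sup>2" by (intro power_mono norm_triangle_ineq4) simp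
  also have "\<dots> \<le> 2 * (norm a)\<^sup>2 + 2 * (norm b)\<^sup>2"
    using sum_squares_bound[of "norm a" "norm b"] by (simp add: power2_sum)
  finally show ?thesis .
qed

text \<open>The free parameter \<open>\<delta>\<close> in \<open>bound\<close> plays the role of the
  triangle inequality: the part of the error proportional to the fixed norm is made small by
  \<open>\<delta>\<close>, and the rest then tends to zero for that \<open>\<delta>\<close>.\<close>

lemma L2_norm_tendsto:
  fixes h :: "'a \<Rightarrow> complex" and hn :: "nat \<Rightarrow> 'a \<Rightarrow> complex"
  assumes [measurable]: "h \<in> borel_measurable M" "\<And>n. hn n \<in> borel_measurable M"
    and h: "integrable M (\<lambda>x. (norm (h x))\<^sup>2)"
    and hn: "\<And>n. integrable M (\<lambda>x. (norm (hn n x - h x))\<^sup>2)"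
    and lim: "(\<lambda>n. \<integral>x. (norm (hn n x - h x))\<^sup>2 \<partial>M) \<longlonglongrightarrow> 0"
  shows "\<And>n. integrable M (\<lambda>x. (norm (hn n x))\<^sup>2)"
    and "(\<lambda>n. \<integral>x. (norm (hn n x))\<^sup>2 \<partial>M) \<longlonglongrightarrow> (\<integral>x. (norm (h x))\<^sup>2 \<partial>M)"
proof -
  have bound: "\<bar>(norm a)\<^sup>2 - (norm b)\<^sup>2\<bar> \<le> \<delta> * (norm b)\<^sup>2 + (1 + 1 / \<delta>) * (norm (a - b))\<^sup>2"
    if \<delta>: "0 < \<delta>" for a b :: complex and \<delta> :: real
  proof -
    define c where "c = norm (a - b)"
    have 1: "\<bar>norm a - norm b\<bar> \<le> c" unfolding c_def by (rule norm_triangle_ineq3)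
    have "norm a + norm b \<le> 2 * norm b + c" using 1 by linarith
    have "\<bar>(norm a)\<^sup>2 - (norm b)\<^sup>2\<bar> = \<bar>norm a - norm b\<bar> * (norm a + norm b)"
      by (simp add: power2_eq_square square_diff_square_factored abs_mult mult.commute)
    also have "\<dots> \<le> c * (2 * norm b + c)"
      using 1 \<open>norm a + norm b \<le> _\<close> by (intro mult_mono) (auto simp: c_def)
    also have "\<dots> = 2 * (c / sqrt \<delta>) * (sqrt \<delta> * norm b) + c\<^sup>2"
      using \<delta> by (simp add: power2_eq_square algebra_simps)
    also have "\<dots> \<le> (c / sqrt \<delta>)\<^sup>2 + (sqrt \<delta> * norm b)\<^sup>2 + c\<^sup>2"
      by (intro add_right_mono sum_squares_bound)
    also have "\<dots> = \<delta> * (norm b)\<^sup>2 + (1 + 1 / \<delta>) * c\<^sup>2"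
      using \<delta> by (simp add: power_mult_distrib power_divide algebra_simps)
    finally show ?thesis unfolding c_def .
  qed
  show int: "integrable M (\<lambda>x. (norm (hn n x))\<^sup>2)" for n
  proof (rule Bochner_Integration.integrable_bound)
    show "integrable M (\<lambda>x. 2 * (norm (h x))\<^sup>2 + 2 * (norm (hn n x - h x))\<^sup>2)"
      using h hn by simp
    show "AE x in M. norm ((norm (hn n x))\<^sup>2) \<le> norm (2 * (norm (h x))\<^sup>2 + 2 * (norm (hn n x - h x))\<^sup>2)"
    proof (rule AE_I2)
      fix x show "norm ((norm (hn n x))\<^sup>2) \<le> norm (2 * (norm (h x))\<^sup>2 + 2 * (norm (hn n x - h x))\<^sup>2)"
        using bound[of 1 "hn n x" "h x"] by (simp add: abs_le_iff)
    qed
  qed measurable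
  define N where "N = (\<integral>x. (norm (h x))\<^sup>2 \<partial>M)"
  have N0: "0 \<le> N" unfolding N_def by simp
  define e where "e = (\<lambda>n. \<integral>x. (norm (hn n x - h x))\<^sup>2 \<partial>M)"
  have diff: "\<bar>(\<integral>x. (norm (hn n x))\<^sup>2 \<partial>M) - N\<bar> \<le> \<delta> * N + (1 + 1 / \<delta>) * e n" if "0 < \<delta>" for n \<delta>
  proof -
    have "\<bar>(\<integral>x. (norm (hn n x))\<^sup>2 \<partial>M) - N\<bar> = \<bar>\<integral>x. (norm (hn n x))\<^sup>2 - (norm (h x))\<^sup>2 \<partial>M\<bar>"
      unfolding N_def using int h by simp
    also have "\<dots> \<le> (\<integral>x. \<bar>(norm (hn n x))\<^sup>2 - (norm (h x))\<^sup>2\<bar> \<partial>M)" by (rule integral_abs_bound)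
    also have "\<dots> \<le> (\<integral>x. \<delta> * (norm (h x))\<^sup>2 + (1 + 1 / \<delta>) * (norm (hn n x - h x))\<^sup>2 \<partial>M)"
      using int h hn bound[OF that]
      by (intro integral_mono integrable_abs Bochner_Integration.integrable_diff Bochner_Integration.integrable_add integrable_mult_right)
    also have "\<dots> = \<delta> * N + (1 + 1 / \<delta>) * e n" unfolding N_def e_def using h hn by simp
    finally show ?thesis .
  qed
  show "(\<lambda>n. \<integral>x. (norm (hn n x))\<^sup>2 \<partial>M) \<longlonglongrightarrow> (\<integral>x. (norm (h x))\<^sup>2 \<partial>M)"
    unfolding N_def[symmetric]
  proof (rule LIMSEQ_I)
    fix r :: real assume r: "0 < r"
    define \<delta> where "\<delta> = r / (2 * (N + 1))"
    have \<delta>: "0 < \<delta>" using r N0 by (simp add: \<delta>_def)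
    have "\<delta> * N \<le> \<delta> * (N + 1)" using \<delta> by simp
    also have "\<dots> = r / 2" using N0 by (simp add: \<delta>_def field_simps)
    finally have dN: "\<delta> * N \<le> r / 2" .
    have "(\<lambda>n. (1 + 1 / \<delta>) * e n) \<longlonglongrightarrow> 0" unfolding e_def by (rule tendsto_mult_right_zero[OF lim])
    from LIMSEQ_D[OF this, of "r / 2"] r obtain n0 where n0: "\<And>n. n0 \<le> n \<Longrightarrow> norm ((1 + 1 / \<delta>) * e n - 0) < r / 2" by auto
    have "norm ((\<integral>x. (norm (hn n x))\<^sup>2 \<partial>M) - N) < r" if "n0 \<le> n" for n
      using diff[OF \<delta>, of n] dN n0[OF that] by (simp only: real_norm_def)
    then show "\<exists>n0. \<forall>n\<ge>n0. norm ((\<integral>x. (norm (hn n x))\<^sup>2 \<partial>M) - N) < r" by blast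
  qed
qed

definition truncation :: "real \<Rightarrow> (real \<Rightarrow> complex) \<Rightarrow> real \<Rightarrow> complex" where
  "truncation R f t = (if \<bar>t\<bar> \<le> R then f t else 0)"

lemma truncated_fourier_eq:
  assumes [measurable]: "f \<in> borel_measurable borel"
  shows "truncated_fourier R f = fourier_L1 (truncation R f)"
proof (rule ext)
  fix \<tau>
  have "(LINT t:{-R..R}|lebesgue. exp (- (\<i> * of_real \<tau> * of_real t)) * f t)
     = (\<integral>t. indicator {-R..R} t *\<^sub>R (exp (- (\<i> * of_real \<tau> * of_real t)) * f t) \<partial>lborel)"
    unfolding set_lebesgue_integral_def by (rule integral_completion) measurable
  also have "\<dots> = (\<integral>t. exp (- (\<i> * of_real \<tau> * of_real t)) * truncation R f t \<partial>lborel)"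
    by (intro Bochner_Integration.integral_cong refl) (auto simp: truncation_def indicator_def)
  finally show "truncated_fourier R f \<tau> = fourier_L1 (truncation R f) \<tau>"
    unfolding truncated_fourier_def fourier_L1_def by simp
qed

lemma fourier_L1_diff:
  assumes "integrable lborel f" "integrable lborel g"
  shows "fourier_L1 (\<lambda>t. f t - g t) \<tau> = fourier_L1 f \<tau> - fourier_L1 g \<tau>"
proof -
  have *: "integrable lborel (\<lambda>t. exp (- (\<i> * of_real \<tau> * of_real t)) * h t)" if "integrable lborel h" for h :: "real \<Rightarrow> complex"
    by (rule Bochner_Integration.integrable_bound[OF that]) (use that in \<open>auto simp: norm_mult\<close>)
  show ?thesis
    unfolding fourier_L1_def right_diff_distrib
    by (subst Bochner_Integration.integral_diff[OF *[OF assms(1)] *[OF assms(2)]]) (simp add: right_diff_distrib)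
qed

lemma fourier_L1_translate: "fourier_L1 (\<lambda>t. f (t + s)) \<tau> = exp (\<i> * of_real (\<tau> * s)) * fourier_L1 f \<tau>"
proof -
  have "(\<integral>t. exp (- (\<i> * of_real \<tau> * of_real t)) * f (t + s) \<partial>lborel)
     = (\<integral>t. exp (- (\<i> * of_real \<tau> * of_real (t - s))) * f t \<partial>lborel)"
    using integral_lborel_translate[of "\<lambda>t. exp (- (\<i> * of_real \<tau> * of_real (t - s))) * f t" s] by simp
  also have "\<dots> = (\<integral>t. exp (\<i> * of_real (\<tau> * s)) * (exp (- (\<i> * of_real \<tau> * of_real t)) * f t) \<partial>lborel)"
  proof (intro Bochner_Integration.integral_cong refl)
    fix t
    have "exp (- (\<i> * of_real \<tau> * of_real (t - s))) = exp (\<i> * of_real (\<tau> * s)) * exp (- (\<i> * of_real \<tau> * complex_of_real t))"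
      unfolding exp_add[symmetric] by (simp add: algebra_simps)
    then show "exp (- (\<i> * of_real \<tau> * of_real (t - s))) * f t = exp (\<i> * of_real (\<tau> * s)) * (exp (- (\<i> * of_real \<tau> * of_real t)) * f t)"
      by simp
  qed
  also have "\<dots> = exp (\<i> * of_real (\<tau> * s)) * (\<integral>t. exp (- (\<i> * of_real \<tau> * of_real t)) * f t \<partial>lborel)"
    by (rule integral_mult_right_zero)
  finally show ?thesis unfolding fourier_L1_def by (simp add: mult_ac)
qed

context
  fixes f :: "real \<Rightarrow> complex"
  assumes f_meas [measurable]: "f \<in> borel_measurable borel"
    and f_sq: "integrable lborel (\<lambda>t. (norm (f t))\<^sup>2)"
begin

lemma truncation_measurable [measurable]: "truncation R f \<in> borel_measurable borel"
  unfolding truncation_def[abs_def] by measurable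

lemma truncation_integrable: "integrable lborel (truncation R f)" "integrable lborel (\<lambda>t. (norm (truncation R f t))\<^sup>2)"
proof -
  have i: "integrable lborel (\<lambda>t. indicator {-R..R} t + (norm (f t))\<^sup>2)"
    using f_sq by (intro Bochner_Integration.integrable_add) (auto simp: emeasure_lborel_Icc_eq)
  have "x \<le> 1 + x\<^sup>2" for x :: real
    using zero_le_power2[of "x - 1 / 2"] by (simp add: power2_eq_square algebra_simps)
  then show "integrable lborel (truncation R f)"
    by (intro Bochner_Integration.integrable_bound[OF i]) (auto simp: truncation_def indicator_def)
  show "integrable lborel (\<lambda>t. (norm (truncation R f t))\<^sup>2)"
    by (rule Bochner_Integration.integrable_bound[OF f_sq]) (auto simp: truncation_def)
qed

definition truncation_error :: "real \<Rightarrow> real" where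
  "truncation_error R = (\<integral>t. (norm (truncation R f t - f t))\<^sup>2 \<partial>lborel)"

lemma truncation_error_integrable: "integrable lborel (\<lambda>t. (norm (truncation R f t - f t))\<^sup>2)"
  by (rule Bochner_Integration.integrable_bound[OF f_sq]) (auto simp: truncation_def)

lemma truncation_error_tendsto: "(truncation_error \<longlongrightarrow> 0) at_top"
proof -
  have "((\<lambda>R. \<integral>t. (norm (truncation R f t - f t))\<^sup>2 \<partial>lborel) \<longlongrightarrow> (\<integral>t. 0 \<partial>(lborel :: real measure))) at_top"
  proof (rule integral_dominated_convergence_at_top[where w = "\<lambda>t. (norm (f t))\<^sup>2"])
    show "AE t in lborel. ((\<lambda>R. (norm (truncation R f t - f t))\<^sup>2) \<longlongrightarrow> 0) at_top"
    proof (rule AE_I2)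
      fix t
      have "\<forall>\<^sub>F R in at_top. (norm (truncation R f t - f t))\<^sup>2 = 0"
        using eventually_ge_at_top[of "\<bar>t\<bar>"] by eventually_elim (simp add: truncation_def)
      then show "((\<lambda>R. (norm (truncation R f t - f t))\<^sup>2) \<longlongrightarrow> 0) at_top" by (rule tendsto_eventually)
    qed
    show "\<forall>\<^sub>F R in at_top. AE t in lborel. norm ((norm (truncation R f t - f t))\<^sup>2) \<le> (norm (f t))\<^sup>2"
      by (auto simp: truncation_def)
  qed (use f_sq in auto)
  then show ?thesis unfolding truncation_error_def[abs_def] by simp
qed

text \<open>A truncation equals \<open>f\<close> or zero at each point, so where two truncations
  differ, exactly one of them deviates from \<open>f\<close>, and by all of \<open>f\<close>.
  Plancherel's identity transports this to the frequency side.\<close>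

lemma fourier_truncation_diff:
  "(\<integral>\<^sup>+\<tau>. ennreal ((norm (fourier_L1 (truncation R f) \<tau> - fourier_L1 (truncation S f) \<tau>))\<^sup>2) \<partial>lborel)
     \<le> ennreal (truncation_error R + truncation_error S)"
proof -
  let ?d = "\<lambda>t. truncation R f t - truncation S f t"
  have le: "(norm (?d t))\<^sup>2 \<le> (norm (truncation R f t - f t))\<^sup>2 + (norm (truncation S f t - f t))\<^sup>2" for t
    by (simp add: truncation_def)
  have di: "integrable lborel ?d" using truncation_integrable(1) by simp
  have d2: "integrable lborel (\<lambda>t. (norm (?d t))\<^sup>2)"
    by (rule Bochner_Integration.integrable_bound[OF Bochner_Integration.integrable_add[OF truncation_error_integrable[of R] truncation_error_integrable[of S]]])
       (measurable, rule AE_I2, simp add: le)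
  have "(\<integral>\<^sup>+\<tau>. ennreal ((norm (fourier_L1 (truncation R f) \<tau> - fourier_L1 (truncation S f) \<tau>))\<^sup>2) \<partial>lborel)
     = (\<integral>\<^sup>+t. ennreal ((norm (?d t))\<^sup>2) \<partial>lborel)"
    unfolding fourier_L1_diff[OF truncation_integrable(1) truncation_integrable(1), symmetric]
    by (rule plancherel_L1[OF _ di d2]) measurable
  also have "\<dots> \<le> (\<integral>\<^sup>+t. ennreal ((norm (truncation R f t - f t))\<^sup>2 + (norm (truncation S f t - f t))\<^sup>2) \<partial>lborel)"
    by (intro nn_integral_mono ennreal_leI le)
  also have "\<dots> = ennreal (truncation_error R + truncation_error S)"
    unfolding truncation_error_def using truncation_error_integrable
    by (subst nn_integral_eq_integral) auto
  finally show ?thesis .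
qed

lemma fourier_truncation_measurable [measurable]: "fourier_L1 (truncation R f) \<in> borel_measurable borel"
  by (rule borel_measurable_fourier_L1[OF _ truncation_integrable]) measurable

lemma fourier_truncation_sq: "integrable lborel (\<lambda>\<tau>. (norm (fourier_L1 (truncation R f) \<tau>))\<^sup>2)"
proof (rule integrableI_bounded)
  have "(\<integral>\<^sup>+\<tau>. ennreal ((norm (fourier_L1 (truncation R f) \<tau>))\<^sup>2) \<partial>lborel) = (\<integral>\<^sup>+t. ennreal ((norm (truncation R f t))\<^sup>2) \<partial>lborel)"
    by (rule plancherel_L1[OF _ truncation_integrable]) measurable
  also have "\<dots> < \<infinity>" using truncation_integrable(2)[of R] by (simp add: integrable_iff_bounded)
  finally show "(\<integral>\<^sup>+\<tau>. ennreal (norm ((norm (fourier_L1 (truncation R f) \<tau>))\<^sup>2)) \<partial>lborel) < \<infinity>" by simp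
qed measurable

text \<open>Completeness of \<open>L\<^sup>2\<close>, made explicit. The radii \<open>r k\<close>
  are chosen with error at most \<open>8 ^ - k\<close>, so that even with the weights
  \<open>2 ^ k\<close> the squared increments have a summable integral, and the transforms converge
  almost everywhere along \<open>r\<close>.\<close>

theorem plancherel_limit:
  obtains g where "g \<in> borel_measurable borel" "integrable lborel (\<lambda>\<tau>. (norm (g \<tau>))\<^sup>2)"
    "((\<lambda>R. \<integral>\<^sup>+\<tau>. ennreal ((norm (fourier_L1 (truncation R f) \<tau> - g \<tau>))\<^sup>2) \<partial>lborel) \<longlongrightarrow> 0) at_top"
proof -
  let ?F = "\<lambda>R. fourier_L1 (truncation R f)"
  have "\<exists>R. truncation_error R \<le> (1 / 8) ^ k" for k :: nat
  proof -
    have "\<forall>\<^sub>F R in at_top. truncation_error R < (1 / 8) ^ k" by (rule order_tendstoD(2)[OF truncation_error_tendsto]) simp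
    then have "\<exists>R. truncation_error R < (1 / 8) ^ k" by (auto dest: eventually_happens)
    then show ?thesis by (auto intro: less_imp_le)
  qed
  then obtain r where r: "truncation_error (r k) \<le> (1 / 8) ^ k" for k by metis
  define d where "d = (\<lambda>k \<tau>. ?F (r (Suc k)) \<tau> - ?F (r k) \<tau>)"
  have [measurable]: "d k \<in> borel_measurable borel" for k unfolding d_def by measurable
  have dk: "(\<integral>\<^sup>+\<tau>. ennreal (2 ^ k * (norm (d k \<tau>))\<^sup>2) \<partial>lborel) \<le> ennreal (2 * (1 / 4) ^ k)" for k
  proof -
    have "(\<integral>\<^sup>+\<tau>. ennreal (2 ^ k * (norm (d k \<tau>))\<^sup>2) \<partial>lborel) = ennreal (2 ^ k) * (\<integral>\<^sup>+\<tau>. ennreal ((norm (d k \<tau>))\<^sup>2) \<partial>lborel)"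
      by (simp add: ennreal_mult nn_integral_cmult)
    also have "\<dots> \<le> ennreal (2 ^ k) * ennreal (truncation_error (r (Suc k)) + truncation_error (r k))"
      unfolding d_def by (intro mult_left_mono fourier_truncation_diff) simp
    also have "\<dots> = ennreal (2 ^ k * (truncation_error (r (Suc k)) + truncation_error (r k)))" by (rule ennreal_mult'[symmetric]) simp
    also have "\<dots> \<le> ennreal (2 * (1 / 4) ^ k)"
    proof (rule ennreal_leI)
      have "(1 / 8) ^ Suc k \<le> (1 / 8 :: real) ^ k" by (rule power_decreasing) auto
      then have "truncation_error (r (Suc k)) + truncation_error (r k) \<le> 2 * (1 / 8) ^ k" using r[of k] r[of "Suc k"] by linarith
      then have "2 ^ k * (truncation_error (r (Suc k)) + truncation_error (r k)) \<le> 2 ^ k * (2 * (1 / 8) ^ k)" by (rule mult_left_mono) simp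
      also have "\<dots> = 2 * (2 * (1 / 8)) ^ k" by (simp only: power_mult_distrib mult_ac)
      finally show "2 ^ k * (truncation_error (r (Suc k)) + truncation_error (r k)) \<le> 2 * (1 / 4) ^ k" by simp
    qed
    finally show ?thesis .
  qed
  have "(\<integral>\<^sup>+\<tau>. (\<Sum>k. ennreal (2 ^ k * (norm (d k \<tau>))\<^sup>2)) \<partial>lborel) = (\<Sum>k. \<integral>\<^sup>+\<tau>. ennreal (2 ^ k * (norm (d k \<tau>))\<^sup>2) \<partial>lborel)"
    by (rule nn_integral_suminf) measurable
  also have "\<dots> \<le> (\<Sum>k. ennreal (2 * (1 / 4) ^ k))" by (intro suminf_le dk) auto
  also have "\<dots> = ennreal (\<Sum>k. 2 * (1 / 4) ^ k)" by (intro suminf_ennreal2) (auto intro!: summable_mult summable_geometric)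
  also have "\<dots> < \<infinity>" by simp
  finally have "AE \<tau> in lborel. (\<Sum>k. ennreal (2 ^ k * (norm (d k \<tau>))\<^sup>2)) \<noteq> \<infinity>"
    by (intro nn_integral_PInf_AE) auto
  then have conv: "AE \<tau> in lborel. convergent (\<lambda>k. ?F (r k) \<tau>)"
  proof eventually_elim
    case (elim \<tau>)
    then have s: "summable (\<lambda>k. 2 ^ k * (norm (d k \<tau>))\<^sup>2)"
      by (intro summable_suminf_not_top) (auto simp: top_unique)
    \<comment> \<open>\<open>x \<le> 1 + x\<^sup>2\<close> at
      \<open>x = 2 ^ k * norm (d k \<tau>)\<close>, divided by \<open>2 ^ k\<close>, passes from
      summable weighted squares to absolute summability.\<close>
    have le: "norm (d k \<tau>) \<le> (1 / 2) ^ k + 2 ^ k * (norm (d k \<tau>))\<^sup>2" for k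
    proof -
      define x where "x = 2 ^ k * norm (d k \<tau>)"
      have "x \<le> 1 + x\<^sup>2" using zero_le_power2[of "x - 1 / 2"] by (simp add: power2_eq_square algebra_simps)
      then have "(1 / 2) ^ k * x \<le> (1 / 2) ^ k * (1 + x\<^sup>2)" by (rule mult_left_mono) simp
      moreover have "(1 / 2) ^ k * x = norm (d k \<tau>)" by (simp add: x_def power_divide)
      moreover have "(1 / 2) ^ k * (1 + x\<^sup>2) = (1 / 2) ^ k + 2 ^ k * (norm (d k \<tau>))\<^sup>2"
        by (simp add: x_def power_divide power2_eq_square field_simps)
      ultimately show ?thesis by simp
    qed
    have "summable (\<lambda>k. d k \<tau>)"
      by (rule summable_comparison_test'[OF summable_add[OF summable_geometric s], of "1 / 2" 0]) (use le in auto)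
    then have "convergent (\<lambda>n. \<Sum>k<n. d k \<tau>)" by (simp add: summable_iff_convergent)
    moreover have "(\<Sum>k<n. d k \<tau>) = ?F (r n) \<tau> - ?F (r 0) \<tau>" for n
      unfolding d_def by (rule sum_lessThan_telescope)
    ultimately have "convergent (\<lambda>n. ?F (r n) \<tau> - ?F (r 0) \<tau> + ?F (r 0) \<tau>)"
      by (intro convergent_add) (auto simp: convergent_const)
    then show ?case by simp
  qed
  define g where "g = (\<lambda>\<tau>. lim (\<lambda>k. ?F (r k) \<tau>))"
  have [measurable]: "g \<in> borel_measurable borel" unfolding g_def by measurable
  \<comment> \<open>Fatou's lemma in \<open>k\<close> at an arbitrary radius \<open>S\<close>; this
    gives the limit over all radii and not only along \<open>r\<close>.\<close>
  have le: "(\<integral>\<^sup>+\<tau>. ennreal ((norm (?F S \<tau> - g \<tau>))\<^sup>2) \<partial>lborel) \<le> ennreal (truncation_error S)" for S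
  proof -
    have "(\<integral>\<^sup>+\<tau>. ennreal ((norm (?F S \<tau> - g \<tau>))\<^sup>2) \<partial>lborel)
      = (\<integral>\<^sup>+\<tau>. liminf (\<lambda>k. ennreal ((norm (?F S \<tau> - ?F (r k) \<tau>))\<^sup>2)) \<partial>lborel)"
    proof (rule nn_integral_cong_AE, use conv in eventually_elim)
      case (elim \<tau>)
      then have "(\<lambda>k. ?F (r k) \<tau>) \<longlonglongrightarrow> g \<tau>" unfolding g_def by (simp add: convergent_LIMSEQ_iff)
      then show ?case by (intro lim_imp_Liminf[symmetric] tendsto_intros) auto
    qed
    also have "\<dots> \<le> liminf (\<lambda>k. \<integral>\<^sup>+\<tau>. ennreal ((norm (?F S \<tau> - ?F (r k) \<tau>))\<^sup>2) \<partial>lborel)"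
      by (rule nn_integral_liminf) measurable
    also have "\<dots> \<le> liminf (\<lambda>k. ennreal (truncation_error S + (1 / 8) ^ k))"
    proof (intro Liminf_mono always_eventually allI)
      fix k
      have "ennreal (truncation_error S + truncation_error (r k)) \<le> ennreal (truncation_error S + (1 / 8) ^ k)" using r[of k] by (intro ennreal_leI) simp
      then show "(\<integral>\<^sup>+\<tau>. ennreal ((norm (?F S \<tau> - ?F (r k) \<tau>))\<^sup>2) \<partial>lborel) \<le> ennreal (truncation_error S + (1 / 8) ^ k)"
        by (rule order_trans[OF fourier_truncation_diff])
    qed
    also have "\<dots> = ennreal (truncation_error S)"
    proof (rule lim_imp_Liminf)
      have "(\<lambda>k. ennreal (truncation_error S + (1 / 8) ^ k)) \<longlonglongrightarrow> ennreal (truncation_error S + 0)"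
        by (intro tendsto_ennrealI tendsto_add tendsto_const LIMSEQ_realpow_zero) auto
      then show "(\<lambda>k. ennreal (truncation_error S + (1 / 8) ^ k)) \<longlonglongrightarrow> ennreal (truncation_error S)" by simp
    qed simp
    finally show ?thesis .
  qed
  have lim: "((\<lambda>R. \<integral>\<^sup>+\<tau>. ennreal ((norm (?F R \<tau> - g \<tau>))\<^sup>2) \<partial>lborel) \<longlongrightarrow> 0) at_top"
  proof (rule tendsto_sandwich[OF _ _ tendsto_const])
    show "((\<lambda>R. ennreal (truncation_error R)) \<longlongrightarrow> 0) at_top"
      using tendsto_ennrealI[OF truncation_error_tendsto] by simp
  qed (use le in auto)
  have "integrable lborel (\<lambda>\<tau>. (norm (?F 0 \<tau> - g \<tau>))\<^sup>2)"
    by (rule integrableI_bounded) (use le[of 0] in \<open>auto intro: order.strict_trans1\<close>)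
  then have "integrable lborel (\<lambda>\<tau>. 2 * (norm (?F 0 \<tau>))\<^sup>2 + 2 * (norm (?F 0 \<tau> - g \<tau>))\<^sup>2)"
    using fourier_truncation_sq by simp
  then have "integrable lborel (\<lambda>\<tau>. (norm (g \<tau>))\<^sup>2)"
  proof (rule Bochner_Integration.integrable_bound)
    have "(norm b)\<^sup>2 \<le> 2 * (norm a)\<^sup>2 + 2 * (norm (a - b))\<^sup>2" for a b :: complex
      using norm_diff_square_le[of a "a - b"] by simp
    then show "AE \<tau> in lborel. norm ((norm (g \<tau>))\<^sup>2) \<le> norm (2 * (norm (?F 0 \<tau>))\<^sup>2 + 2 * (norm (?F 0 \<tau> - g \<tau>))\<^sup>2)"
      by simp
  qed measurable
  with lim show thesis using that[of g] by simp
qed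

theorem plancherel_difference:
  assumes [measurable]: "g \<in> borel_measurable borel" and g: "integrable lborel (\<lambda>\<tau>. (norm (g \<tau>))\<^sup>2)"
    and lim: "((\<lambda>R. \<integral>\<^sup>+\<tau>. ennreal ((norm (fourier_L1 (truncation R f) \<tau> - g \<tau>))\<^sup>2) \<partial>lborel) \<longlongrightarrow> 0) at_top"
  shows "(\<integral>\<^sup>+\<tau>. ennreal ((norm (exp (\<i> * of_real (\<tau> * s)) - 1))\<^sup>2 * (norm (g \<tau>))\<^sup>2) \<partial>lborel)
     = (\<integral>\<^sup>+t. ennreal ((norm (f (t + s) - f t))\<^sup>2) \<partial>lborel)"
proof -
  let ?F = "\<lambda>R. fourier_L1 (truncation R f)"
  let ?e = "\<lambda>\<tau>. exp (\<i> * complex_of_real (\<tau> * s)) - 1"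
  let ?a = "\<lambda>n t. truncation (real n) f (t + s) - truncation (real n) f t"
  have e4: "(norm (?e \<tau>))\<^sup>2 \<le> 4" for \<tau>
  proof -
    have "norm (?e \<tau>) \<le> 2" using norm_triangle_ineq4[of "exp (\<i> * complex_of_real (\<tau> * s))" 1] by simp
    then have "(norm (?e \<tau>))\<^sup>2 \<le> 2\<^sup>2" by (rule power_mono) simp
    then show ?thesis by simp
  qed
  have Fg: "integrable lborel (\<lambda>\<tau>. (norm (?F R \<tau> - g \<tau>))\<^sup>2)" for R
    by (rule Bochner_Integration.integrable_bound[OF integrable_mult_right[OF Bochner_Integration.integrable_add[OF fourier_truncation_sq[of R] g], of 2]])
       (measurable, rule AE_I2, use norm_diff_square_le in simp)
  have "((\<lambda>R. \<integral>\<tau>. (norm (?F R \<tau> - g \<tau>))\<^sup>2 \<partial>lborel) \<longlongrightarrow> 0) at_top"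
    using lim by (subst (asm) nn_integral_eq_integral[OF Fg]) (auto simp: tendsto_ennreal_iff ennreal_0[symmetric] simp del: ennreal_0)
  then have limn: "(\<lambda>n. \<integral>\<tau>. (norm (?F (real n) \<tau> - g \<tau>))\<^sup>2 \<partial>lborel) \<longlonglongrightarrow> 0"
    by (rule filterlim_compose[OF _ filterlim_real_sequentially])
  have e_le: "(norm (?e \<tau> * z))\<^sup>2 \<le> 4 * (norm z)\<^sup>2" for \<tau> z
    unfolding norm_mult power_mult_distrib by (intro mult_right_mono e4) simp
  have e_int: "integrable lborel (\<lambda>\<tau>. (norm (?e \<tau> * h \<tau>))\<^sup>2)"
    if [measurable]: "h \<in> borel_measurable borel" and h: "integrable lborel (\<lambda>\<tau>. (norm (h \<tau>))\<^sup>2)" for h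
    by (rule Bochner_Integration.integrable_bound[OF integrable_mult_right[OF h, of 4]])
       (measurable, rule AE_I2, use e_le in \<open>simp del: norm_mult\<close>)
  have L: "(\<lambda>n. \<integral>\<tau>. (norm (?e \<tau> * ?F (real n) \<tau>))\<^sup>2 \<partial>lborel) \<longlonglongrightarrow> (\<integral>\<tau>. (norm (?e \<tau> * g \<tau>))\<^sup>2 \<partial>lborel)"
  proof (rule L2_norm_tendsto(2))
    show "integrable lborel (\<lambda>\<tau>. (norm (?e \<tau> * g \<tau>))\<^sup>2)" by (intro e_int g) measurable
    have i: "integrable lborel (\<lambda>\<tau>. (norm (?e \<tau> * (?F (real n) \<tau> - g \<tau>)))\<^sup>2)" for n
      by (intro e_int Fg) measurable
    then show "integrable lborel (\<lambda>\<tau>. (norm (?e \<tau> * ?F (real n) \<tau> - ?e \<tau> * g \<tau>))\<^sup>2)" for n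
      by (simp only: right_diff_distrib)
    have "(\<lambda>n. \<integral>\<tau>. (norm (?e \<tau> * (?F (real n) \<tau> - g \<tau>)))\<^sup>2 \<partial>lborel) \<longlonglongrightarrow> 0"
    proof (rule tendsto_sandwich[OF _ _ tendsto_const])
      show "(\<lambda>n. 4 * (\<integral>\<tau>. (norm (?F (real n) \<tau> - g \<tau>))\<^sup>2 \<partial>lborel)) \<longlonglongrightarrow> 0"
        by (rule tendsto_mult_right_zero[OF limn])
      have "(\<integral>\<tau>. (norm (?e \<tau> * (?F (real n) \<tau> - g \<tau>)))\<^sup>2 \<partial>lborel) \<le> (\<integral>\<tau>. 4 * (norm (?F (real n) \<tau> - g \<tau>))\<^sup>2 \<partial>lborel)" for n
        by (intro integral_mono i integrable_mult_right Fg e_le)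
      then show "\<forall>\<^sub>F n in sequentially. (\<integral>\<tau>. (norm (?e \<tau> * (?F (real n) \<tau> - g \<tau>)))\<^sup>2 \<partial>lborel) \<le> 4 * (\<integral>\<tau>. (norm (?F (real n) \<tau> - g \<tau>))\<^sup>2 \<partial>lborel)"
        by simp
    qed simp
    then show "(\<lambda>n. \<integral>\<tau>. (norm (?e \<tau> * ?F (real n) \<tau> - ?e \<tau> * g \<tau>))\<^sup>2 \<partial>lborel) \<longlonglongrightarrow> 0"
      by (simp only: right_diff_distrib)
  qed measurable
  have ft: "integrable lborel (\<lambda>t. (norm (f (t + s)))\<^sup>2)"
    using f_sq by (rule integrable_lborel_translate[of "\<lambda>t. (norm (f t))\<^sup>2", THEN iffD2])
  have ff: "integrable lborel (\<lambda>t. (norm (f (t + s) - f t))\<^sup>2)"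
    by (rule Bochner_Integration.integrable_bound[OF Bochner_Integration.integrable_add[OF integrable_mult_right[OF ft, of 2] integrable_mult_right[OF f_sq, of 2]]])
       (measurable, rule AE_I2, use norm_diff_square_le in simp)
  define tr where "tr = (\<lambda>n t. (norm (truncation (real n) f t - f t))\<^sup>2)"
  have tr: "integrable lborel (tr n)" "integrable lborel (\<lambda>t. tr n (t + s))" for n
    unfolding tr_def using truncation_error_integrable[of "real n"]
      integrable_lborel_translate[of "\<lambda>t. (norm (truncation (real n) f t - f t))\<^sup>2" s] by auto
  have trI: "(\<integral>t. 2 * tr n (t + s) + 2 * tr n t \<partial>lborel) = 4 * truncation_error (real n)" for n
    using tr[of n] integral_lborel_translate[of "tr n" s] by (simp add: truncation_error_def tr_def)
  have a_le: "(norm (?a n t - (f (t + s) - f t)))\<^sup>2 \<le> 2 * tr n (t + s) + 2 * tr n t" for n t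
    unfolding tr_def
    using norm_diff_square_le[of "truncation (real n) f (t + s) - f (t + s)" "truncation (real n) f t - f t"]
    by (simp add: algebra_simps)
  have a_int: "integrable lborel (\<lambda>t. (norm (?a n t - (f (t + s) - f t)))\<^sup>2)" for n
    by (rule Bochner_Integration.integrable_bound[OF Bochner_Integration.integrable_add[OF integrable_mult_right[OF tr(2)[of n], of 2] integrable_mult_right[OF tr(1)[of n], of 2]]])
       (measurable, rule AE_I2, use a_le order_trans[OF a_le abs_ge_self] in simp)
  have a_lim: "(\<lambda>n. \<integral>t. (norm (?a n t - (f (t + s) - f t)))\<^sup>2 \<partial>lborel) \<longlonglongrightarrow> 0"
  proof (rule tendsto_sandwich[OF _ _ tendsto_const])
    show "(\<lambda>n. 4 * truncation_error (real n)) \<longlonglongrightarrow> 0"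
      by (intro tendsto_mult_right_zero filterlim_compose[OF truncation_error_tendsto filterlim_real_sequentially])
    have "(\<integral>t. (norm (?a n t - (f (t + s) - f t)))\<^sup>2 \<partial>lborel) \<le> (\<integral>t. 2 * tr n (t + s) + 2 * tr n t \<partial>lborel)" for n
      by (intro integral_mono a_int a_le Bochner_Integration.integrable_add integrable_mult_right tr)
    then show "\<forall>\<^sub>F n in sequentially. (\<integral>t. (norm (?a n t - (f (t + s) - f t)))\<^sup>2 \<partial>lborel) \<le> 4 * truncation_error (real n)"
      by (simp only: trI) simp
  qed simp
  have am: "(\<lambda>t. ?a n t) \<in> borel_measurable lborel" for n by measurable
  have a2: "integrable lborel (\<lambda>t. (norm (?a n t))\<^sup>2)" for n
    by (rule L2_norm_tendsto(1)[OF _ am ff a_int a_lim]) measurable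
  have R: "(\<lambda>n. \<integral>t. (norm (?a n t))\<^sup>2 \<partial>lborel) \<longlonglongrightarrow> (\<integral>t. (norm (f (t + s) - f t))\<^sup>2 \<partial>lborel)"
    by (rule L2_norm_tendsto(2)[OF _ am ff a_int a_lim]) measurable
  have eq: "(\<integral>t. (norm (?a n t))\<^sup>2 \<partial>lborel) = (\<integral>\<tau>. (norm (?e \<tau> * ?F (real n) \<tau>))\<^sup>2 \<partial>lborel)" for n
  proof -
    have ti: "integrable lborel (\<lambda>t. truncation (real n) f (t + s))"
      by (rule integrable_lborel_translate[THEN iffD2, OF truncation_integrable(1)])
    have ai: "integrable lborel (\<lambda>t. ?a n t)"
      by (intro Bochner_Integration.integrable_diff ti truncation_integrable(1))
    have Fa: "fourier_L1 (\<lambda>t. ?a n t) \<tau> = ?e \<tau> * ?F (real n) \<tau>" for \<tau>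
      unfolding fourier_L1_diff[OF ti truncation_integrable(1)] fourier_L1_translate by (simp add: left_diff_distrib)
    have "ennreal (\<integral>\<tau>. (norm (?e \<tau> * ?F (real n) \<tau>))\<^sup>2 \<partial>lborel) = (\<integral>\<^sup>+\<tau>. ennreal ((norm (?e \<tau> * ?F (real n) \<tau>))\<^sup>2) \<partial>lborel)"
      by (intro nn_integral_eq_integral[symmetric] e_int fourier_truncation_sq) auto
    also have "\<dots> = (\<integral>\<^sup>+t. ennreal ((norm (?a n t))\<^sup>2) \<partial>lborel)"
      unfolding Fa[symmetric] by (rule plancherel_L1[OF _ ai a2]) measurable
    also have "\<dots> = ennreal (\<integral>t. (norm (?a n t))\<^sup>2 \<partial>lborel)" by (rule nn_integral_eq_integral[OF a2]) simp
    finally show ?thesis by (subst (asm) ennreal_inj) auto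
  qed
  have "(\<integral>\<tau>. (norm (?e \<tau> * g \<tau>))\<^sup>2 \<partial>lborel) = (\<integral>t. (norm (f (t + s) - f t))\<^sup>2 \<partial>lborel)"
    using L R unfolding eq by (rule LIMSEQ_unique)
  moreover have "(\<integral>\<^sup>+\<tau>. ennreal ((norm (?e \<tau> * g \<tau>))\<^sup>2) \<partial>lborel) = ennreal (\<integral>\<tau>. (norm (?e \<tau> * g \<tau>))\<^sup>2 \<partial>lborel)"
    by (intro nn_integral_eq_integral e_int g) auto
  moreover have "(\<integral>\<^sup>+t. ennreal ((norm (f (t + s) - f t))\<^sup>2) \<partial>lborel) = ennreal (\<integral>t. (norm (f (t + s) - f t))\<^sup>2 \<partial>lborel)"
    by (intro nn_integral_eq_integral ff) auto
  ultimately show ?thesis by (simp add: norm_mult power_mult_distrib)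
qed

end

section \<open>The symbol as an average of squared differences\<close>

text \<open>Euler's product for the sine at an imaginary argument.\<close>

lemma sinh_product_formula:
  fixes x :: real
  shows "(\<lambda>n. pi * x * (\<Prod>k=1..n. 1 + x\<^sup>2 / (real k)\<^sup>2)) \<longlonglongrightarrow> sinh (pi * x)"
proof -
  let ?z = "\<i> * complex_of_real x"
  have "(\<lambda>n. of_real pi * ?z * (\<Prod>k=1..n. 1 - ?z\<^sup>2 / of_nat k ^ 2)) \<longlonglongrightarrow> sin (of_real pi * ?z)"
    by (rule sin_product_formula_complex)
  then have "(\<lambda>n. Im (of_real pi * ?z * (\<Prod>k=1..n. 1 - ?z\<^sup>2 / of_nat k ^ 2))) \<longlonglongrightarrow> Im (sin (of_real pi * ?z))"
    by (rule tendsto_Im)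
  moreover have "of_real pi * ?z * (\<Prod>k=1..n. 1 - ?z\<^sup>2 / of_nat k ^ 2) = \<i> * of_real (pi * x * (\<Prod>k=1..n. 1 + x\<^sup>2 / (real k)\<^sup>2))" for n
    by (simp add: power_mult_distrib)
  moreover have "Im (sin (of_real pi * ?z)) = sinh (pi * x)"
    by (simp add: Im_sin sinh_field_def)
  ultimately show ?thesis by (simp only: Im_i_times Re_complex_of_real)
qed

text \<open>The logarithmic derivative of the product for
  \<open>sinh (pi * x) / (pi * x)\<close>.\<close>

lemma coth_partial_fractions:
  fixes x :: real
  assumes x: "0 < x"
  shows "(\<lambda>k. 2 * x / ((real (Suc k))\<^sup>2 + x\<^sup>2)) sums (pi * coth (pi * x) - 1 / x)"
proof -
  let ?f = "\<lambda>k x. ln (1 + x\<^sup>2 / (real (Suc k))\<^sup>2)"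
  let ?f' = "\<lambda>k x. 2 * x / ((real (Suc k))\<^sup>2 + x\<^sup>2)"
  \<comment> \<open>Boundedness of this neighbourhood lets
    \<open>2 * (x + 1) / (k + 1)\<^sup>2\<close> dominate the differentiated terms.\<close>
  let ?S = "{0<..<x + 1}"
  have pos: "0 < 1 + y\<^sup>2 / (real (Suc k))\<^sup>2" for y k by (intro add_pos_nonneg) auto
  have sums: "(\<lambda>k. ?f k y) sums ln (sinh (pi * y) / (pi * y))" if "0 < y" for y
  proof -
    have "(\<lambda>n. pi * y * (\<Prod>k=1..n. 1 + y\<^sup>2 / (real k)\<^sup>2) / (pi * y)) \<longlonglongrightarrow> sinh (pi * y) / (pi * y)"
      using that by (intro tendsto_divide sinh_product_formula tendsto_const) auto
    then have "(\<lambda>n. \<Prod>k=1..n. 1 + y\<^sup>2 / (real k)\<^sup>2) \<longlonglongrightarrow> sinh (pi * y) / (pi * y)" using that by simp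
    moreover have "(\<Prod>k=1..n. 1 + y\<^sup>2 / (real k)\<^sup>2) = (\<Prod>k<n. 1 + y\<^sup>2 / (real (Suc k))\<^sup>2)" for n
      by (rule prod.reindex_bij_witness[of _ Suc "\<lambda>k. k - 1"]) auto
    ultimately have "(\<lambda>n. \<Prod>k<n. 1 + y\<^sup>2 / (real (Suc k))\<^sup>2) \<longlonglongrightarrow> sinh (pi * y) / (pi * y)" by simp
    then have "(\<lambda>n. ln (\<Prod>k<n. 1 + y\<^sup>2 / (real (Suc k))\<^sup>2)) \<longlonglongrightarrow> ln (sinh (pi * y) / (pi * y))"
      using that by (intro tendsto_ln) auto
    moreover have "ln (\<Prod>k<n. 1 + y\<^sup>2 / (real (Suc k))\<^sup>2) = (\<Sum>k<n. ?f k y)" for n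
      by (rule ln_prod) (simp, metis pos less_irrefl)
    ultimately show ?thesis by (simp add: sums_def)
  qed
  have xS: "x \<in> interior ?S" using x by simp
  have der: "(?f k has_field_derivative ?f' k y) (at y within ?S)" for k y
  proof -
    define d where "d = (real (Suc k))\<^sup>2"
    have d: "0 < d" by (simp add: d_def)
    have "((\<lambda>y. 1 + y\<^sup>2 / d) has_field_derivative 2 * y / d) (at y within ?S)"
      using d by (auto intro!: derivative_eq_intros)
    moreover have "0 < 1 + y\<^sup>2 / d" using d by (intro add_pos_nonneg) auto
    ultimately have "((\<lambda>y. ln (1 + y\<^sup>2 / d)) has_field_derivative inverse (1 + y\<^sup>2 / d) * (2 * y / d)) (at y within ?S)"
      by (intro DERIV_chain'[where g = ln and f = "\<lambda>y. 1 + y\<^sup>2 / d"] DERIV_ln)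
    moreover have "1 + y\<^sup>2 / d = (d + y\<^sup>2) / d" using d by (simp add: field_simps)
    then have "inverse (1 + y\<^sup>2 / d) * (2 * y / d) = 2 * y / (d + y\<^sup>2)" using d by simp
    ultimately show ?thesis unfolding d_def by (simp only:)
  qed
  have unif: "uniformly_convergent_on ?S (\<lambda>n y. \<Sum>k<n. ?f' k y)"
  proof (rule Weierstrass_m_test'_ev[unfolded uniformly_convergent_on_def[symmetric]])
    show "\<forall>\<^sub>F n in sequentially. \<forall>y\<in>?S. norm (?f' n y) \<le> 2 * (x + 1) * (1 / (real (Suc n))\<^sup>2)"
    proof (intro always_eventually allI ballI)
      fix n y assume y: "y \<in> ?S"
      have "2 * y / ((real (Suc n))\<^sup>2 + y\<^sup>2) \<le> 2 * (x + 1) / (real (Suc n))\<^sup>2"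
        using y by (intro frac_le) auto
      then show "norm (?f' n y) \<le> 2 * (x + 1) * (1 / (real (Suc n))\<^sup>2)" using y by simp
    qed
    show "summable (\<lambda>n. 2 * (x + 1) * (1 / (real (Suc n))\<^sup>2))"
      by (intro summable_mult) (use sums_summable[OF inverse_squares_sums] in \<open>simp add: add.commute\<close>)
  qed
  have summ': "summable (\<lambda>k. ?f' k x)"
  proof -
    have "convergent (\<lambda>n. \<Sum>k<n. ?f' k x)"
      by (rule uniformly_convergent_imp_convergent[OF unif]) (use x in auto)
    then show ?thesis by (simp add: summable_iff_convergent)
  qed
  have d: "((\<lambda>y. \<Sum>k. ?f k y) has_field_derivative (\<Sum>k. ?f' k x)) (at x)"
    by (rule has_field_derivative_series'(2)[OF _ der unif _ sums_summable[OF sums] xS, of x]) (use x in auto)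
  have "((\<lambda>y. ln (sinh (pi * y) / (pi * y))) has_field_derivative (\<Sum>k. ?f' k x)) (at x)"
  proof (rule has_field_derivative_transform_within_open[OF d, of ?S])
    show "(\<Sum>k. ?f k y) = ln (sinh (pi * y) / (pi * y))" if "y \<in> ?S" for y
      using sums_unique[OF sums[of y]] that by simp
  qed (use x in auto)
  moreover have "((\<lambda>y. ln (sinh (pi * y) / (pi * y))) has_field_derivative (pi * coth (pi * x) - 1 / x)) (at x)"
    using x by (auto intro!: derivative_eq_intros simp: coth_def field_simps power2_eq_square)
  ultimately have "(\<Sum>k. ?f' k x) = pi * coth (pi * x) - 1 / x" by (rule DERIV_unique)
  then show ?thesis using summ' by (simp add: sums_iff)
qed

text \<open>The shape matches the kernel computation: the outer factor two stands for the two
  half-lines, and \<open>2 * x\<close> times the bracket is what the partial fractions produce on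
  one of them.\<close>

lemma T_symbol_eq:
  assumes "\<tau> \<noteq> 0"
  defines "x \<equiv> \<bar>\<tau>\<bar> / 2"
  shows "2 * pi * T_symbol \<tau> = 2 * (2 * x * (pi * coth (pi * x) - 1 / x))"
proof -
  have "\<tau> * coth (pi * \<tau> / 2) = \<bar>\<tau>\<bar> * coth (pi * \<bar>\<tau>\<bar> / 2)"
    by (cases "0 \<le> \<tau>") (simp_all add: coth_def)
  also have "\<dots> = 2 * x * coth (pi * x)" by (simp add: x_def)
  finally have "\<tau> * coth (pi * \<tau> / 2) = 2 * x * coth (pi * x)" .
  moreover have "x \<noteq> 0" using assms by simp
  ultimately show ?thesis using assms(1) by (simp add: T_symbol_def field_simps)
qed

lemma T_symbol_nonneg: "0 \<le> T_symbol \<tau>"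
proof (cases "\<tau> = 0")
  case False
  define x where "x = \<bar>\<tau>\<bar> / 2"
  have x: "0 < x" using False by (simp add: x_def)
  have "0 \<le> (\<Sum>k. 2 * x / ((real (Suc k))\<^sup>2 + x\<^sup>2))"
    using x by (intro suminf_nonneg sums_summable[OF coth_partial_fractions]) auto
  also have "\<dots> = pi * coth (pi * x) - 1 / x"
    by (rule sums_unique[OF coth_partial_fractions[OF x], symmetric])
  finally have "0 \<le> 2 * pi * T_symbol \<tau>"
    unfolding T_symbol_eq[OF False] x_def[symmetric] using x by (intro mult_nonneg_nonneg) auto
  then show ?thesis using divide_nonneg_pos[of "2 * pi * T_symbol \<tau>" "2 * pi"] by simp
qed (simp add: T_symbol_def)

lemma T_symbol_le: "T_symbol \<tau> \<le> \<bar>\<tau>\<bar>"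
proof (cases "\<tau> = 0")
  case False
  define y where "y = pi * \<bar>\<tau>\<bar> / 2"
  have y: "0 < y" using False by (simp add: y_def)
  have ey: "1 + 2 * y \<le> exp (2 * y)" by (rule exp_ge_add_one_self)
  then have "y * cosh y \<le> (y + 1) * sinh y"
  proof -
    have "2 * y * exp (- y) \<le> (exp (2 * y) - 1) * exp (- y)"
      using ey by (intro mult_right_mono) (simp_all add: algebra_simps)
    also have "\<dots> = exp y - exp (- y)" by (simp add: left_diff_distrib flip: exp_add)
    finally show ?thesis by (simp add: cosh_field_def sinh_field_def field_simps)
  qed
  then have "y * coth y \<le> y + 1" using y by (simp add: coth_def divide_le_eq)
  moreover have "\<tau> * coth (pi * \<tau> / 2) = \<bar>\<tau>\<bar> * coth y"
    by (cases "0 \<le> \<tau>") (simp_all add: coth_def y_def)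
  ultimately show ?thesis using False by (simp add: T_symbol_def y_def field_simps)
qed (simp add: T_symbol_def)

lemma borel_measurable_sinh_cosh [measurable]:
  "sinh \<in> borel_measurable (borel :: real measure)" "cosh \<in> borel_measurable (borel :: real measure)"
  by (intro borel_measurable_continuous_onI continuous_intros)+

lemma borel_measurable_T_symbol [measurable]: "T_symbol \<in> borel_measurable borel"
  unfolding T_symbol_def[abs_def] coth_def by measurable

lemma norm_exp_minus_one_square: "(norm (exp (\<i> * of_real x) - 1))\<^sup>2 = 2 - 2 * cos x"
proof -
  have "(norm (exp (\<i> * of_real x) - 1))\<^sup>2 = (cos x - 1)\<^sup>2 + (sin x)\<^sup>2"
    by (simp add: cmod_power2 cis_conv_exp[symmetric])
  also have "\<dots> = 2 - 2 * cos x"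
    using sin_cos_squared_add[of x] by (simp add: power2_diff)
  finally show ?thesis .
qed

section \<open>The kernel \<open>1 / sinh\<^sup>2\<close> and its transform\<close>

lemma nn_integral_damped_cos:
  fixes b c :: real
  assumes c: "0 < c"
  shows "(\<integral>\<^sup>+s. ennreal ((2 - 2 * cos (b * s)) * (2 * c * exp (- c * s))) * indicator {0..} s \<partial>lborel)
     = ennreal (4 * b\<^sup>2 / (c\<^sup>2 + b\<^sup>2))"
proof -
  have cb: "0 < c\<^sup>2 + b\<^sup>2" using c by (simp add: add_pos_nonneg)
  \<comment> \<open>\<open>exp (- c s) (c cos (b s) - b sin (b s))\<close> has the derivative
    \<open>- (c\<^sup>2 + b\<^sup>2) exp (- c s) cos (b s)\<close>, so this \<open>K\<close> makes
    \<open>?F\<close> an antiderivative of the integrand.\<close>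
  define K where "K = 4 * c / (c\<^sup>2 + b\<^sup>2)"
  have K: "0 < K" "K * (c\<^sup>2 + b\<^sup>2) = 4 * c" using c cb by (auto simp: K_def)
  let ?F = "\<lambda>s. exp (- c * s) * (- 4 + K * (c * cos (b * s) - b * sin (b * s)))"
  have lim: "(?F \<longlongrightarrow> 0) at_top"
  proof (rule Lim_null_comparison)
    show "\<forall>\<^sub>F s in at_top. norm (?F s) \<le> exp (- c * s) * (4 + K * (c + \<bar>b\<bar>))"
    proof (intro always_eventually allI)
      fix s
      have shift4: "\<bar>y\<bar> \<le> Y \<Longrightarrow> \<bar>- 4 + y\<bar> \<le> 4 + Y" for y Y :: real by linarith
      have "\<bar>c * cos (b * s) - b * sin (b * s)\<bar> \<le> \<bar>c * cos (b * s)\<bar> + \<bar>b * sin (b * s)\<bar>" by (rule abs_triangle_ineq4)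
      also have "\<dots> \<le> c * 1 + \<bar>b\<bar> * 1" unfolding abs_mult using c by (intro add_mono mult_mono) auto
      finally have "\<bar>K\<bar> * \<bar>c * cos (b * s) - b * sin (b * s)\<bar> \<le> K * (c + \<bar>b\<bar>)"
        using c K by (intro mult_mono) auto
      then have "\<bar>- 4 + K * (c * cos (b * s) - b * sin (b * s))\<bar> \<le> 4 + K * (c + \<bar>b\<bar>)"
        using shift4[of "K * (c * cos (b * s) - b * sin (b * s))"] by (simp only: abs_mult)
      then show "norm (?F s) \<le> exp (- c * s) * (4 + K * (c + \<bar>b\<bar>))"
        unfolding real_norm_def abs_mult[of "exp _"] by (intro mult_mono) auto
    qed
    have "((\<lambda>s. exp (- c * s)) \<longlongrightarrow> 0) at_top" using c by real_asymp
    then show "((\<lambda>s. exp (- c * s) * (4 + K * (c + \<bar>b\<bar>))) \<longlongrightarrow> 0) at_top"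
      by (rule tendsto_mult_left_zero)
  qed
  have "(\<integral>\<^sup>+s. ennreal ((2 - 2 * cos (b * s)) * (2 * c * exp (- c * s))) * indicator {0..} s \<partial>lborel) = ennreal (0 - ?F 0)"
  proof (rule nn_integral_FTC_atLeast[OF _ _ _ lim])
    show "(\<lambda>s. (2 - 2 * cos (b * s)) * (2 * c * exp (- c * s))) \<in> borel_measurable borel" by measurable
    show "0 \<le> (2 - 2 * cos (b * s)) * (2 * c * exp (- c * s))" for s using c by (intro mult_nonneg_nonneg) auto
    show "(?F has_real_derivative (2 - 2 * cos (b * s)) * (2 * c * exp (- c * s))) (at s)" for s
    proof -
      have "(?F has_real_derivative - c * exp (- c * s) * (- 4 + K * (c * cos (b * s) - b * sin (b * s)))
         + exp (- c * s) * (K * (- (c * b * sin (b * s)) - b * b * cos (b * s)))) (at s)"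
        by (auto intro!: derivative_eq_intros simp: algebra_simps)
      moreover have "- c * exp (- c * s) * (- 4 + K * (c * cos (b * s) - b * sin (b * s)))
         + exp (- c * s) * (K * (- (c * b * sin (b * s)) - b * b * cos (b * s)))
         = exp (- c * s) * (4 * c - K * (c\<^sup>2 + b\<^sup>2) * cos (b * s))"
        by (simp add: power2_eq_square algebra_simps)
      moreover have "exp (- c * s) * (4 * c - K * (c\<^sup>2 + b\<^sup>2) * cos (b * s)) = (2 - 2 * cos (b * s)) * (2 * c * exp (- c * s))"
        unfolding K(2) by (simp add: algebra_simps)
      ultimately show ?thesis by (simp only:)
    qed
  qed
  also have "0 - ?F 0 = 4 * b\<^sup>2 / (c\<^sup>2 + b\<^sup>2)"
  proof -
    define D where "D = c\<^sup>2 + b\<^sup>2"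
    have "D \<noteq> 0" using cb unfolding D_def by (rule less_imp_neq[symmetric])
    then have "4 - 4 * c / D * c = 4 * (D - c\<^sup>2) / D"
      by (simp add: field_simps power2_eq_square)
    then show ?thesis by (simp add: K_def D_def)
  qed
  finally show ?thesis .
qed

text \<open>With \<open>q = exp (- 2 s)\<close> one has
  \<open>1 / sinh\<^sup>2 s = 4 q / (1 - q)\<^sup>2\<close>, four times \<open>q\<close> times the
  differentiated geometric series.\<close>

lemma inverse_sinh_square_sums:
  fixes s :: real
  assumes s: "0 < s"
  shows "(\<lambda>k. 2 * (2 * real (Suc k)) * exp (- (2 * real (Suc k)) * s)) sums (1 / (sinh s)\<^sup>2)"
proof -
  define q where "q = exp (- 2 * s)"
  have q: "0 < q" "q < 1" using s by (auto simp: q_def)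
  have "(\<lambda>k. 4 * q * (real (Suc k) * q ^ k)) sums (4 * q * (1 / (1 - q)\<^sup>2))"
    using q by (intro sums_mult geometric_deriv_sums) auto
  moreover have "4 * q * (real (Suc k) * q ^ k) = 2 * (2 * real (Suc k)) * exp (- (2 * real (Suc k)) * s)" for k
  proof -
    have "q * q ^ k = exp (- (2 * real (Suc k)) * s)"
      using exp_of_nat_mult[of "Suc k" "- 2 * s"] by (simp add: q_def algebra_simps)
    then show ?thesis by (metis (no_types, opaque_lifting) mult.assoc mult.left_commute mult_2 numeral_Bit0_eq_double)
  qed
  moreover have "4 * q * (1 / (1 - q)\<^sup>2) = 1 / (sinh s)\<^sup>2"
  proof -
    have qe: "q = exp (- s) * exp (- s)" unfolding q_def by (simp flip: exp_add)
    have "exp s * exp (- s) = (1::real)" by (simp flip: exp_add)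
    then have "1 - q = 2 * sinh s * exp (- s)"
      by (simp add: qe sinh_field_def algebra_simps)
    then have "(1 - q)\<^sup>2 = 4 * (sinh s)\<^sup>2 * q"
      using qe by (simp add: power_mult_distrib power2_eq_square)
    then show ?thesis using q by simp
  qed
  ultimately show ?thesis by (simp only:)
qed

lemma nn_integral_even:
  fixes f :: "real \<Rightarrow> ennreal"
  assumes [measurable]: "f \<in> borel_measurable borel" and even: "\<And>s. f (- s) = f s"
  shows "(\<integral>\<^sup>+s. f s \<partial>lborel) = 2 * (\<integral>\<^sup>+s. f s * indicator {0..} s \<partial>lborel)"
proof -
  have "(\<integral>\<^sup>+s. f s \<partial>lborel) = (\<integral>\<^sup>+s. f s * indicator {0..} s + f s * indicator {..<0} s \<partial>lborel)"
    by (intro nn_integral_cong) (auto simp: indicator_def)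
  also have "\<dots> = (\<integral>\<^sup>+s. f s * indicator {0..} s \<partial>lborel) + (\<integral>\<^sup>+s. f s * indicator {..<0} s \<partial>lborel)"
    by (rule nn_integral_add) measurable
  also have "(\<integral>\<^sup>+s. f s * indicator {..<0} s \<partial>lborel) = (\<integral>\<^sup>+s. f s * indicator {..<0} (- s) \<partial>lborel)"
    using nn_integral_real_affine[of "\<lambda>s. f s * indicator {..<0} s" "- 1" 0] by (simp add: even)
  also have "\<dots> = (\<integral>\<^sup>+s. f s * indicator {0..} s \<partial>lborel)"
    by (rule nn_integral_cong_AE, use AE_lborel_singleton[of "0::real"] in eventually_elim) (auto simp: indicator_def)
  finally show ?thesis by (simp add: mult_2)
qed

text \<open>On the half-line the exponential expansion of \<open>1 / sinh\<^sup>2\<close> has the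
  rates \<open>2 (k + 1)\<close>. Each term integrates to one partial fraction of the hyperbolic
  cotangent at \<open>x = \<bar>\<tau>\<bar> / 2\<close>, and all terms are nonnegative.\<close>

lemma nn_integral_sinh_kernel:
  "(\<integral>\<^sup>+s. ennreal ((norm (exp (\<i> * of_real (\<tau> * s)) - 1))\<^sup>2 / (sinh s)\<^sup>2) \<partial>lborel) = ennreal (2 * pi * T_symbol \<tau>)"
proof (cases "\<tau> = 0")
  case True
  then show ?thesis by (simp add: T_symbol_def)
next
  case False
  define x where "x = \<bar>\<tau>\<bar> / 2"
  have x: "0 < x" using False by (simp add: x_def)
  let ?h = "\<lambda>k s. (2 - 2 * cos (\<tau> * s)) * (2 * (2 * real (Suc k)) * exp (- (2 * real (Suc k)) * s))"
  have "(\<integral>\<^sup>+s. ennreal ((2 - 2 * cos (\<tau> * s)) / (sinh s)\<^sup>2) * indicator {0..} s \<partial>lborel)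
     = (\<integral>\<^sup>+s. (\<Sum>k. ennreal (?h k s) * indicator {0..} s) \<partial>lborel)"
  proof (rule nn_integral_cong_AE, use AE_lborel_singleton[of "0::real"] in eventually_elim)
    case (elim s)
    show ?case
    proof (cases "0 < s")
      case True
      have "(\<lambda>k. ?h k s) sums ((2 - 2 * cos (\<tau> * s)) * (1 / (sinh s)\<^sup>2))"
        by (intro sums_mult inverse_sinh_square_sums True)
      then have "(\<Sum>k. ennreal (?h k s)) = ennreal ((2 - 2 * cos (\<tau> * s)) * (1 / (sinh s)\<^sup>2))"
        by (intro suminf_ennreal_eq) auto
      then show ?thesis using True by simp
    qed (use elim in simp)
  qed
  also have "\<dots> = (\<Sum>k. \<integral>\<^sup>+s. ennreal (?h k s) * indicator {0..} s \<partial>lborel)"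
    by (rule nn_integral_suminf) measurable
  also have "\<dots> = (\<Sum>k. ennreal (4 * \<tau>\<^sup>2 / ((2 * real (Suc k))\<^sup>2 + \<tau>\<^sup>2)))"
    by (intro suminf_cong nn_integral_damped_cos) simp
  also have "\<dots> = (\<Sum>k. ennreal (2 * x * (2 * x / ((real (Suc k))\<^sup>2 + x\<^sup>2))))"
  proof (intro suminf_cong arg_cong[where f = ennreal])
    fix k
    have "\<tau>\<^sup>2 = 4 * x\<^sup>2" by (simp add: x_def power_divide)
    then have "4 * \<tau>\<^sup>2 / ((2 * real (Suc k))\<^sup>2 + \<tau>\<^sup>2) = (4 * (4 * x\<^sup>2)) / (4 * ((real (Suc k))\<^sup>2 + x\<^sup>2))"
      by (simp only: power_mult_distrib distrib_left) simp
    then show "4 * \<tau>\<^sup>2 / ((2 * real (Suc k))\<^sup>2 + \<tau>\<^sup>2) = 2 * x * (2 * x / ((real (Suc k))\<^sup>2 + x\<^sup>2))"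
      by (simp only: mult_divide_mult_cancel_left_if) (simp add: power2_eq_square)
  qed
  also have "\<dots> = ennreal (2 * x * (pi * coth (pi * x) - 1 / x))"
    using x by (intro suminf_ennreal_eq sums_mult coth_partial_fractions) auto
  finally have half: "(\<integral>\<^sup>+s. ennreal ((2 - 2 * cos (\<tau> * s)) / (sinh s)\<^sup>2) * indicator {0..} s \<partial>lborel) = \<dots>" .
  have "(\<integral>\<^sup>+s. ennreal ((2 - 2 * cos (\<tau> * s)) / (sinh s)\<^sup>2) \<partial>lborel) = 2 * ennreal (2 * x * (pi * coth (pi * x) - 1 / x))"
    unfolding half[symmetric] by (rule nn_integral_even) auto
  also have "\<dots> = ennreal (2 * (2 * x * (pi * coth (pi * x) - 1 / x)))"
    using ennreal_mult'[of 2 "2 * x * (pi * coth (pi * x) - 1 / x)"] by simp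
  also have "\<dots> = ennreal (2 * pi * T_symbol \<tau>)" unfolding T_symbol_eq[OF False] x_def ..
  finally show ?thesis unfolding norm_exp_minus_one_square .
qed

text \<open>General values admit both a complex function and its real modulus. The diagonal, where
  the quotient is zero by convention, is a null set.\<close>

definition sinh_energy :: "(real \<Rightarrow> 'a :: real_normed_vector) \<Rightarrow> ennreal" where
  "sinh_energy f = (\<integral>\<^sup>+t. \<integral>\<^sup>+s. ennreal ((norm (f s - f t))\<^sup>2 / (sinh (s - t))\<^sup>2) \<partial>lborel \<partial>lborel)"

text \<open>Tonelli's theorem exchanges the frequency with the shift \<open>s\<close>: the symbol is
  opened up as an integral over \<open>s\<close>, and for each \<open>s\<close> the hypothesis
  \<open>diff\<close> returns to the line. The identity also holds with infinite values.\<close>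

lemma T_symbol_integral_eq_sinh_energy:
  fixes f g :: "real \<Rightarrow> complex"
  assumes [measurable]: "f \<in> borel_measurable borel" "g \<in> borel_measurable borel"
    and diff: "\<And>s. (\<integral>\<^sup>+\<tau>. ennreal ((norm (exp (\<i> * of_real (\<tau> * s)) - 1))\<^sup>2 * (norm (g \<tau>))\<^sup>2) \<partial>lborel)
     = (\<integral>\<^sup>+t. ennreal ((norm (f (t + s) - f t))\<^sup>2) \<partial>lborel)"
  shows "ennreal (2 * pi) * (\<integral>\<^sup>+\<tau>. ennreal (T_symbol \<tau> * (norm (g \<tau>))\<^sup>2) \<partial>lborel) = sinh_energy f"
proof -
  let ?e = "\<lambda>\<tau> s. (norm (exp (\<i> * of_real (\<tau> * s)) - 1))\<^sup>2"
  have "ennreal (2 * pi) * (\<integral>\<^sup>+\<tau>. ennreal (T_symbol \<tau> * (norm (g \<tau>))\<^sup>2) \<partial>lborel)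
    = (\<integral>\<^sup>+\<tau>. ennreal (2 * pi * T_symbol \<tau>) * ennreal ((norm (g \<tau>))\<^sup>2) \<partial>lborel)"
    by (subst nn_integral_cmult[symmetric]) (auto simp: T_symbol_nonneg mult.assoc simp flip: ennreal_mult)
  also have "\<dots> = (\<integral>\<^sup>+\<tau>. \<integral>\<^sup>+s. ennreal (?e \<tau> s / (sinh s)\<^sup>2) * ennreal ((norm (g \<tau>))\<^sup>2) \<partial>lborel \<partial>lborel)"
    unfolding nn_integral_sinh_kernel[symmetric] by (intro nn_integral_cong nn_integral_multc[symmetric]) measurable
  also have "\<dots> = (\<integral>\<^sup>+s. \<integral>\<^sup>+\<tau>. ennreal (?e \<tau> s / (sinh s)\<^sup>2) * ennreal ((norm (g \<tau>))\<^sup>2) \<partial>lborel \<partial>lborel)"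
    by (rule lborel_pair.Fubini'[symmetric]) measurable
  also have "\<dots> = (\<integral>\<^sup>+s. ennreal (1 / (sinh s)\<^sup>2) * (\<integral>\<^sup>+t. ennreal ((norm (f (t + s) - f t))\<^sup>2) \<partial>lborel) \<partial>lborel)"
    unfolding diff[symmetric]
    by (intro nn_integral_cong, subst nn_integral_cmult[symmetric]) (auto simp: mult_ac simp flip: ennreal_mult)
  also have "\<dots> = (\<integral>\<^sup>+s. \<integral>\<^sup>+t. ennreal ((norm (f (t + s) - f t))\<^sup>2 / (sinh s)\<^sup>2) \<partial>lborel \<partial>lborel)"
    by (intro nn_integral_cong, subst nn_integral_cmult[symmetric]) (auto simp: mult_ac simp flip: ennreal_mult)
  also have "\<dots> = (\<integral>\<^sup>+t. \<integral>\<^sup>+s. ennreal ((norm (f (t + s) - f t))\<^sup>2 / (sinh s)\<^sup>2) \<partial>lborel \<partial>lborel)"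
    by (rule lborel_pair.Fubini') measurable
  also have "\<dots> = sinh_energy f"
    unfolding sinh_energy_def
  proof (rule nn_integral_cong)
    fix t
    show "(\<integral>\<^sup>+s. ennreal ((norm (f (t + s) - f t))\<^sup>2 / (sinh s)\<^sup>2) \<partial>lborel) = (\<integral>\<^sup>+s. ennreal ((norm (f s - f t))\<^sup>2 / (sinh (s - t))\<^sup>2) \<partial>lborel)"
      using nn_integral_lborel_translate[of "\<lambda>s. ennreal ((norm (f s - f t))\<^sup>2 / (sinh (s - t))\<^sup>2)" t]
      by (simp add: add.commute)
  qed
  finally show ?thesis .
qed

section \<open>The angular variable\<close>

definition log_tan :: "real \<Rightarrow> real" where
  "log_tan \<theta> = ln (tan (\<theta> / 2))"

lemma borel_measurable_log_tan [measurable]: "log_tan \<in> borel_measurable borel"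
  unfolding log_tan_def[abs_def] tan_def by measurable

lemma half_angle_pos:
  assumes "0 < \<theta>" "\<theta> < pi"
  shows "0 < sin (\<theta> / 2)" "0 < cos (\<theta> / 2)" "0 < tan (\<theta> / 2)"
    "sin \<theta> = 2 * sin (\<theta> / 2) * cos (\<theta> / 2)" "cos \<theta> = (cos (\<theta> / 2))\<^sup>2 - (sin (\<theta> / 2))\<^sup>2"
  using assms sin_double[of "\<theta> / 2"] cos_double[of "\<theta> / 2"]
    sin_gt_zero[of "\<theta> / 2"] cos_gt_zero_pi[of "\<theta> / 2"] tan_gt_zero[of "\<theta> / 2"] by simp_all

lemma cosh_sinh_log_tan:
  assumes "0 < \<theta>" "\<theta> < pi"
  shows "cosh (log_tan \<theta>) = 1 / sin \<theta>" "sinh (log_tan \<theta>) = - cos \<theta> / sin \<theta>"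
proof -
  note h = half_angle_pos[OF assms]
  define S C where "S = sin (\<theta> / 2)" and "C = cos (\<theta> / 2)"
  have SC: "0 < S" "0 < C" "S\<^sup>2 + C\<^sup>2 = 1" using h by (auto simp: S_def C_def)
  have e: "exp (log_tan \<theta>) = S / C" "exp (- log_tan \<theta>) = C / S"
    using h(3) by (simp_all add: log_tan_def exp_minus tan_def S_def C_def)
  show "cosh (log_tan \<theta>) = 1 / sin \<theta>"
    unfolding cosh_field_def e h(4) S_def[symmetric] C_def[symmetric] SC(3)[symmetric]
    using SC(1,2) by (simp add: field_simps power2_eq_square)
  show "sinh (log_tan \<theta>) = - cos \<theta> / sin \<theta>"
    unfolding sinh_field_def e h(4,5) S_def[symmetric] C_def[symmetric]
    using SC(1,2) by (simp add: field_simps power2_eq_square)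
qed

lemma DERIV_log_tan:
  assumes "0 < \<theta>" "\<theta> < pi"
  shows "(log_tan has_real_derivative 1 / sin \<theta>) (at \<theta>)"
proof -
  note h = half_angle_pos[OF assms]
  have "((\<lambda>\<theta>. tan (\<theta> / 2)) has_real_derivative inverse ((cos (\<theta> / 2))\<^sup>2) * (1 / 2)) (at \<theta>)"
    by (rule DERIV_chain'[where f = "\<lambda>\<theta>. \<theta> / 2", OF _ DERIV_tan]) (use h in \<open>auto intro!: derivative_eq_intros\<close>)
  then have "((\<lambda>\<theta>. ln (tan (\<theta> / 2))) has_real_derivative inverse (tan (\<theta> / 2)) * (inverse ((cos (\<theta> / 2))\<^sup>2) * (1 / 2))) (at \<theta>)"
    by (intro DERIV_chain'[where g = ln] DERIV_ln) (use h in auto)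
  moreover have "inverse (tan (\<theta> / 2)) * (inverse ((cos (\<theta> / 2))\<^sup>2) * (1 / 2)) = 1 / sin \<theta>"
    using h by (simp add: tan_def field_simps power2_eq_square)
  ultimately show ?thesis unfolding log_tan_def[abs_def] by (simp only:)
qed

lemma log_tan_arctan: "log_tan (2 * arctan (exp t)) = t"
  by (simp add: log_tan_def tan_arctan)

lemma log_tan_less_iff:
  assumes "0 < a" "a < pi" "0 < b" "b < pi"
  shows "log_tan a < log_tan b \<longleftrightarrow> a < b"
proof -
  have "log_tan a < log_tan b \<longleftrightarrow> tan (a / 2) < tan (b / 2)"
    using half_angle_pos(3) assms by (simp add: log_tan_def)
  also have "\<dots> \<longleftrightarrow> a / 2 < b / 2" using assms by (intro tan_mono_lt_eq) auto
  finally show ?thesis by simp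
qed

text \<open>Put as an identity of measures, the substitution serves integrals and almost-everywhere
  statements alike. It is checked on intervals, where the derivative \<open>1 / sin \<theta>\<close>
  integrates back to the length; values of \<open>log_tan\<close> outside \<open>(0, pi)\<close>
  have no mass.\<close>

lemma lborel_eq_distr_log_tan:
  "lborel = distr (density angle (\<lambda>\<theta>. ennreal (1 / sin \<theta>))) borel log_tan"
proof (rule lborel_eqI)
  fix l u :: real assume "\<And>b. b \<in> Basis \<Longrightarrow> l \<bullet> b \<le> u \<bullet> b"
  then have lu: "l \<le> u" by simp
  \<comment> \<open>The preimages of \<open>l\<close> and \<open>u\<close> in
    \<open>(0, pi)\<close>, from \<open>tan (\<theta> / 2) = exp t\<close>.\<close>
  define A B where "A = 2 * arctan (exp l)" and "B = 2 * arctan (exp u)"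
  have AB: "0 < A" "A < pi" "0 < B" "B < pi" "log_tan A = l" "log_tan B = u"
    using arctan_ubound[of "exp l"] arctan_ubound[of "exp u"]
    by (auto simp: A_def B_def log_tan_arctan arctan_less_zero_iff zero_less_arctan_iff)
  have "A \<le> B" using lu by (simp add: A_def B_def arctan_le_iff)
  have [measurable]: "log_tan -` {l<..<u} \<in> sets borel"
    by (rule measurable_sets_borel) measurable
  have "emeasure (distr (density angle (\<lambda>\<theta>. ennreal (1 / sin \<theta>))) borel log_tan) (box l u)
     = (\<integral>\<^sup>+\<theta>. ennreal (1 / sin \<theta>) * indicator (log_tan -` {l<..<u}) \<theta> \<partial>angle)"
    by (subst emeasure_distr) (auto simp: box_real emeasure_density)
  also have "\<dots> = (\<integral>\<^sup>+\<theta>. indicator {0<..<pi} \<theta> * (ennreal (1 / sin \<theta>) * indicator (log_tan -` {l<..<u}) \<theta>) \<partial>lborel)"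
    by (rule nn_integral_angle) measurable
  also have "\<dots> = (\<integral>\<^sup>+\<theta>. ennreal (1 / sin \<theta>) * indicator {A..B} \<theta> \<partial>lborel)"
  proof (rule nn_integral_cong_AE, use AE_lborel_singleton[of A] AE_lborel_singleton[of B] in eventually_elim)
    case (elim \<theta>)
    show ?case
    proof (cases "0 < \<theta> \<and> \<theta> < pi")
      case True
      then have "\<theta> \<in> log_tan -` {l<..<u} \<longleftrightarrow> A < \<theta> \<and> \<theta> < B"
        using log_tan_less_iff[of A \<theta>] log_tan_less_iff[of \<theta> B] AB by auto
      then show ?thesis using True elim by (auto simp: indicator_def)
    next
      case False
      then show ?thesis using AB by (auto simp: indicator_def)
    qed
  qed
  also have "\<dots> = ennreal (log_tan B - log_tan A)"
  proof (rule nn_integral_FTC_Icc)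
    fix \<theta> assume "\<theta> \<in> {A..B}"
    then have "0 < \<theta>" "\<theta> < pi" using AB by auto
    then show "(log_tan has_real_derivative 1 / sin \<theta>) (at \<theta>)" "0 \<le> 1 / sin \<theta>"
      by (rule DERIV_log_tan) (simp add: less_imp_le[OF sin_gt_zero] \<open>0 < \<theta>\<close> \<open>\<theta> < pi\<close>)
  qed (use \<open>A \<le> B\<close> in auto)
  finally show "emeasure (distr (density angle (\<lambda>\<theta>. ennreal (1 / sin \<theta>))) borel log_tan) (box l u) = (\<Prod>b\<in>Basis. (u - l) \<bullet> b)"
    using AB lu by simp
qed simp

lemma nn_integral_log_tan:
  assumes [measurable]: "h \<in> borel_measurable borel"
  shows "(\<integral>\<^sup>+t. h t \<partial>lborel) = (\<integral>\<^sup>+\<theta>. ennreal (1 / sin \<theta>) * h (log_tan \<theta>) \<partial>angle)"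
  by (subst lborel_eq_distr_log_tan) (simp add: nn_integral_distr nn_integral_density)

lemma AE_log_tan:
  assumes [measurable]: "Measurable.pred borel P" and P: "AE \<theta> in angle. P (log_tan \<theta>)"
  shows "AE t in lborel. P t"
proof -
  have "AE \<theta> in density angle (\<lambda>\<theta>. ennreal (1 / sin \<theta>)). P (log_tan \<theta>)"
    using P by (subst AE_density) (auto elim: eventually_mono)
  then show ?thesis by (subst lborel_eq_distr_log_tan, subst AE_distr_iff) auto
qed

lemma nn_integral_inverse_sin_square:
  assumes a: "0 < a" "a < pi"
  shows "(\<integral>\<^sup>+b. ennreal (1 / (4 * (sin ((a + b) / 2))\<^sup>2)) \<partial>angle) = ennreal (1 / sin a)"
proof -
  \<comment> \<open>Minus half the cotangent of \<open>(a + b) / 2\<close>. At the two ends it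
    yields half of \<open>tan (a / 2) + cot (a / 2)\<close>, which is
    \<open>1 / sin a\<close>.\<close>
  let ?F = "\<lambda>b. - (1 / 2) * (cos ((a + b) / 2) / sin ((a + b) / 2))"
  have "(\<integral>\<^sup>+b. ennreal (1 / (4 * (sin ((a + b) / 2))\<^sup>2)) \<partial>angle)
    = (\<integral>\<^sup>+b. indicator {0<..<pi} b * ennreal (1 / (4 * (sin ((a + b) / 2))\<^sup>2)) \<partial>lborel)"
    by (rule nn_integral_angle) measurable
  also have "\<dots> = (\<integral>\<^sup>+b. ennreal (1 / (4 * (sin ((a + b) / 2))\<^sup>2)) * indicator {0..pi} b \<partial>lborel)"
    by (rule nn_integral_cong_AE, use AE_lborel_singleton[of "0::real"] AE_lborel_singleton[of pi] in eventually_elim)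
       (auto simp: indicator_def)
  also have "\<dots> = ennreal (?F pi - ?F 0)"
  proof (rule nn_integral_FTC_Icc)
    fix b assume "b \<in> {0..pi}"
    then have b: "0 \<le> b" "b \<le> pi" by auto
    have s: "0 < sin ((a + b) / 2)" using a b by (intro sin_gt_zero) auto
    define x where "x = (a + b) / 2"
    have "((\<lambda>b. cos ((a + b) / 2)) has_real_derivative - sin x * (1 / 2)) (at b)"
      "((\<lambda>b. sin ((a + b) / 2)) has_real_derivative cos x * (1 / 2)) (at b)"
      unfolding x_def by (auto intro!: derivative_eq_intros)
    from DERIV_cmult[OF DERIV_divide[OF this], of "- (1 / 2)"]
    have "(?F has_real_derivative - (1 / 2) * ((- sin x * (1 / 2) * sin x - cos x * (cos x * (1 / 2))) / (sin x * sin x))) (at b)"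
      using s by (simp add: x_def)
    moreover have "- sin x * (1 / 2) * sin x - cos x * (cos x * (1 / 2)) = - (1 / 2)"
      using sin_cos_squared_add[of x] by (simp add: power2_eq_square field_simps)
    ultimately have "(?F has_real_derivative 1 / (4 * (sin x)\<^sup>2)) (at b)"
      by (simp add: power2_eq_square)
    then show "(?F has_real_derivative 1 / (4 * (sin ((a + b) / 2))\<^sup>2)) (at b)"
      unfolding x_def .
  qed auto
  also have "?F pi - ?F 0 = 1 / sin a"
  proof -
    note h = half_angle_pos[OF a]
    have pi2: "(a + pi) / 2 = a / 2 + pi / 2" by (simp add: field_simps)
    have "cos ((a + pi) / 2) = - sin (a / 2)" "sin ((a + pi) / 2) = cos (a / 2)"
      unfolding pi2 cos_add sin_add by simp_all
    then have "?F pi - ?F 0 = 1 / 2 * (sin (a / 2) / cos (a / 2) + cos (a / 2) / sin (a / 2))" by simp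
    also have "\<dots> = ((sin (a / 2))\<^sup>2 + (cos (a / 2))\<^sup>2) / (2 * sin (a / 2) * cos (a / 2))"
      using h by (simp add: field_simps power2_eq_square)
    also have "\<dots> = 1 / sin a" unfolding h(4) by simp
    finally show ?thesis .
  qed
  finally show ?thesis .
qed

text \<open>
  The left-hand side is, up to a factor, the Douglas integral of the odd extension to the circle.
  The image charge at \<open>- b\<close> contributes the \<open>L\<^sup>2\<close> term, as its kernel integrates to \<open>1 / sin a\<close>.
\<close>

lemma angular_energy_eq_sinh_energy:
  fixes p :: "real \<Rightarrow> real"
  assumes [measurable]: "p \<in> borel_measurable borel"
  shows "angular_energy (\<lambda>\<theta>. p (log_tan \<theta>)) = sinh_energy p + 4 * (\<integral>\<^sup>+t. ennreal ((p t)\<^sup>2) \<partial>lborel)"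
proof -
  define f where "f = (\<lambda>\<theta>. p (log_tan \<theta>))"
  have [measurable]: "f \<in> borel_measurable borel" unfolding f_def by measurable
  let ?r = "\<lambda>a b. 1 / (4 * (sin ((a + b) / 2))\<^sup>2)"
  let ?k = "\<lambda>a b. (f a - f b)\<^sup>2 * (sin a * sin b / (cos a - cos b)\<^sup>2)"
  \<comment> \<open>Off the diagonal \<open>sin a sin b / (cos a - cos b)\<^sup>2\<close> is the
    direct kernel minus the image kernel. Rewriting \<open>(f a + f b)\<^sup>2\<close> as
    \<open>2 (f a)\<^sup>2 + 2 (f b)\<^sup>2 - (f a - f b)\<^sup>2\<close> collects both in front of
    the squared difference.\<close>
  have key: "(f a - f b)\<^sup>2 / (4 * (sin ((a - b) / 2))\<^sup>2) + (f a + f b)\<^sup>2 / (4 * (sin ((a + b) / 2))\<^sup>2)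
     = ?k a b + 2 * (f a)\<^sup>2 * ?r a b + 2 * (f b)\<^sup>2 * ?r a b"
    if a: "0 < a" "a < pi" and b: "0 < b" "b < pi" for a b
  proof (cases "a = b")
    case True
    then show ?thesis by (simp add: power2_eq_square)
  next
    case False
    define P R where "P = sin ((a - b) / 2)" and "R = sin ((a + b) / 2)"
    have P: "P \<noteq> 0" using False a b sin_eq_0_pi[of "(a - b) / 2"] by (auto simp: P_def)
    have R: "R \<noteq> 0" using a b sin_gt_zero[of "(a + b) / 2"] by (auto simp: R_def)
    have c: "cos a - cos b = - 2 * R * P"
    proof -
      have "(b - a) / 2 = - ((a - b) / 2)" by (simp add: field_simps)
      then have "sin ((b - a) / 2) = - P" unfolding P_def by (simp only: sin_minus)
      then show ?thesis using cos_diff_cos[of a b] by (simp add: R_def)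
    qed
    have s: "sin a * sin b = R\<^sup>2 - P\<^sup>2"
    proof -
      have "(a + b) / 2 + (a - b) / 2 = a" "(a + b) / 2 - (a - b) / 2 = b" by (simp_all add: field_simps)
      then have "sin a * sin b = sin ((a + b) / 2 + (a - b) / 2) * sin ((a + b) / 2 - (a - b) / 2)" by (simp only:)
      also have "\<dots> = (sin ((a + b) / 2))\<^sup>2 * (cos ((a - b) / 2))\<^sup>2 - (cos ((a + b) / 2))\<^sup>2 * (sin ((a - b) / 2))\<^sup>2"
        by (simp add: sin_add sin_diff power2_eq_square algebra_simps)
      also have "\<dots> = R\<^sup>2 - P\<^sup>2"
        unfolding P_def R_def cos_squared_eq by (simp add: algebra_simps)
      finally show ?thesis .
    qed
    have "(R\<^sup>2 - P\<^sup>2) / (- 2 * R * P)\<^sup>2 = 1 / (4 * P\<^sup>2) - 1 / (4 * R\<^sup>2)"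
      using P R by (simp add: field_simps power2_eq_square)
    then have k: "?k a b = (f a - f b)\<^sup>2 * (1 / (4 * P\<^sup>2)) - (f a - f b)\<^sup>2 * (1 / (4 * R\<^sup>2))"
      unfolding c s by (simp only: right_diff_distrib)
    have "(f a + f b)\<^sup>2 = 2 * (f a)\<^sup>2 + 2 * (f b)\<^sup>2 - (f a - f b)\<^sup>2"
      by (simp add: power2_eq_square algebra_simps)
    then have "(f a + f b)\<^sup>2 * (1 / (4 * R\<^sup>2)) = 2 * (f a)\<^sup>2 * (1 / (4 * R\<^sup>2)) + 2 * (f b)\<^sup>2 * (1 / (4 * R\<^sup>2)) - (f a - f b)\<^sup>2 * (1 / (4 * R\<^sup>2))"
      by (simp only: left_diff_distrib distrib_right)
    then show ?thesis unfolding k unfolding P_def[symmetric] R_def[symmetric] by simp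
  qed
  have k0: "0 \<le> ?k a b" if "0 < a" "a < pi" "0 < b" "b < pi" for a b
    using that by (intro mult_nonneg_nonneg divide_nonneg_nonneg) (auto intro: less_imp_le[OF sin_gt_zero])
  have E1: "(\<integral>\<^sup>+a. \<integral>\<^sup>+b. ennreal (?k a b) \<partial>angle \<partial>angle) = sinh_energy p"
  proof -
    let ?h = "\<lambda>t s. ennreal ((norm (p s - p t))\<^sup>2 / (sinh (s - t))\<^sup>2)"
    have "sinh_energy p = (\<integral>\<^sup>+t. (\<integral>\<^sup>+b. ennreal (1 / sin b) * ?h t (log_tan b) \<partial>angle) \<partial>lborel)"
      unfolding sinh_energy_def by (intro nn_integral_cong nn_integral_log_tan) measurable
    also have "\<dots> = (\<integral>\<^sup>+a. ennreal (1 / sin a) * (\<integral>\<^sup>+b. ennreal (1 / sin b) * ?h (log_tan a) (log_tan b) \<partial>angle) \<partial>angle)"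
      by (rule nn_integral_log_tan) measurable
    also have "\<dots> = (\<integral>\<^sup>+a. \<integral>\<^sup>+b. ennreal (1 / sin a) * (ennreal (1 / sin b) * ?h (log_tan a) (log_tan b)) \<partial>angle \<partial>angle)"
      by (intro nn_integral_cong nn_integral_cmult[symmetric]) measurable
    also have "\<dots> = (\<integral>\<^sup>+a. \<integral>\<^sup>+b. ennreal (?k a b) \<partial>angle \<partial>angle)"
    proof (rule nn_integral_cong_AE, use AE_angle in eventually_elim, rule nn_integral_cong_AE, use AE_angle in eventually_elim)
      fix a b :: real assume a: "0 < a \<and> a < pi" and b: "0 < b \<and> b < pi"
      have sa: "0 < sin a" and sb: "0 < sin b" using a b by (auto intro: sin_gt_zero)
      \<comment> \<open>The two Jacobians \<open>1 / sin a\<close> and \<open>1 / sin b\<close>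
        together with this quotient produce the kernel in \<open>?k\<close>.\<close>
      have "sinh (log_tan b - log_tan a) = (cos a - cos b) / (sin a * sin b)"
        unfolding sinh_diff using cosh_sinh_log_tan[of a] cosh_sinh_log_tan[of b] a b sa sb
        by (simp only: simp_thms) (simp add: field_simps)
      moreover have "(norm (p (log_tan b) - p (log_tan a)))\<^sup>2 = (f a - f b)\<^sup>2"
        by (simp add: f_def power2_commute)
      ultimately have eq: "1 / sin a * (1 / sin b * ((norm (p (log_tan b) - p (log_tan a)))\<^sup>2 / (sinh (log_tan b - log_tan a))\<^sup>2)) = ?k a b"
        using sa sb by (simp add: power_divide) (simp add: power2_eq_square)
      have "ennreal (1 / sin a * (1 / sin b * X)) = ennreal (1 / sin a) * (ennreal (1 / sin b) * ennreal X)" for X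
        using sa sb by (simp only: ennreal_mult' zero_le_divide_1_iff less_imp_le)
      then show "ennreal (1 / sin a) * (ennreal (1 / sin b) * ?h (log_tan a) (log_tan b)) = ennreal (?k a b)"
        unfolding eq[symmetric] by (rule sym)
    qed
    finally show ?thesis ..
  qed
  have E2: "(\<integral>\<^sup>+a. \<integral>\<^sup>+b. ennreal (2 * (f a)\<^sup>2 * ?r a b) \<partial>angle \<partial>angle) = 2 * (\<integral>\<^sup>+t. ennreal ((p t)\<^sup>2) \<partial>lborel)"
  proof -
    have "(\<integral>\<^sup>+a. \<integral>\<^sup>+b. ennreal (2 * (f a)\<^sup>2 * ?r a b) \<partial>angle \<partial>angle) = (\<integral>\<^sup>+a. 2 * (ennreal (1 / sin a) * ennreal ((f a)\<^sup>2)) \<partial>angle)"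
    proof (rule nn_integral_cong_AE, use AE_angle in eventually_elim)
      fix a :: real assume a: "0 < a \<and> a < pi"
      have "(\<integral>\<^sup>+b. ennreal (2 * (f a)\<^sup>2 * ?r a b) \<partial>angle) = ennreal (2 * (f a)\<^sup>2) * (\<integral>\<^sup>+b. ennreal (?r a b) \<partial>angle)"
        by (subst nn_integral_cmult[symmetric]) (measurable, simp only: ennreal_mult' zero_le_mult_iff zero_le_power2 zero_le_numeral simp_thms)
      also have "\<dots> = 2 * ennreal ((f a)\<^sup>2) * ennreal (1 / sin a)"
        using a ennreal_mult'[of 2 "(f a)\<^sup>2"] by (simp only: nn_integral_inverse_sin_square zero_le_numeral ennreal_numeral simp_thms)
      finally show "(\<integral>\<^sup>+b. ennreal (2 * (f a)\<^sup>2 * ?r a b) \<partial>angle) = 2 * (ennreal (1 / sin a) * ennreal ((f a)\<^sup>2))"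
        by (simp only: mult_ac)
    qed
    also have "\<dots> = 2 * (\<integral>\<^sup>+a. ennreal (1 / sin a) * ennreal ((f a)\<^sup>2) \<partial>angle)"
      by (rule nn_integral_cmult) measurable
    also have "(\<integral>\<^sup>+a. ennreal (1 / sin a) * ennreal ((f a)\<^sup>2) \<partial>angle) = (\<integral>\<^sup>+t. ennreal ((p t)\<^sup>2) \<partial>lborel)"
      unfolding f_def by (rule nn_integral_log_tan[symmetric]) measurable
    finally show ?thesis .
  qed
  have "(\<integral>\<^sup>+a. \<integral>\<^sup>+b. ennreal (2 * (f b)\<^sup>2 * ?r a b) \<partial>angle \<partial>angle) = (\<integral>\<^sup>+b. \<integral>\<^sup>+a. ennreal (2 * (f b)\<^sup>2 * ?r a b) \<partial>angle \<partial>angle)"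
    by (rule angle2.Fubini'[symmetric]) measurable
  then have E3: "(\<integral>\<^sup>+a. \<integral>\<^sup>+b. ennreal (2 * (f b)\<^sup>2 * ?r a b) \<partial>angle \<partial>angle) = 2 * (\<integral>\<^sup>+t. ennreal ((p t)\<^sup>2) \<partial>lborel)"
    using E2 by (simp add: add.commute)
  have "angular_energy f = (\<integral>\<^sup>+a. \<integral>\<^sup>+b. (ennreal (?k a b) + ennreal (2 * (f a)\<^sup>2 * ?r a b)) + ennreal (2 * (f b)\<^sup>2 * ?r a b) \<partial>angle \<partial>angle)"
    unfolding angular_energy_def
  proof (rule nn_integral_cong_AE, use AE_angle in eventually_elim, rule nn_integral_cong_AE, use AE_angle in eventually_elim)
    fix a b :: real assume a: "0 < a \<and> a < pi" and b: "0 < b \<and> b < pi"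
    have n: "0 \<le> ?k a b" "0 \<le> 2 * (f a)\<^sup>2 * ?r a b" "0 \<le> 2 * (f b)\<^sup>2 * ?r a b"
      using a b k0[of a b] by auto
    have k: "(f a - f b)\<^sup>2 / (4 * (sin ((a - b) / 2))\<^sup>2) + (f a + f b)\<^sup>2 / (4 * (sin ((a + b) / 2))\<^sup>2)
       = ?k a b + 2 * (f a)\<^sup>2 * ?r a b + 2 * (f b)\<^sup>2 * ?r a b"
      by (rule key) (use a b in auto)
    show "ennreal ((f a - f b)\<^sup>2 / (4 * (sin ((a - b) / 2))\<^sup>2) + (f a + f b)\<^sup>2 / (4 * (sin ((a + b) / 2))\<^sup>2))
       = (ennreal (?k a b) + ennreal (2 * (f a)\<^sup>2 * ?r a b)) + ennreal (2 * (f b)\<^sup>2 * ?r a b)"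
      unfolding k by (simp only: ennreal_plus[OF add_nonneg_nonneg[OF n(1,2)] n(3)] ennreal_plus[OF n(1,2)])
  qed
  also have "\<dots> = (\<integral>\<^sup>+a. (\<integral>\<^sup>+b. ennreal (?k a b) \<partial>angle) + (\<integral>\<^sup>+b. ennreal (2 * (f a)\<^sup>2 * ?r a b) \<partial>angle) + (\<integral>\<^sup>+b. ennreal (2 * (f b)\<^sup>2 * ?r a b) \<partial>angle) \<partial>angle)"
    by (simp add: nn_integral_add)
  also have "\<dots> = sinh_energy p + 2 * (\<integral>\<^sup>+t. ennreal ((p t)\<^sup>2) \<partial>lborel) + 2 * (\<integral>\<^sup>+t. ennreal ((p t)\<^sup>2) \<partial>lborel)"
    by (subst nn_integral_add, measurable, subst nn_integral_add, measurable) (simp only: E1 E2 E3)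
  also have "\<dots> = sinh_energy p + 4 * (\<integral>\<^sup>+t. ennreal ((p t)\<^sup>2) \<partial>lborel)"
    unfolding add.assoc distrib_right[symmetric] by simp
  finally show ?thesis unfolding f_def .
qed

section \<open>Rank one and the extremal functions\<close>

text \<open>The imaginary part of the geometric series
  \<open>exp (\<i> x) / (1 - r exp (\<i> x))\<close>, that is, the generating function of the
  characters times \<open>sin x\<close>.\<close>

lemma geometric_sine_sums:
  fixes r x :: real
  assumes r: "\<bar>r\<bar> < 1"
  shows "(\<lambda>m. r ^ m * sin (real (Suc m) * x)) sums (sin x / (1 - 2 * r * cos x + r\<^sup>2))"
proof -
  define z where "z = complex_of_real r * cis x"
  define D where "D = 1 - 2 * r * cos x + r\<^sup>2"
  have nz: "norm z < 1" using r by (simp add: z_def norm_mult)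
  have sc: "(cos x)\<^sup>2 + (sin x)\<^sup>2 = 1" by simp
  have "(\<lambda>m. cis x * z ^ m) sums (cis x * (1 / (1 - z)))" by (intro sums_mult geometric_sums nz)
  then have "(\<lambda>m. Im (cis x * z ^ m)) sums Im (cis x * (1 / (1 - z)))" by (rule sums_Im)
  moreover have "Im (cis x * z ^ m) = r ^ m * sin (real (Suc m) * x)" for m
  proof -
    have "cis x * z ^ m = complex_of_real (r ^ m) * cis (real (Suc m) * x)"
      by (simp add: z_def power_mult_distrib Complex.DeMoivre cis_mult algebra_simps)
    then show ?thesis by simp
  qed
  moreover have "Im (cis x * (1 / (1 - z))) = sin x / D"
  proof -
    have "cis x * (1 / (1 - z)) = cis x / (1 - z)" by simp
    moreover have re: "Re (1 - z) = 1 - r * cos x" "Im (1 - z) = - (r * sin x)" "Re (cis x) = cos x" "Im (cis x) = sin x"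
      by (simp_all add: z_def)
    moreover have "(1 - r * cos x)\<^sup>2 + (- (r * sin x))\<^sup>2 = D" unfolding D_def using sc by algebra
    ultimately have "Im (cis x * (1 / (1 - z))) = (sin x * (1 - r * cos x) - cos x * (- (r * sin x))) / D"
      by (simp only: Im_divide)
    also have "sin x * (1 - r * cos x) - cos x * (- (r * sin x)) = sin x" by (simp add: algebra_simps)
    finally show ?thesis .
  qed
  ultimately show ?thesis unfolding D_def by (simp only:)
qed

text \<open>The vanishing minors with \<open>z = 1\<close> are a first-order recursion, so the
  coefficients are geometric. Finite energy excludes a ratio of modulus one or more, and the Abel
  means, now summed in closed form, converge to \<open>f\<close> almost everywhere.\<close>

lemma rank_one_sine_series:
  fixes f :: "real \<Rightarrow> real" and w :: real
  assumes f_meas [measurable]: "f \<in> borel_measurable borel"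
    and f_sq: "integrable angle (\<lambda>x. (f x)\<^sup>2)"
    and w: "angular_energy f \<le> ennreal w" "0 \<le> w"
    and rank: "\<And>z k. sine_coeff f 0 * sine_coeff f (z + k) = sine_coeff f k * sine_coeff f z"
  obtains c q where "\<bar>q\<bar> < 1" "AE x in angle. f x = c * (sin x / (1 - 2 * q * cos x + q\<^sup>2))"
proof -
  define \<beta> where "\<beta> = sine_coeff f"
  obtain c q where q: "\<bar>q\<bar> < 1" and \<beta>: "\<And>m. \<beta> m = c * q ^ m"
  proof (cases "\<beta> 0 = 0")
    case True
    \<comment> \<open>The minor with \<open>z = k = m\<close> reduces to
      \<open>(\<beta> m)\<^sup>2\<close> here.\<close>
    have "\<beta> m = 0" for m using rank[of m m] True by (simp add: \<beta>_def)
    then show thesis using that[of 0 0] by simp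
  next
    case False
    define q where "q = \<beta> 1 / \<beta> 0"
    have step: "\<beta> (Suc m) = q * \<beta> m" for m
      using rank[of 1 m] False by (simp add: \<beta>_def q_def field_simps)
    have \<beta>: "\<beta> m = \<beta> 0 * q ^ m" for m by (induction m) (simp_all add: step)
    have "\<bar>q\<bar> < 1"
    \<comment> \<open>Otherwise every coefficient is at least as large as the first in modulus, and
      the weighted sums exceed \<open>w / pi\<^sup>2\<close>.\<close>
    proof (rule ccontr)
      assume "\<not> \<bar>q\<bar> < 1"
      then have q1: "1 \<le> (q ^ m)\<^sup>2" for m
        by (metis abs_ge_zero linorder_not_less one_le_power power2_abs power_abs)
      have b0: "0 < (\<beta> 0)\<^sup>2" using False by simp
      obtain N where N: "w / pi\<^sup>2 / (\<beta> 0)\<^sup>2 < real N" using reals_Archimedean2 by blast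
      have "real N * (\<beta> 0)\<^sup>2 = (\<Sum>m<N. 1 * ((\<beta> 0)\<^sup>2 * 1))" by simp
      also have "\<dots> \<le> (\<Sum>m<N. real (m + 1) * ((\<beta> 0)\<^sup>2 * (q ^ m)\<^sup>2))"
        using q1 by (intro sum_mono mult_mono mult_left_mono) auto
      also have "\<dots> = (\<Sum>m<N. real (m + 1) * (\<beta> m)\<^sup>2)" 
      proof (intro sum.cong refl)
        fix m show "real (m + 1) * ((\<beta> 0)\<^sup>2 * (q ^ m)\<^sup>2) = real (m + 1) * (\<beta> m)\<^sup>2"
          using \<beta>[of m] by (simp add: power_mult_distrib)
      qed
      also have "\<dots> \<le> w / pi\<^sup>2" unfolding \<beta>_def by (rule weighted_sine_coeff_bessel[OF f_meas f_sq w])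
      finally have "real N * (\<beta> 0)\<^sup>2 \<le> w / pi\<^sup>2" .
      moreover have "w / pi\<^sup>2 < real N * (\<beta> 0)\<^sup>2" using N by (simp only: pos_divide_less_eq[OF b0])
      ultimately show False by linarith
    qed
    then show thesis using \<beta> that by blast
  qed
  obtain \<rho> where \<rho>: "\<And>n. 0 < \<rho> n" "\<And>n. \<rho> n < (1::real)" "\<rho> \<longlonglongrightarrow> 1"
    and lim: "AE x in angle. (\<lambda>n. abel_mean (\<rho> n) f x) \<longlonglongrightarrow> f x"
    by (rule abel_mean_AE_convergent[OF f_meas f_sq w]) (rule that)
  have "f x = c * (sin x / (1 - 2 * q * cos x + q\<^sup>2))" if x: "(\<lambda>n. abel_mean (\<rho> n) f x) \<longlonglongrightarrow> f x" for x
  proof -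
    have "abel_mean (\<rho> n) f x = \<rho> n * c * (sin x / (1 - 2 * (\<rho> n * q) * cos x + (\<rho> n * q)\<^sup>2))" for n
    proof (rule sums_unique2[OF abel_mean_sums[OF f_meas integrable_of_square[OF f_meas f_sq] less_imp_le[OF \<rho>(1)] \<rho>(2)]])
      have "\<bar>\<rho> n * q\<bar> < 1"
        using mult_strict_mono'[of "\<rho> n" 1 "\<bar>q\<bar>" 1] \<rho>(1,2)[of n] q by (simp add: abs_mult)
      from sums_mult[OF geometric_sine_sums[OF this, of x], of "\<rho> n * c"]
      show "(\<lambda>m. \<rho> n ^ Suc m * sine_coeff f m * sin (real (Suc m) * x)) sums (\<rho> n * c * (sin x / (1 - 2 * (\<rho> n * q) * cos x + (\<rho> n * q)\<^sup>2)))"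
        unfolding \<beta>_def[symmetric] \<beta> by (simp add: power_mult_distrib mult_ac)
    qed
    then have abel: "(\<lambda>n. abel_mean (\<rho> n) f x) = (\<lambda>n. \<rho> n * c * (sin x / (1 - 2 * (\<rho> n * q) * cos x + (\<rho> n * q)\<^sup>2)))" by (rule ext)
    have "(1 - \<bar>q\<bar>)\<^sup>2 \<le> 1 - 2 * q * cos x + q\<^sup>2"
    proof -
      have "q * cos x \<le> \<bar>q\<bar> * 1" using abs_ge_self[of "q * cos x"] mult_left_le[of "\<bar>cos x\<bar>" "\<bar>q\<bar>"] by (simp add: abs_mult)
      then show ?thesis by (simp add: power2_diff)
    qed
    moreover have "0 < (1 - \<bar>q\<bar>)\<^sup>2" using q by (intro zero_less_power) simp
    ultimately have "0 < 1 - 2 * q * cos x + q\<^sup>2" by linarith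
    then have "1 - 2 * (1 * q) * cos x + (1 * q)\<^sup>2 \<noteq> 0" by simp
    then have "(\<lambda>n. \<rho> n * c * (sin x / (1 - 2 * (\<rho> n * q) * cos x + (\<rho> n * q)\<^sup>2))) \<longlonglongrightarrow>
       1 * c * (sin x / (1 - 2 * (1 * q) * cos x + (1 * q)\<^sup>2))"
      by (intro tendsto_intros \<rho>(3))
    then show ?thesis using LIMSEQ_unique[OF x] unfolding abel by simp
  qed
  then have "AE x in angle. f x = c * (sin x / (1 - 2 * q * cos x + q\<^sup>2))"
    using lim by (auto elim: eventually_mono)
  with q show thesis by (rule that)
qed

text \<open>The hyperbolic amplitude-phase form: \<open>(1 + q\<^sup>2)\<^sup>2 - (2 q)\<^sup>2 = (1
  - q\<^sup>2)\<^sup>2\<close>, so the two coefficients are \<open>1 - q\<^sup>2\<close> times the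
  \<open>cosh\<close> and minus the \<open>sinh\<close> of one number.\<close>

lemma sech_translate:
  fixes q :: real
  assumes q: "\<bar>q\<bar> < 1"
  obtains \<alpha> where "\<And>t. (1 + q\<^sup>2) * cosh t + 2 * q * sinh t = (1 - q\<^sup>2) * cosh (t - \<alpha>)"
proof
  fix t
  define \<alpha> where "\<alpha> = arsinh (- 2 * q / (1 - q\<^sup>2))"
  have q2: "0 < 1 - q\<^sup>2" using q by (simp add: abs_square_less_1)
  have s: "sinh \<alpha> = - 2 * q / (1 - q\<^sup>2)" by (simp add: \<alpha>_def)
  have "(cosh \<alpha>)\<^sup>2 = ((1 + q\<^sup>2) / (1 - q\<^sup>2))\<^sup>2"
    unfolding cosh_square_eq s using q2 by (simp add: power_divide field_simps) (simp add: power2_eq_square algebra_simps)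
  then have c: "cosh \<alpha> = (1 + q\<^sup>2) / (1 - q\<^sup>2)"
    by (rule power2_eq_imp_eq) (use q2 in auto)
  show "(1 + q\<^sup>2) * cosh t + 2 * q * sinh t = (1 - q\<^sup>2) * cosh (t - arsinh (- 2 * q / (1 - q\<^sup>2)))"
  proof -
    have dd: "D * (x * (N / D) - y * (M / D)) = x * N - y * M" if "D \<noteq> 0" for D N M x y :: real
      using that by (simp add: field_simps)
    have "(1 - q\<^sup>2) * cosh (t - \<alpha>) = cosh t * (1 + q\<^sup>2) - sinh t * (- 2 * q)"
      unfolding cosh_diff s c by (rule dd) (use q2 in simp)
    then show ?thesis unfolding \<alpha>_def by (simp add: algebra_simps)
  qed
qed

section \<open>Equality in the passage to the modulus\<close>

lemma nn_integral_eq_imp_AE_eq: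
  fixes f g :: "'a \<Rightarrow> ennreal"
  assumes [measurable]: "f \<in> borel_measurable M" "g \<in> borel_measurable M"
    and le: "\<And>x. f x \<le> g x" and eq: "(\<integral>\<^sup>+x. g x \<partial>M) \<le> (\<integral>\<^sup>+x. f x \<partial>M)" and fin: "(\<integral>\<^sup>+x. f x \<partial>M) \<noteq> \<infinity>"
  shows "AE x in M. f x = g x"
proof -
  have "(\<integral>\<^sup>+x. g x - f x \<partial>M) = (\<integral>\<^sup>+x. g x \<partial>M) - (\<integral>\<^sup>+x. f x \<partial>M)"
    by (rule nn_integral_diff) (use le fin in auto)
  also have "\<dots> = 0" using eq fin by (simp add: diff_eq_0_iff_ennreal order.strict_trans1 less_top)
  finally have "AE x in M. g x - f x = 0" by (subst (asm) nn_integral_0_iff_AE) auto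
  then show ?thesis by eventually_elim (simp add: le diff_eq_0_iff_ennreal antisym)
qed

lemma AE_lborel_ex: "AE t in (lborel :: real measure). P t \<Longrightarrow> \<exists>t. P t"
  using eventually_happens[of P "ae_filter (lborel :: real measure)"]
  by (auto simp: ae_filter_eq_bot_iff)

lemma sinh_energy_norm_le:
  fixes f :: "real \<Rightarrow> complex"
  shows "sinh_energy (\<lambda>t. norm (f t)) \<le> sinh_energy f"
  unfolding sinh_energy_def
  by (intro nn_integral_mono ennreal_leI divide_right_mono power_mono) (auto simp: norm_triangle_ineq3)

text \<open>Equal finite energies force equality in the reverse triangle inequality for almost all
  pairs, hence for almost all \<open>s\<close> at one well-chosen base point \<open>t\<close>. As
  \<open>f t\<close> is not zero there, its phase \<open>u\<close> is the phase of
  \<open>f s\<close> for almost every \<open>s\<close>.\<close>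

lemma sinh_energy_norm_eq:
  fixes f :: "real \<Rightarrow> complex" and P :: "real \<Rightarrow> real"
  assumes [measurable]: "f \<in> borel_measurable borel"
    and eq: "sinh_energy f \<le> sinh_energy (\<lambda>t. norm (f t))" and fin: "sinh_energy f \<noteq> \<infinity>"
    and P: "AE t in lborel. norm (f t) = P t" and pos: "\<And>t. 0 < P t"
  obtains u where "norm u = 1" "AE t in lborel. f t = of_real (P t) * u"
proof -
  let ?f = "\<lambda>t s. ennreal ((norm (f s - f t))\<^sup>2 / (sinh (s - t))\<^sup>2)"
  let ?p = "\<lambda>t s. ennreal ((norm (norm (f s) - norm (f t)))\<^sup>2 / (sinh (s - t))\<^sup>2)"
  have le: "?p t s \<le> ?f t s" for t s
    by (intro ennreal_leI divide_right_mono power_mono) (auto simp: norm_triangle_ineq3)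
  have fin': "(\<integral>\<^sup>+t. \<integral>\<^sup>+s. ?f t s \<partial>lborel \<partial>lborel) \<noteq> \<infinity>" using fin unfolding sinh_energy_def .
  have "AE t in lborel. (\<integral>\<^sup>+s. ?p t s \<partial>lborel) = (\<integral>\<^sup>+s. ?f t s \<partial>lborel)"
  proof (rule nn_integral_eq_imp_AE_eq)
    show "(\<integral>\<^sup>+t. \<integral>\<^sup>+s. ?f t s \<partial>lborel \<partial>lborel) \<le> (\<integral>\<^sup>+t. \<integral>\<^sup>+s. ?p t s \<partial>lborel \<partial>lborel)"
      using eq unfolding sinh_energy_def .
    show "(\<integral>\<^sup>+t. \<integral>\<^sup>+s. ?p t s \<partial>lborel \<partial>lborel) \<noteq> \<infinity>"
      using sinh_energy_norm_le[of f] fin unfolding sinh_energy_def by (auto simp: top_unique)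
    show "(\<integral>\<^sup>+s. ?p t s \<partial>lborel) \<le> (\<integral>\<^sup>+s. ?f t s \<partial>lborel)" for t by (intro nn_integral_mono le)
  qed measurable
  moreover have "AE t in lborel. (\<integral>\<^sup>+s. ?f t s \<partial>lborel) \<noteq> \<infinity>"
    by (rule nn_integral_PInf_AE[OF _ fin']) measurable
  ultimately have "AE t in lborel. (\<integral>\<^sup>+s. ?p t s \<partial>lborel) = (\<integral>\<^sup>+s. ?f t s \<partial>lborel) \<and> (\<integral>\<^sup>+s. ?f t s \<partial>lborel) \<noteq> \<infinity> \<and> norm (f t) = P t"
    using P by eventually_elim simp
  from AE_lborel_ex[OF this] obtain t where t: "(\<integral>\<^sup>+s. ?p t s \<partial>lborel) = (\<integral>\<^sup>+s. ?f t s \<partial>lborel)"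
    "(\<integral>\<^sup>+s. ?f t s \<partial>lborel) \<noteq> \<infinity>" "norm (f t) = P t" by blast
  define u where "u = f t / of_real (P t)"
  have "AE s in lborel. ?p t s = ?f t s"
    by (rule nn_integral_eq_imp_AE_eq)
       (measurable, rule le, rule eq_refl[OF t(1)[symmetric]], subst t(1), rule t(2))
  then have "AE s in lborel. f s = of_real (P s) * u"
    using P AE_lborel_singleton[of t]
  proof eventually_elim
    case (elim s)
    have "sinh (s - t) \<noteq> 0" using elim(3) by (simp add: sinh_real_zero_iff)
    moreover have "(norm (norm (f s) - norm (f t)))\<^sup>2 / (sinh (s - t))\<^sup>2 = (norm (f s - f t))\<^sup>2 / (sinh (s - t))\<^sup>2"
      using elim(1) by (subst (asm) ennreal_inj) auto
    ultimately have n: "(norm (f s) - norm (f t))\<^sup>2 = (norm (f s - f t))\<^sup>2" by simp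
    have r: "norm (f s) = P s" "norm (f t) = P t" using elim(2) t(3) by auto
    have "(norm (of_real (P t) * f s - of_real (P s) * f t))\<^sup>2 = 0"
    proof -
      \<comment> \<open>With \<open>a = P t = norm y\<close> and \<open>b = P s = norm x\<close>,
        equality in the reverse triangle inequality makes the two summands cancel; the vectors are
        then positive multiples of each other.\<close>
      have ex: "(norm (of_real a * x - of_real b * y))\<^sup>2 = a * b * (norm (x - y))\<^sup>2 + (a - b) * (a * (norm x)\<^sup>2 - b * (norm y)\<^sup>2)" for a b :: real and x y :: complex
        by (simp only: cmod_power2) (simp add: power2_eq_square algebra_simps)
      show ?thesis unfolding ex n[symmetric] r by (simp add: power2_eq_square algebra_simps)
    qed
    then have "of_real (P t) * f s = of_real (P s) * f t" by simp
    then show ?case using pos[of t] by (simp add: u_def field_simps)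
  qed
  moreover have "norm u = 1" using t(3) pos[of t] by (simp add: u_def norm_divide)
  ultimately show thesis using that by blast
qed

lemma cube_root_cubed:
  fixes y :: real
  assumes "0 \<le> y"
  shows "(y powr (1 / 3)) ^ 3 = y"
  using assms by (cases "y = 0") (simp_all flip: powr_realpow add: powr_powr)

text \<open>In the angular variable \<open>1 / cosh\<close> is the single mode
  \<open>sin \<theta>\<close>. The integrand of the energy collapses to
  \<open>1 + cos a * cos b\<close>, with double integral \<open>pi\<^sup>2\<close>, and the cubic
  one to \<open>sin\<^sup>2\<close>, with integral \<open>pi / 2\<close>.\<close>

lemma sech_energy:
  fixes \<alpha> :: real and \<beta> :: complex
  defines "h \<equiv> \<lambda>t. \<beta> * of_real (1 / cosh (t - \<alpha>))"
  shows "sinh_energy h + 4 * (\<integral>\<^sup>+t. ennreal ((norm (h t))\<^sup>2) \<partial>lborel) = ennreal ((norm \<beta>)\<^sup>2 * pi\<^sup>2)"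
    and "(\<integral>\<^sup>+t. ennreal (norm (h t) ^ 3) \<partial>lborel) = ennreal (norm \<beta> ^ 3 * (pi / 2))"
proof -
  let ?h = "\<lambda>t::real. 1 / cosh t"
  have nh: "norm (h t) = norm \<beta> * ?h (t - \<alpha>)" for t
    by (simp add: h_def norm_mult norm_divide)
  have nd: "norm (h s - h t) = norm \<beta> * \<bar>?h (s - \<alpha>) - ?h (t - \<alpha>)\<bar>" for s t
    unfolding h_def right_diff_distrib[symmetric] of_real_diff[symmetric] norm_mult norm_of_real ..
  have E: "sinh_energy h = ennreal ((norm \<beta>)\<^sup>2) * sinh_energy ?h"
  proof -
    let ?k = "\<lambda>t s. ennreal ((norm (?h s - ?h t))\<^sup>2 / (sinh (s - t))\<^sup>2)"
    have "ennreal ((norm (h s - h t))\<^sup>2 / (sinh (s - t))\<^sup>2) = ennreal ((norm \<beta>)\<^sup>2) * ?k (t - \<alpha>) (s - \<alpha>)" for s t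
      unfolding nd by (subst ennreal_mult'[symmetric]) (simp_all add: power_mult_distrib)
    then have "sinh_energy h = (\<integral>\<^sup>+t. \<integral>\<^sup>+s. ennreal ((norm \<beta>)\<^sup>2) * ?k (t - \<alpha>) (s - \<alpha>) \<partial>lborel \<partial>lborel)"
      unfolding sinh_energy_def by simp
    also have "\<dots> = (\<integral>\<^sup>+t. ennreal ((norm \<beta>)\<^sup>2) * (\<integral>\<^sup>+s. ?k (t - \<alpha>) s \<partial>lborel) \<partial>lborel)"
    proof (rule nn_integral_cong)
      fix t
      have "(\<integral>\<^sup>+s. ennreal ((norm \<beta>)\<^sup>2) * ?k (t - \<alpha>) (s - \<alpha>) \<partial>lborel)
         = (\<integral>\<^sup>+s. ennreal ((norm \<beta>)\<^sup>2) * ?k (t - \<alpha>) s \<partial>lborel)"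
        using nn_integral_lborel_translate[of "\<lambda>s. ennreal ((norm \<beta>)\<^sup>2) * ?k (t - \<alpha>) s" "- \<alpha>"] by simp
      also have "\<dots> = ennreal ((norm \<beta>)\<^sup>2) * (\<integral>\<^sup>+s. ?k (t - \<alpha>) s \<partial>lborel)"
        by (rule nn_integral_cmult) measurable
      finally show "(\<integral>\<^sup>+s. ennreal ((norm \<beta>)\<^sup>2) * ?k (t - \<alpha>) (s - \<alpha>) \<partial>lborel) = ennreal ((norm \<beta>)\<^sup>2) * (\<integral>\<^sup>+s. ?k (t - \<alpha>) s \<partial>lborel)" .
    qed
    also have "\<dots> = ennreal ((norm \<beta>)\<^sup>2) * (\<integral>\<^sup>+t. (\<integral>\<^sup>+s. ?k (t - \<alpha>) s \<partial>lborel) \<partial>lborel)"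
      by (rule nn_integral_cmult) measurable
    also have "(\<integral>\<^sup>+t. (\<integral>\<^sup>+s. ?k (t - \<alpha>) s \<partial>lborel) \<partial>lborel) = sinh_energy ?h"
      unfolding sinh_energy_def using nn_integral_lborel_translate[of "\<lambda>t. \<integral>\<^sup>+s. ?k t s \<partial>lborel" "- \<alpha>"] by simp
    finally show ?thesis .
  qed
  have N: "(\<integral>\<^sup>+t. ennreal ((norm (h t))\<^sup>2) \<partial>lborel) = ennreal ((norm \<beta>)\<^sup>2) * (\<integral>\<^sup>+t. ennreal ((?h t)\<^sup>2) \<partial>lborel)"
  proof -
    have "(\<integral>\<^sup>+t. ennreal ((norm (h t))\<^sup>2) \<partial>lborel) = (\<integral>\<^sup>+t. ennreal ((norm \<beta>)\<^sup>2) * ennreal ((?h (t - \<alpha>))\<^sup>2) \<partial>lborel)"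
      unfolding nh power_mult_distrib by (intro nn_integral_cong ennreal_mult) auto
    also have "\<dots> = ennreal ((norm \<beta>)\<^sup>2) * (\<integral>\<^sup>+t. ennreal ((?h (t - \<alpha>))\<^sup>2) \<partial>lborel)"
      by (rule nn_integral_cmult) measurable
    also have "(\<integral>\<^sup>+t. ennreal ((?h (t - \<alpha>))\<^sup>2) \<partial>lborel) = (\<integral>\<^sup>+t. ennreal ((?h t)\<^sup>2) \<partial>lborel)"
      using nn_integral_lborel_translate[of "\<lambda>t. ennreal ((?h t)\<^sup>2)" "- \<alpha>"] by simp
    finally show ?thesis .
  qed
  have ang: "AE a in angle. ?h (log_tan a) = sin a"
    using AE_angle by eventually_elim (simp add: cosh_sinh_log_tan)
  have "angular_energy (\<lambda>a. ?h (log_tan a)) = (\<integral>\<^sup>+a. ennreal (pi * 1) \<partial>angle)"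
    unfolding angular_energy_def
  proof (rule nn_integral_cong_AE, use AE_angle in eventually_elim)
    fix a :: real assume a: "0 < a \<and> a < pi"
    have "AE b in angle. b \<noteq> a" unfolding angle_def
      by (subst AE_density) (use AE_lborel_singleton[of a] in \<open>auto elim: eventually_mono\<close>)
    then have "(\<integral>\<^sup>+b. ennreal ((?h (log_tan a) - ?h (log_tan b))\<^sup>2 / (4 * (sin ((a - b) / 2))\<^sup>2)
        + (?h (log_tan a) + ?h (log_tan b))\<^sup>2 / (4 * (sin ((a + b) / 2))\<^sup>2)) \<partial>angle)
      = (\<integral>\<^sup>+b. ennreal (1 + cos a * cos b) \<partial>angle)"
      using AE_angle
    proof (intro nn_integral_cong_AE, eventually_elim)
      case (elim b)
      have h: "?h (log_tan a) = sin a" "?h (log_tan b) = sin b"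
        using a elim by (simp_all add: cosh_sinh_log_tan)
      \<comment> \<open>In half sum and half difference,
        \<open>sin a - sin b = 2 cos x sin y\<close> and
        \<open>sin a + sin b = 2 sin x cos y\<close> cancel the denominators.\<close>
      define x y where "x = (a + b) / 2" and "y = (a - b) / 2"
      have ab: "a = x + y" "b = x - y" by (simp_all add: x_def y_def field_simps)
      have "sin x \<noteq> 0" "sin y \<noteq> 0"
        using a elim sin_gt_zero[of x] sin_eq_0_pi[of y] by (auto simp: x_def y_def)
      then have "(sin a - sin b)\<^sup>2 / (4 * (sin y)\<^sup>2) + (sin a + sin b)\<^sup>2 / (4 * (sin x)\<^sup>2) = (cos x)\<^sup>2 + (cos y)\<^sup>2"
        unfolding ab sin_add sin_diff by (simp add: power2_eq_square)
      also have "\<dots> = 1 + cos a * cos b"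
        unfolding ab cos_add cos_diff using sin_cos_squared_add[of x] sin_cos_squared_add[of y] by algebra
      finally show ?case unfolding h x_def y_def by simp
    qed
    also have "\<dots> = ennreal (pi * 1)"
    proof -
      have "has_bochner_integral angle (\<lambda>b. 1 + cos a * cos b) (pi + cos a * 0)"
        using integral_angle_cos[of 0] integral_angle_cos[of 1]
        by (intro has_bochner_integral_add has_bochner_integral_mult_right) auto
      moreover have "0 \<le> 1 + cos a * cos b" for b
      proof -
        have "\<bar>cos a * cos b\<bar> \<le> 1 * 1" unfolding abs_mult by (intro mult_mono) auto
        then show ?thesis by linarith
      qed
      ultimately show ?thesis by (subst nn_integral_eq_integral) (auto simp: has_bochner_integral_iff)
    qed
    finally show "(\<integral>\<^sup>+b. ennreal ((?h (log_tan a) - ?h (log_tan b))\<^sup>2 / (4 * (sin ((a - b) / 2))\<^sup>2)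
        + (?h (log_tan a) + ?h (log_tan b))\<^sup>2 / (4 * (sin ((a + b) / 2))\<^sup>2)) \<partial>angle) = ennreal (pi * 1)" .
  qed
  also have "\<dots> = ennreal (pi\<^sup>2)"
  proof -
    have "has_bochner_integral angle (\<lambda>b. pi * 1) (pi * pi)"
      using integral_angle_cos[of 0] by (intro has_bochner_integral_mult_right) auto
    then show ?thesis by (subst nn_integral_eq_integral) (auto simp: has_bochner_integral_iff power2_eq_square)
  qed
  finally have W: "sinh_energy ?h + 4 * (\<integral>\<^sup>+t. ennreal ((?h t)\<^sup>2) \<partial>lborel) = ennreal (pi\<^sup>2)"
    by (subst (asm) angular_energy_eq_sinh_energy) measurable
  have "sinh_energy h + 4 * (\<integral>\<^sup>+t. ennreal ((norm (h t))\<^sup>2) \<partial>lborel)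
     = ennreal ((norm \<beta>)\<^sup>2) * (sinh_energy ?h + 4 * (\<integral>\<^sup>+t. ennreal ((?h t)\<^sup>2) \<partial>lborel))"
    unfolding E N by (simp only: distrib_left mult.left_commute)
  then show "sinh_energy h + 4 * (\<integral>\<^sup>+t. ennreal ((norm (h t))\<^sup>2) \<partial>lborel) = ennreal ((norm \<beta>)\<^sup>2 * pi\<^sup>2)"
    unfolding W by (simp only: ennreal_mult'[OF zero_le_power2])
  have "(\<integral>\<^sup>+t. ennreal (norm (h t) ^ 3) \<partial>lborel) = (\<integral>\<^sup>+t. ennreal (norm \<beta> ^ 3) * ennreal (?h (t - \<alpha>) ^ 3) \<partial>lborel)"
    unfolding nh power_mult_distrib by (intro nn_integral_cong ennreal_mult) auto
  also have "\<dots> = ennreal (norm \<beta> ^ 3) * (\<integral>\<^sup>+t. ennreal (?h (t - \<alpha>) ^ 3) \<partial>lborel)"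
    by (rule nn_integral_cmult) measurable
  also have "(\<integral>\<^sup>+t. ennreal (?h (t - \<alpha>) ^ 3) \<partial>lborel) = (\<integral>\<^sup>+t. ennreal (?h t ^ 3) \<partial>lborel)"
    using nn_integral_lborel_translate[of "\<lambda>t. ennreal (?h t ^ 3)" "- \<alpha>"] by simp
  also have "\<dots> = (\<integral>\<^sup>+a. ennreal (1 / sin a) * ennreal (?h (log_tan a) ^ 3) \<partial>angle)"
    by (rule nn_integral_log_tan) measurable
  also have "\<dots> = (\<integral>\<^sup>+a. ennreal (sin (real (Suc 0) * a) * sin (real (Suc 0) * a)) \<partial>angle)"
  proof (rule nn_integral_cong_AE, use ang AE_angle in eventually_elim)
    case (elim a)
    then have "0 < sin a" by (auto intro: sin_gt_zero)
    then show ?case unfolding elim(1)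
      by (subst ennreal_mult'[symmetric]) (simp_all add: power3_eq_cube)
  qed
  also have "\<dots> = ennreal (pi / 2)"
    using integral_angle_sin_sin[of 0 0] by (subst nn_integral_eq_integral) (auto simp: has_bochner_integral_iff)
  finally show "(\<integral>\<^sup>+t. ennreal (norm (h t) ^ 3) \<partial>lborel) = ennreal (norm \<beta> ^ 3 * (pi / 2))"
    by (simp only: ennreal_mult'[OF zero_le_power[OF norm_ge_zero]])
qed

text \<open>Transfers the estimate from the angle to the line; \<open>p\<close> will be a modulus.
  The last two conclusions are what the rank-one analysis needs of \<open>F\<close>; square
  integrability comes from \<open>1 \<le> 1 / sin \<theta>\<close>.\<close>

lemma cube_bound:
  fixes p :: "real \<Rightarrow> real" and w :: real and z k :: nat
  assumes [measurable]: "p \<in> borel_measurable borel" and p0: "\<And>t. 0 \<le> p t"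
    and p2: "integrable lborel (\<lambda>t. (p t)\<^sup>2)"
    and w: "sinh_energy p + 4 * (\<integral>\<^sup>+t. ennreal ((p t)\<^sup>2) \<partial>lborel) \<le> ennreal w" "0 \<le> w"
  defines "F \<equiv> \<lambda>\<theta>. p (log_tan \<theta>)"
  defines "\<delta> \<equiv> sine_coeff F 0 * sine_coeff F (z + k) - sine_coeff F k * sine_coeff F z"
  shows "(\<integral>\<^sup>+t. ennreal (p t ^ 3) \<partial>lborel) \<le> ennreal (pi / 2 * sqrt (w / pi\<^sup>2 * ((w / pi\<^sup>2)\<^sup>2 - \<delta>\<^sup>2)))"
    and "integrable angle (\<lambda>x. (F x)\<^sup>2)" and "angular_energy F \<le> ennreal w"
proof -
  have [measurable]: "F \<in> borel_measurable borel" unfolding F_def by measurable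
  show F2: "integrable angle (\<lambda>x. (F x)\<^sup>2)"
  proof (rule integrableI_bounded)
    have "(\<integral>\<^sup>+\<theta>. ennreal (norm ((F \<theta>)\<^sup>2)) \<partial>angle) \<le> (\<integral>\<^sup>+\<theta>. ennreal (1 / sin \<theta>) * ennreal ((p (log_tan \<theta>))\<^sup>2) \<partial>angle)"
    proof (rule nn_integral_mono_AE, use AE_angle in eventually_elim)
      case (elim \<theta>)
      then have "0 < sin \<theta>" by (auto intro: sin_gt_zero)
      then have "1 \<le> 1 / sin \<theta>" by (simp add: field_simps)
      then have "1 * (F \<theta>)\<^sup>2 \<le> 1 / sin \<theta> * (F \<theta>)\<^sup>2" by (rule mult_right_mono) simp
      then show ?case using \<open>0 < sin \<theta>\<close>
        by (subst ennreal_mult'[symmetric]) (auto simp: F_def intro: ennreal_leI)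
    qed
    also have "\<dots> = (\<integral>\<^sup>+t. ennreal ((p t)\<^sup>2) \<partial>lborel)" by (rule nn_integral_log_tan[symmetric]) measurable
    also have "\<dots> < \<infinity>" using p2 by (simp add: integrable_iff_bounded)
    finally show "(\<integral>\<^sup>+\<theta>. ennreal (norm ((F \<theta>)\<^sup>2)) \<partial>angle) < \<infinity>" .
  qed measurable
  show W: "angular_energy F \<le> ennreal w"
    using w(1) unfolding F_def by (subst angular_energy_eq_sinh_energy) auto
  have "(\<integral>\<^sup>+t. ennreal (p t ^ 3) \<partial>lborel) = (\<integral>\<^sup>+\<theta>. ennreal (1 / sin \<theta>) * ennreal (p (log_tan \<theta>) ^ 3) \<partial>angle)"
    by (rule nn_integral_log_tan) measurable
  also have "\<dots> = (\<integral>\<^sup>+\<theta>. ennreal (F \<theta> ^ 3 / sin \<theta>) \<partial>angle)"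
  proof (rule nn_integral_cong_AE, use AE_angle in eventually_elim)
    case (elim \<theta>)
    then have "0 < sin \<theta>" by (auto intro: sin_gt_zero)
    then show ?case by (subst ennreal_mult'[symmetric]) (simp_all add: F_def)
  qed
  also have "\<dots> \<le> ennreal (pi / 2 * sqrt (w / pi\<^sup>2 * ((w / pi\<^sup>2)\<^sup>2 - \<delta>\<^sup>2)))"
    unfolding \<delta>_def by (rule cube_integral_le[OF _ F2 W w(2)]) (auto simp: F_def p0)
  finally show "(\<integral>\<^sup>+t. ennreal (p t ^ 3) \<partial>lborel) \<le> ennreal (pi / 2 * sqrt (w / pi\<^sup>2 * ((w / pi\<^sup>2)\<^sup>2 - \<delta>\<^sup>2)))" .
qed

section \<open>The inequality on the line\<close>

text \<open>A negative radicand would make \<open>sqrt\<close> negative in HOL, so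
  \<open>0 < C\<close> guarantees that squaring recovers it.\<close>

lemma square_le_cube_bound:
  fixes C B \<delta> :: real
  assumes "0 < C" "C \<le> pi / 2 * sqrt (B * (B\<^sup>2 - \<delta>\<^sup>2))"
  shows "C\<^sup>2 \<le> (pi / 2)\<^sup>2 * (B * (B\<^sup>2 - \<delta>\<^sup>2))"
proof -
  have "0 < pi / 2 * sqrt (B * (B\<^sup>2 - \<delta>\<^sup>2))" using assms by linarith
  then have pos: "0 < B * (B\<^sup>2 - \<delta>\<^sup>2)" by (simp only: zero_less_mult_iff real_sqrt_gt_0_iff) auto
  have "C\<^sup>2 \<le> (pi / 2 * sqrt (B * (B\<^sup>2 - \<delta>\<^sup>2)))\<^sup>2" using assms by (intro power_mono) auto
  also have "\<dots> = (pi / 2)\<^sup>2 * (B * (B\<^sup>2 - \<delta>\<^sup>2))"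
    using pos by (simp only: power_mult_distrib real_sqrt_pow2 less_imp_le)
  finally show ?thesis .
qed

lemma sinh_energy_cong_AE:
  assumes "AE t in lborel. f t = g t"
  shows "sinh_energy f = sinh_energy g"
  unfolding sinh_energy_def
proof (rule nn_integral_cong_AE, use assms in eventually_elim, rule nn_integral_cong_AE, use assms in eventually_elim)
  fix t s assume "f t = g t" "f s = g s"
  then show "ennreal ((norm (f s - f t))\<^sup>2 / (sinh (s - t))\<^sup>2) = ennreal ((norm (g s - g t))\<^sup>2 / (sinh (s - t))\<^sup>2)" by simp
qed

text \<open>
  With \<open>e = 2\<pi> (f, T f)\<close> this is \<open>2/\<pi>\<close> times the left-hand side of the inequality, an upper
  bound for \<open>tr H\<^sup>2\<close>.
\<close>

definition scaled_form :: "(real \<Rightarrow> complex) \<Rightarrow> real \<Rightarrow> real" where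
  "scaled_form f e = (e + 4 * (\<integral>t. (norm (f t))\<^sup>2 \<partial>lborel)) / pi\<^sup>2"

context
  fixes f :: "real \<Rightarrow> complex" and e :: real
  assumes f_meas [measurable]: "f \<in> borel_measurable borel"
    and f_sq: "integrable lborel (\<lambda>t. (norm (f t))\<^sup>2)"
    and e: "sinh_energy f = ennreal e" "0 \<le> e"
begin

text \<open>The number \<open>w\<close> belongs to the modulus and \<open>e\<close> to
  \<open>f\<close> itself. Since both are finite and share the \<open>L\<^sup>2\<close> term,
  equality of the scaled quantities gives back equality of the energies.\<close>

lemma norm_energy:
  obtains w where "sinh_energy (\<lambda>t. norm (f t)) + 4 * (\<integral>\<^sup>+t. ennreal ((norm (f t))\<^sup>2) \<partial>lborel) = ennreal w"
    "0 \<le> w" "w / pi\<^sup>2 \<le> scaled_form f e"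
    "w / pi\<^sup>2 = scaled_form f e \<Longrightarrow> sinh_energy f \<le> sinh_energy (\<lambda>t. norm (f t))"
proof -
  let ?N = "\<integral>t. (norm (f t))\<^sup>2 \<partial>lborel"
  have le: "sinh_energy (\<lambda>t. norm (f t)) \<le> ennreal e" using sinh_energy_norm_le[of f] e by simp
  then obtain e' where e': "sinh_energy (\<lambda>t. norm (f t)) = ennreal e'" "0 \<le> e'"
    by (cases "sinh_energy (\<lambda>t. norm (f t))") (auto simp: top_unique)
  have "e' \<le> e" using le e(2) unfolding e'(1) by simp
  have "(\<integral>\<^sup>+t. ennreal ((norm (f t))\<^sup>2) \<partial>lborel) = ennreal ?N" by (rule nn_integral_eq_integral[OF f_sq]) simp
  moreover have "ennreal e' + 4 * ennreal ?N = ennreal (e' + 4 * ?N)"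
    using e'(2) ennreal_mult'[of 4 ?N] by simp
  ultimately show thesis
    using that[of "e' + 4 * ?N"] e' e \<open>e' \<le> e\<close> by (simp add: scaled_form_def divide_right_mono)
qed

lemma cube_integrable: "integrable lborel (\<lambda>t. norm (f t) ^ 3)"
proof -
  obtain w where w: "sinh_energy (\<lambda>t. norm (f t)) + 4 * (\<integral>\<^sup>+t. ennreal ((norm (f t))\<^sup>2) \<partial>lborel) = ennreal w" "0 \<le> w"
    by (rule norm_energy) (rule that)
  have "(\<integral>\<^sup>+t. ennreal (norm (f t) ^ 3) \<partial>lborel) < \<infinity>"
    using cube_bound(1)[of "\<lambda>t. norm (f t)" w 0 0] f_sq w by (auto intro: order.strict_trans1)
  then show ?thesis by (intro integrableI_bounded) auto
qed

text \<open>In squared form the comparison is polynomial. Equality has two consequences: the modulus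
  has the same energy as \<open>f\<close>, which fixes the phase, and all minors of its coefficients
  vanish, which makes the modulus a translate of a multiple of \<open>1 / cosh\<close>.\<close>

lemma cube_integral_square_le:
  "(\<integral>t. norm (f t) ^ 3 \<partial>lborel)\<^sup>2 \<le> (pi / 2)\<^sup>2 * scaled_form f e ^ 3" (is "?C\<^sup>2 \<le> _")
  and cube_integral_square_eq_imp:
  "(\<integral>t. norm (f t) ^ 3 \<partial>lborel)\<^sup>2 = (pi / 2)\<^sup>2 * scaled_form f e ^ 3 \<Longrightarrow>
     \<exists>\<alpha> \<beta>. AE t in lborel. f t = \<beta> * of_real (1 / cosh (t - \<alpha>))"
proof -
  let ?p = "\<lambda>t. norm (f t)"
  obtain w where w: "sinh_energy ?p + 4 * (\<integral>\<^sup>+t. ennreal ((?p t)\<^sup>2) \<partial>lborel) = ennreal w" "0 \<le> w"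
    "w / pi\<^sup>2 \<le> scaled_form f e" "w / pi\<^sup>2 = scaled_form f e \<Longrightarrow> sinh_energy f \<le> sinh_energy ?p"
    by (rule norm_energy) (rule that)
  define B where "B = w / pi\<^sup>2"
  have B0: "0 \<le> B" using w(2) by (simp add: B_def)
  let ?F = "\<lambda>\<theta>. ?p (log_tan \<theta>)"
  let ?\<delta> = "\<lambda>z k. sine_coeff ?F 0 * sine_coeff ?F (z + k) - sine_coeff ?F k * sine_coeff ?F z"
  have Cn: "(\<integral>\<^sup>+t. ennreal (?p t ^ 3) \<partial>lborel) = ennreal ?C"
    by (rule nn_integral_eq_integral[OF cube_integrable]) simp
  have C0: "0 \<le> ?C" by simp
  have bound: "ennreal ?C \<le> ennreal (pi / 2 * sqrt (B * (B\<^sup>2 - (?\<delta> z k)\<^sup>2)))" for z k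
    unfolding B_def Cn[symmetric] by (rule cube_bound(1)) (use f_sq w in auto)
  have sq: "?C\<^sup>2 \<le> (pi / 2)\<^sup>2 * (B * (B\<^sup>2 - (?\<delta> z k)\<^sup>2))" if "0 < ?C" for z k
  proof (rule square_le_cube_bound[OF that])
    show "?C \<le> pi / 2 * sqrt (B * (B\<^sup>2 - (?\<delta> z k)\<^sup>2))"
      using bound[of z k] that by (metis ennreal_le_iff2 not_le)
  qed
  have CB: "?C\<^sup>2 \<le> (pi / 2)\<^sup>2 * B ^ 3"
  proof (cases "?C = 0")
    case False
    have "B * (B\<^sup>2 - (?\<delta> 0 0)\<^sup>2) \<le> B * B\<^sup>2" using B0 by (intro mult_left_mono) auto
    then have "(pi / 2)\<^sup>2 * (B * (B\<^sup>2 - (?\<delta> 0 0)\<^sup>2)) \<le> (pi / 2)\<^sup>2 * (B * B\<^sup>2)" by (rule mult_left_mono) simp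
    moreover have "B * B\<^sup>2 = B ^ 3" by (simp add: power2_eq_square power3_eq_cube)
    ultimately show ?thesis using sq[of 0 0] False C0 by simp
  qed (use B0 in simp)
  also have BS: "\<dots> \<le> (pi / 2)\<^sup>2 * scaled_form f e ^ 3"
    using w(3) B0 by (intro mult_left_mono power_mono) (auto simp: B_def)
  finally show "?C\<^sup>2 \<le> (pi / 2)\<^sup>2 * scaled_form f e ^ 3" .
  show "\<exists>\<alpha> \<beta>. AE t in lborel. f t = \<beta> * of_real (1 / cosh (t - \<alpha>))"
    if eq: "?C\<^sup>2 = (pi / 2)\<^sup>2 * scaled_form f e ^ 3"
  proof -
    have zero: ?thesis if "AE t in lborel. f t = 0"
      using that by (intro exI[of _ 0]) simp
    \<comment> \<open>Nothing may be lost between \<open>f\<close> and its modulus; this releases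
      the last property of \<open>w\<close>.\<close>
    have "scaled_form f e ^ 3 \<le> B ^ 3" using CB unfolding eq by simp
    then have "scaled_form f e \<le> B" using B0 by (rule power_le_imp_le_base[of _ 2, simplified])
    then have SB: "w / pi\<^sup>2 = scaled_form f e" using w(3) by (simp add: B_def)
    show ?thesis
    proof (cases "?C = 0")
      case True
      then have "AE t in lborel. norm (f t) ^ 3 = 0"
        using integral_nonneg_eq_0_iff_AE[OF cube_integrable] by simp
      then have "AE t in lborel. f t = 0" by eventually_elim simp
      then show ?thesis by (rule zero)
    next
      case False
      then have Cpos: "0 < ?C" using C0 by linarith
      have Bpos: "0 < B"
      proof (rule ccontr)
        assume "\<not> 0 < B"
        then have "B = 0" using B0 by simp
        then show False using CB Cpos by simp
      qed
      have "?\<delta> z k = 0" for z k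
      proof -
        have "(pi / 2)\<^sup>2 * B ^ 3 \<le> (pi / 2)\<^sup>2 * (B * (B\<^sup>2 - (?\<delta> z k)\<^sup>2))"
          using sq[OF Cpos, of z k] eq SB by (simp add: B_def)
        then have "B ^ 3 \<le> B * (B\<^sup>2 - (?\<delta> z k)\<^sup>2)" by (rule mult_left_le_imp_le) simp
        then have "B * (?\<delta> z k)\<^sup>2 \<le> 0" by (simp add: power2_eq_square power3_eq_cube algebra_simps)
        then show ?thesis using Bpos by (simp add: mult_le_0_iff)
      qed
      then have rank: "sine_coeff ?F 0 * sine_coeff ?F (z + k) = sine_coeff ?F k * sine_coeff ?F z" for z k by simp
      have F: "integrable angle (\<lambda>x. (?F x)\<^sup>2)" "angular_energy ?F \<le> ennreal w"
        by (rule cube_bound(2,3); use f_sq w in auto)+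
      have Fm: "?F \<in> borel_measurable borel" by measurable
      obtain c q where q: "\<bar>q\<bar> < 1" and cq: "AE x in angle. ?F x = c * (sin x / (1 - 2 * q * cos x + q\<^sup>2))"
        by (rule rank_one_sine_series[OF Fm F w(2) rank])
      obtain \<alpha> where \<alpha>: "\<And>t. (1 + q\<^sup>2) * cosh t + 2 * q * sinh t = (1 - q\<^sup>2) * cosh (t - \<alpha>)"
        using sech_translate[OF q] by blast
      define \<gamma> where "\<gamma> = c / (1 - q\<^sup>2)"
      have P: "AE t in lborel. norm (f t) = \<gamma> * (1 / cosh (t - \<alpha>))"
      proof (rule AE_log_tan)
        show "AE \<theta> in angle. norm (f (log_tan \<theta>)) = \<gamma> * (1 / cosh (log_tan \<theta> - \<alpha>))"
          using cq AE_angle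
        proof eventually_elim
          case (elim \<theta>)
          have s: "0 < sin \<theta>" using elim(2) by (auto intro: sin_gt_zero)
          have "(1 - q\<^sup>2) * cosh (log_tan \<theta> - \<alpha>) = (1 - 2 * q * cos \<theta> + q\<^sup>2) / sin \<theta>"
            unfolding \<alpha>[symmetric] using elim(2) s by (simp add: cosh_sinh_log_tan field_simps)
          then have "c * (sin \<theta> / (1 - 2 * q * cos \<theta> + q\<^sup>2)) = c * (1 / ((1 - q\<^sup>2) * cosh (log_tan \<theta> - \<alpha>)))" by simp
          then show ?case unfolding elim(1) \<gamma>_def by simp
        qed
      qed measurable
      show ?thesis
      proof (cases "0 < \<gamma>")
        case True
        obtain u where "AE t in lborel. f t = of_real (\<gamma> * (1 / cosh (t - \<alpha>))) * u"
        proof (rule sinh_energy_norm_eq[OF f_meas w(4)[OF SB] _ P])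
          show "sinh_energy f \<noteq> \<infinity>" using e by simp
          show "0 < \<gamma> * (1 / cosh (t - \<alpha>))" for t using True by simp
        qed
        then have "AE t in lborel. f t = (of_real \<gamma> * u) * of_real (1 / cosh (t - \<alpha>))"
          by eventually_elim simp
        then show ?thesis by blast
      next
        \<comment> \<open>A nonpositive \<open>\<gamma>\<close> leaves only the zero function, the
          case \<open>\<beta> = 0\<close>.\<close>
        case False
        have "AE t in lborel. f t = 0"
          using P
        proof eventually_elim
          case (elim t)
          have "\<gamma> * (1 / cosh (t - \<alpha>)) \<le> 0" using False by (simp add: divide_le_0_iff)
          with elim have "norm (f t) \<le> 0" by linarith
          then show ?case by simp
        qed
        then show ?thesis by (rule zero)
      qed
    qed
  qed
qed

text \<open>Both sides equal \<open>(pi / 2)\<^sup>2\<close> times the sixth power of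
  \<open>norm \<beta>\<close>.\<close>

lemma cube_integral_square_eqI:
  assumes "AE t in lborel. f t = \<beta> * of_real (1 / cosh (t - \<alpha>))"
  shows "(\<integral>t. norm (f t) ^ 3 \<partial>lborel)\<^sup>2 = (pi / 2)\<^sup>2 * scaled_form f e ^ 3"
proof -
  let ?N = "\<integral>t. (norm (f t))\<^sup>2 \<partial>lborel" and ?C = "\<integral>t. norm (f t) ^ 3 \<partial>lborel"
  let ?h = "\<lambda>t. \<beta> * of_real (1 / cosh (t - \<alpha>))"
  have "ennreal ?N = (\<integral>\<^sup>+t. ennreal ((norm (f t))\<^sup>2) \<partial>lborel)" by (rule nn_integral_eq_integral[OF f_sq, symmetric]) simp
  also have "\<dots> = (\<integral>\<^sup>+t. ennreal ((norm (?h t))\<^sup>2) \<partial>lborel)"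
    by (rule nn_integral_cong_AE) (use assms in \<open>eventually_elim, simp only:\<close>)
  finally have N: "(\<integral>\<^sup>+t. ennreal ((norm (?h t))\<^sup>2) \<partial>lborel) = ennreal ?N" ..
  have "ennreal ?C = (\<integral>\<^sup>+t. ennreal (norm (f t) ^ 3) \<partial>lborel)" by (rule nn_integral_eq_integral[OF cube_integrable, symmetric]) simp
  also have "\<dots> = (\<integral>\<^sup>+t. ennreal (norm (?h t) ^ 3) \<partial>lborel)"
    by (rule nn_integral_cong_AE) (use assms in \<open>eventually_elim, simp only:\<close>)
  also have "\<dots> = ennreal (norm \<beta> ^ 3 * (pi / 2))" by (rule sech_energy(2))
  finally have C: "?C = norm \<beta> ^ 3 * (pi / 2)" by (subst (asm) ennreal_inj) auto
  have "ennreal (e + 4 * ?N) = ennreal e + 4 * ennreal ?N"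
    using e(2) ennreal_mult'[of 4 ?N] by simp
  also have "\<dots> = ennreal ((norm \<beta>)\<^sup>2 * pi\<^sup>2)"
    unfolding N[symmetric] e(1)[symmetric] sinh_energy_cong_AE[OF assms] by (rule sech_energy(1))
  finally have "e + 4 * ?N = (norm \<beta>)\<^sup>2 * pi\<^sup>2" using e(2) by (subst (asm) ennreal_inj) auto
  then have "scaled_form f e = (norm \<beta>)\<^sup>2" by (simp add: scaled_form_def)
  then show ?thesis unfolding C by (simp add: power_mult_distrib power_divide flip: power_mult)
qed

end

section \<open>From Borel functions back to classes of Lebesgue measurable functions\<close>

lemma lebesgue_borel_version:
  fixes \<phi> :: "real \<Rightarrow> complex"
  assumes "\<phi> \<in> borel_measurable lebesgue"
  obtains f where "f \<in> borel_measurable borel" "AE t in lborel. \<phi> t = f t"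
proof -
  have "(\<lambda>t. Re (\<phi> t)) \<in> borel_measurable lebesgue" "(\<lambda>t. Im (\<phi> t)) \<in> borel_measurable lebesgue"
    using assms by measurable
  then obtain a b where ab: "a \<in> borel_measurable lborel" "AE t in lborel. Re (\<phi> t) = a t"
    "b \<in> borel_measurable lborel" "AE t in lborel. Im (\<phi> t) = b t"
    using completion_ex_borel_measurable_real by metis
  have "AE t in lborel. \<phi> t = Complex (a t) (b t)"
    using ab(2,4) by eventually_elim (simp add: complex_eq_iff)
  moreover have "(\<lambda>t. of_real (a t) + \<i> * of_real (b t)) \<in> borel_measurable borel"
    using ab(1,3) by measurable
  ultimately show thesis using that by (simp add: Complex_eq)
qed

lemma truncated_fourier_cong_AE:
  assumes [measurable]: "\<phi> \<in> borel_measurable lebesgue" "f \<in> borel_measurable borel"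
    and ae: "AE t in lborel. \<phi> t = f t"
  shows "truncated_fourier R \<phi> \<tau> = truncated_fourier R f \<tau>"
proof -
  have [measurable]: "(\<lambda>t::real. t) \<in> borel_measurable lebesgue" "f \<in> borel_measurable lebesgue"
    by (auto intro: measurable_completion simp: assms(2))
  have "(LINT t:{-R..R}|lebesgue. exp (- (\<i> * of_real \<tau> * of_real t)) * \<phi> t)
     = (LINT t:{-R..R}|lebesgue. exp (- (\<i> * of_real \<tau> * of_real t)) * f t)"
    unfolding set_lebesgue_integral_def
  proof (rule integral_cong_AE)
    show "AE t in lebesgue. indicator {-R..R} t *\<^sub>R (exp (- (\<i> * of_real \<tau> * of_real t)) * \<phi> t)
       = indicator {-R..R} t *\<^sub>R (exp (- (\<i> * of_real \<tau> * of_real t)) * f t)"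
      using AE_completion[OF ae] by eventually_elim simp
  qed measurable
  then show ?thesis by (simp add: truncated_fourier_def)
qed

text \<open>The condition \<open>0 < n\<close> concerns the zeros of \<open>f\<close>, where
  \<open>powr\<close> is zero for every exponent.\<close>

lemma Lp_integral_borel_version:
  fixes \<phi> f :: "real \<Rightarrow> complex"
  assumes [measurable]: "\<phi> \<in> borel_measurable lebesgue" "f \<in> borel_measurable borel"
    and ae: "AE t in lborel. \<phi> t = f t" and n: "0 < n"
  shows "integrable lebesgue (\<lambda>t. norm (\<phi> t) powr real n) \<longleftrightarrow> integrable lborel (\<lambda>t. norm (f t) ^ n)"
    and "(\<integral>t. norm (\<phi> t) powr real n \<partial>lebesgue) = (\<integral>t. norm (f t) ^ n \<partial>lborel)"
proof -
  have ae': "AE t in lebesgue. norm (\<phi> t) powr real n = norm (f t) ^ n"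
    using AE_completion[OF ae]
  proof eventually_elim
    case (elim t)
    then show ?case using n by (cases "f t = 0") (simp_all add: powr_realpow)
  qed
  have f: "(\<lambda>t. norm (f t) ^ n) \<in> borel_measurable lebesgue"
    by (intro measurable_completion) measurable
  have "integrable lebesgue (\<lambda>t. norm (\<phi> t) powr real n) \<longleftrightarrow> integrable lebesgue (\<lambda>t. norm (f t) ^ n)"
    by (rule integrable_cong_AE[OF _ f ae']) measurable
  also have "\<dots> \<longleftrightarrow> integrable lborel (\<lambda>t. norm (f t) ^ n)" by (rule integrable_completion) measurable
  finally show "integrable lebesgue (\<lambda>t. norm (\<phi> t) powr real n) \<longleftrightarrow> integrable lborel (\<lambda>t. norm (f t) ^ n)" .
  have "(\<integral>t. norm (\<phi> t) powr real n \<partial>lebesgue) = (\<integral>t. norm (f t) ^ n \<partial>lebesgue)"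
    by (rule integral_cong_AE[OF _ f ae']) measurable
  also have "\<dots> = (\<integral>t. norm (f t) ^ n \<partial>lborel)" by (rule integral_completion) measurable
  finally show "(\<integral>t. norm (\<phi> t) powr real n \<partial>lebesgue) = (\<integral>t. norm (f t) ^ n \<partial>lborel)" .
qed

text \<open>The choice in \<open>fourier_L2\<close> is not vacuous: the limit built for a Borel
  version serves for \<open>\<phi>\<close> as well, since truncated transforms ignore null
  sets.\<close>

lemma is_fourier_L2_fourier_L2:
  assumes "\<phi> \<in> Lp_space 2"
  shows "is_fourier_L2 \<phi> (fourier_L2 \<phi>)"
proof -
  have \<phi>: "\<phi> \<in> borel_measurable lebesgue" "integrable lebesgue (\<lambda>t. norm (\<phi> t) powr 2)"
    using assms by (auto simp: Lp_space_def)
  obtain f where f: "f \<in> borel_measurable borel" "AE t in lborel. \<phi> t = f t"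
    by (rule lebesgue_borel_version[OF \<phi>(1)])
  have f2: "integrable lborel (\<lambda>t. (norm (f t))\<^sup>2)"
    using Lp_integral_borel_version(1)[OF \<phi>(1) f, of 2] \<phi>(2) by simp
  obtain g where g: "g \<in> borel_measurable borel" "integrable lborel (\<lambda>\<tau>. (norm (g \<tau>))\<^sup>2)"
    "((\<lambda>R. \<integral>\<^sup>+\<tau>. ennreal ((norm (fourier_L1 (truncation R f) \<tau> - g \<tau>))\<^sup>2) \<partial>lborel) \<longlongrightarrow> 0) at_top"
    by (rule plancherel_limit[OF f(1) f2])
  have gl: "g \<in> borel_measurable lebesgue" using g(1) by (intro measurable_completion) simp
  have "is_fourier_L2 \<phi> g"
    unfolding is_fourier_L2_def Lp_space_def
    using gl g(3) Lp_integral_borel_version(1)[OF gl g(1), of 2] g(2)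
    by (simp add: nn_integral_completion truncated_fourier_cong_AE[OF \<phi>(1) f] truncated_fourier_eq[OF f(1)])
  then show ?thesis unfolding fourier_L2_def by (rule someI[where P = "is_fourier_L2 \<phi>"])
qed

text \<open>The chosen transform is Lebesgue measurable only. Its Borel version \<open>g\<close> is
  still the limit of the truncated transforms, so \<open>plancherel_difference\<close> applies to
  it.\<close>

lemma T_symbol_fourier_L2:
  assumes \<phi>: "\<phi> \<in> Lp_space 2" and f: "f \<in> borel_measurable borel" "AE t in lborel. \<phi> t = f t"
  shows "ennreal (2 * pi) * (\<integral>\<^sup>+\<tau>. ennreal (T_symbol \<tau> * (norm (fourier_L2 \<phi> \<tau>))\<^sup>2) \<partial>lebesgue) = sinh_energy f"
proof -
  have \<phi>m: "\<phi> \<in> borel_measurable lebesgue" "integrable lebesgue (\<lambda>t. norm (\<phi> t) powr 2)"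
    using \<phi> by (auto simp: Lp_space_def)
  have f2: "integrable lborel (\<lambda>t. (norm (f t))\<^sup>2)"
    using Lp_integral_borel_version(1)[OF \<phi>m(1) f, of 2] \<phi>m(2) by simp
  have F: "fourier_L2 \<phi> \<in> borel_measurable lebesgue" "integrable lebesgue (\<lambda>t. norm (fourier_L2 \<phi> t) powr 2)"
    "((\<lambda>R. \<integral>\<^sup>+\<tau>. ennreal ((norm (fourier_L1 (truncation R f) \<tau> - fourier_L2 \<phi> \<tau>))\<^sup>2) \<partial>lborel) \<longlongrightarrow> 0) at_top"
    using is_fourier_L2_fourier_L2[OF \<phi>] unfolding is_fourier_L2_def Lp_space_def
    by (simp_all add: nn_integral_completion truncated_fourier_cong_AE[OF \<phi>m(1) f] truncated_fourier_eq[OF f(1)])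
  obtain g where g: "g \<in> borel_measurable borel" "AE \<tau> in lborel. fourier_L2 \<phi> \<tau> = g \<tau>"
    by (rule lebesgue_borel_version[OF F(1)])
  have g2: "integrable lborel (\<lambda>t. (norm (g t))\<^sup>2)"
    using Lp_integral_borel_version(1)[OF F(1) g, of 2] F(2) by simp
  have "(\<integral>\<^sup>+\<tau>. ennreal ((norm (fourier_L1 (truncation R f) \<tau> - fourier_L2 \<phi> \<tau>))\<^sup>2) \<partial>lborel)
     = (\<integral>\<^sup>+\<tau>. ennreal ((norm (fourier_L1 (truncation R f) \<tau> - g \<tau>))\<^sup>2) \<partial>lborel)" for R
    by (rule nn_integral_cong_AE) (use g(2) in \<open>eventually_elim, simp only:\<close>)
  then have glim: "((\<lambda>R. \<integral>\<^sup>+\<tau>. ennreal ((norm (fourier_L1 (truncation R f) \<tau> - g \<tau>))\<^sup>2) \<partial>lborel) \<longlongrightarrow> 0) at_top"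
    using F(3) by simp
  have "(\<integral>\<^sup>+\<tau>. ennreal (T_symbol \<tau> * (norm (fourier_L2 \<phi> \<tau>))\<^sup>2) \<partial>lebesgue) = (\<integral>\<^sup>+\<tau>. ennreal (T_symbol \<tau> * (norm (g \<tau>))\<^sup>2) \<partial>lborel)"
    unfolding nn_integral_completion by (rule nn_integral_cong_AE) (use g(2) in \<open>eventually_elim, simp only:\<close>)
  then show ?thesis
    using T_symbol_integral_eq_sinh_energy[OF f(1) g(1) plancherel_difference[OF f(1) f2 g(1) g2 glim]] by simp
qed

text \<open>The Sobolev weight dominates the symbol, so the integral in \<open>T_form\<close> is a
  genuine value and not the default zero of the Bochner integral.\<close>

lemma T_form_eq_sinh_energy:
  assumes \<phi>: "\<phi> \<in> Sobolev_space (1 / 2)" and f: "f \<in> borel_measurable borel" "AE t in lborel. \<phi> t = f t"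
  shows "sinh_energy f = ennreal (2 * pi * T_form \<phi>)" and "0 \<le> T_form \<phi>"
proof -
  let ?G = "\<lambda>\<tau>. T_symbol \<tau> * (norm (fourier_L2 \<phi> \<tau>))\<^sup>2"
  have \<phi>2: "\<phi> \<in> Lp_space 2" and S: "integrable lebesgue (\<lambda>\<tau>. (1 + \<tau>\<^sup>2) powr (1 / 2) * (norm (fourier_L2 \<phi> \<tau>))\<^sup>2)"
    using \<phi> by (auto simp: Sobolev_space_def)
  have Fm [measurable]: "fourier_L2 \<phi> \<in> borel_measurable lebesgue"
    using is_fourier_L2_fourier_L2[OF \<phi>2] by (simp add: is_fourier_L2_def Lp_space_def)
  have Tm: "T_symbol \<in> borel_measurable lebesgue"
    by (intro measurable_completion) measurable
  have G0: "0 \<le> ?G \<tau>" for \<tau> by (simp add: T_symbol_nonneg)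
  have int: "integrable lebesgue ?G"
  proof (rule Bochner_Integration.integrable_bound[OF S])
    show "?G \<in> borel_measurable lebesgue" using Tm by measurable
    show "AE \<tau> in lebesgue. norm (?G \<tau>) \<le> norm ((1 + \<tau>\<^sup>2) powr (1 / 2) * (norm (fourier_L2 \<phi> \<tau>))\<^sup>2)"
    proof (rule AE_I2)
      fix \<tau>
      have "T_symbol \<tau> \<le> sqrt (\<tau>\<^sup>2)" using T_symbol_le[of \<tau>] by simp
      also have "\<dots> \<le> sqrt (1 + \<tau>\<^sup>2)" by (intro real_sqrt_le_mono) simp
      also have "\<dots> = (1 + \<tau>\<^sup>2) powr (1 / 2)" by (rule powr_half_sqrt[symmetric]) simp
      finally have "?G \<tau> \<le> (1 + \<tau>\<^sup>2) powr (1 / 2) * (norm (fourier_L2 \<phi> \<tau>))\<^sup>2" by (rule mult_right_mono) simp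
      then show "norm (?G \<tau>) \<le> norm ((1 + \<tau>\<^sup>2) powr (1 / 2) * (norm (fourier_L2 \<phi> \<tau>))\<^sup>2)" using G0[of \<tau>] by simp
    qed
  qed
  have "(\<integral>\<^sup>+\<tau>. ennreal (?G \<tau>) \<partial>lebesgue) = ennreal (T_form \<phi>)"
    unfolding T_form_def by (rule nn_integral_eq_integral[OF int]) (simp add: G0)
  then show "sinh_energy f = ennreal (2 * pi * T_form \<phi>)"
    using T_symbol_fourier_L2[OF \<phi>2 f] ennreal_mult'[of "2 * pi" "T_form \<phi>"] by simp
  show "0 \<le> T_form \<phi>" unfolding T_form_def by (intro Bochner_Integration.integral_nonneg G0)
qed

theorem theorem2p1:
  fixes \<phi> :: "real \<Rightarrow> complex"
  assumes "\<phi> \<in> Sobolev_space (1 / 2)"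
  shows "\<phi> \<in> Lp_space 3 \<and>
    T_form \<phi> + 2 / pi * (Lp_norm 2 \<phi>)\<^sup>2 \<ge> (pi / 2) powr (1 / 3) * (Lp_norm 3 \<phi>)\<^sup>2 \<and>
    (T_form \<phi> + 2 / pi * (Lp_norm 2 \<phi>)\<^sup>2 = (pi / 2) powr (1 / 3) * (Lp_norm 3 \<phi>)\<^sup>2 \<longleftrightarrow>
      (\<exists>(\<alpha>::real) (\<beta>::complex). AE t in lebesgue. \<phi> t = \<beta> * of_real (1 / cosh (t - \<alpha>))))"
proof -
  have \<phi>: "\<phi> \<in> borel_measurable lebesgue" "integrable lebesgue (\<lambda>t. norm (\<phi> t) powr 2)"
    using assms by (auto simp: Sobolev_space_def Lp_space_def)
  obtain f where f: "f \<in> borel_measurable borel" "AE t in lborel. \<phi> t = f t"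
    by (rule lebesgue_borel_version[OF \<phi>(1)])
  have f2: "integrable lborel (\<lambda>t. (norm (f t))\<^sup>2)"
    using Lp_integral_borel_version(1)[OF \<phi>(1) f, of 2] \<phi>(2) by simp
  note T = T_form_eq_sinh_energy[OF assms f]
  have e0: "0 \<le> 2 * pi * T_form \<phi>" using T(2) by simp
  note core = f(1) f2 T(1) e0
  define N C B where "N = (\<integral>t. (norm (f t))\<^sup>2 \<partial>lborel)" and "C = (\<integral>t. norm (f t) ^ 3 \<partial>lborel)"
    and "B = scaled_form f (2 * pi * T_form \<phi>)"
  have N0: "0 \<le> N" and C0: "0 \<le> C" by (simp_all add: N_def C_def)
  have B: "B = (2 * pi * T_form \<phi> + 4 * N) / pi\<^sup>2" unfolding B_def N_def by (rule scaled_form_def)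
  then have B0: "0 \<le> B" using e0 N0 by simp
  have L3: "\<phi> \<in> Lp_space 3"
    using \<phi>(1) Lp_integral_borel_version(1)[OF \<phi>(1) f, of 3] cube_integrable[OF core] by (simp add: Lp_space_def)
  have "(Lp_norm 2 \<phi>)\<^sup>2 = N"
    using Lp_integral_borel_version(2)[OF \<phi>(1) f, of 2] N0 by (simp add: Lp_norm_def N_def powr_half_sqrt)
  then have lhs: "T_form \<phi> + 2 / pi * (Lp_norm 2 \<phi>)\<^sup>2 = pi / 2 * B"
    unfolding B by (simp add: field_simps power2_eq_square)
  \<comment> \<open>Both sides are nonnegative and are compared through their cubes, which removes
    the fractional powers: \<open>X\<close> becomes \<open>pi / 2 * C\<^sup>2\<close>, and the two
    factors \<open>pi / 2\<close> cancel.\<close>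
  define X where "X = (pi / 2) powr (1 / 3) * (Lp_norm 3 \<phi>)\<^sup>2"
  have "Lp_norm 3 \<phi> = C powr (1 / 3)"
    using Lp_integral_borel_version(2)[OF \<phi>(1) f, of 3] by (simp add: Lp_norm_def C_def)
  moreover have "(y\<^sup>2) ^ 3 = (y ^ 3)\<^sup>2" for y :: real by (simp flip: power_mult)
  ultimately have X3: "X ^ 3 = pi / 2 * C\<^sup>2"
    using C0 by (simp only: X_def power_mult_distrib cube_root_cubed) (simp add: cube_root_cubed)
  have X0: "0 \<le> X" by (simp add: X_def)
  have Y3: "(pi / 2 * B) ^ 3 = pi / 2 * ((pi / 2)\<^sup>2 * B ^ 3)"
    by (simp add: power_mult_distrib power2_eq_square power3_eq_cube)
  have "X ^ 3 \<le> (pi / 2 * B) ^ 3"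
    unfolding X3 Y3 using cube_integral_square_le[OF core] by (simp add: C_def B_def)
  then have le: "X \<le> pi / 2 * B"
    by (subst (asm) power_mono_iff) (use X0 B0 in auto)
  have "pi / 2 * B = X \<longleftrightarrow> (pi / 2 * B) ^ 3 = X ^ 3"
    using power_eq_imp_eq_base[of "pi / 2 * B" 3 X] B0 X0 by auto
  also have "\<dots> \<longleftrightarrow> C\<^sup>2 = (pi / 2)\<^sup>2 * B ^ 3" unfolding X3 Y3 by auto
  also have "\<dots> \<longleftrightarrow> (\<exists>\<alpha> \<beta>. AE t in lborel. f t = \<beta> * of_real (1 / cosh (t - \<alpha>)))"
    unfolding C_def B_def using cube_integral_square_eq_imp[OF core] cube_integral_square_eqI[OF core] by blast
  also have "\<dots> \<longleftrightarrow> (\<exists>\<alpha> \<beta>. AE t in lebesgue. \<phi> t = \<beta> * of_real (1 / cosh (t - \<alpha>)))"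
  proof -
    \<comment> \<open>Completion keeps the almost-everywhere filter, so the extremal form may be
      tested on either representative.\<close>
    have "(AE t in lebesgue. \<phi> t = h t) \<longleftrightarrow> (AE t in lborel. f t = h t)" for h
      unfolding AE_completion_iff using f(2) by (auto elim: eventually_elim2)
    then show ?thesis by simp
  qed
  finally show ?thesis using L3 le unfolding lhs X_def by simp
qed

end
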